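(* Let $M$ be a regular irreducible algebraic submonoid of $M_n(\mathbb{C})$ and let $e\in M$ be an idempotent. Let $\mathsf{G}_e^l=\{\mathsf{R}(x): x\in D_e^M\}$ and $\mathsf{G}_e^r=\{\mathsf{N}(x): x\in D_e^M\}$. Then: (1) $\dim E(L_e^M)=\dim \mathsf{G}_e^r$; (2) $\dim E(R_e^M)=\dim \mathsf{G}_e^l$.
   Context: $M_n(\mathbb{C})$ is the multiplicative monoid of $n\times n$ complex matrices, identified with $\mathbb{C}^{n^2}$. An algebraic submonoid $M$ of $M_n(\mathbb{C})$ is a submonoid (containing the identity matrix) that is the zero set of a collection of polynomials in the matrix entries; it is irreducible if it is not the union of two proper algebraic subsets, and regular if for every $a\in M$ there is $x\in M$ with $axa=a$. Green's relations in $M$: $a\,\mathscr L^M\, b$ iff $Ma=Mb$; $a\,\mathscr R^M\, b$ iff $aM=bM$; $\mathscr D^M$ is the smallest equivalence relation containing both; $L_e^M,R_e^M,D_e^M$ are the corresponding classes of $e$. $E(T)$ denotes the set of idempotents in $T$. Matrices act on the right on the space $V=\mathbb{C}^n$ of row vectors: $\mathsf{R}(x)=\{vx: v\in V\}$ is the range (row space) and $\mathsf{N}(x)=\{v\in V: vx=0\}$ the null space. With $k=\operatorname{Rank}(e)$, $\mathsf{G}_e^l$ is a submanifold of the Grassmann manifold $\mathsf{G}_k$ of $k$-dimensional subspaces of $V$, and $\mathsf{G}_e^r$ is a submanifold of $\mathsf{G}_{n-k}$; $E(L_e^M)$ and $E(R_e^M)$ are submanifolds of $M_n(\mathbb{C})$.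 All topological terms refer to the euclidean topology; manifolds are complex analytic, submanifolds are embedded, and $\dim$ is the (complex) dimension as a manifold. *)

theory Defs
  imports "HOL-Analysis.Analysis"
begin

section \<open>Algebraic sets and algebraic monoids of matrices\<close>

text \<open>Polynomials in the matrix entries, given as functions; as the complex field is infinite this
  loses nothing.\<close>

inductive entry_polynomial :: "(complex^'n^'n \<Rightarrow> complex) \<Rightarrow> bool" where
  entry: "entry_polynomial (\<lambda>x. x $ i $ j)"
| const: "entry_polynomial (\<lambda>x. c)"
| add: "entry_polynomial p \<Longrightarrow> entry_polynomial q \<Longrightarrow> entry_polynomial (\<lambda>x. p x + q x)"
| mult: "entry_polynomial p \<Longrightarrow> entry_polynomial q \<Longrightarrow> entry_polynomial (\<lambda>x. p x * q x)"

definition algebraic_set :: "(complex^'n^'n) set \<Rightarrow> bool" where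
  "algebraic_set S \<longleftrightarrow>
     (\<exists>P. (\<forall>p\<in>P. entry_polynomial p) \<and> S = {x. \<forall>p\<in>P. p x = 0})"

definition irreducible_set :: "(complex^'n^'n) set \<Rightarrow> bool" where
  "irreducible_set S \<longleftrightarrow>
     (\<nexists>A B. algebraic_set A \<and> algebraic_set B \<and> A \<subset> S \<and> B \<subset> S \<and> S = A \<union> B)"

definition matrix_submonoid :: "(complex^'n^'n) set \<Rightarrow> bool" where
  "matrix_submonoid M \<longleftrightarrow> mat 1 \<in> M \<and> (\<forall>x\<in>M. \<forall>y\<in>M. x ** y \<in> M)"

definition algebraic_submonoid :: "(complex^'n^'n) set \<Rightarrow> bool" where
  "algebraic_submonoid M \<longleftrightarrow> matrix_submonoid M \<and> algebraic_set M"

definition regular_monoid :: "(complex^'n^'n) set \<Rightarrow> bool" where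
  "regular_monoid M \<longleftrightarrow> (\<forall>a\<in>M. \<exists>x\<in>M. a ** x ** a = a)"

definition idempotents :: "(complex^'n^'n) set \<Rightarrow> (complex^'n^'n) set" where
  "idempotents T = {x \<in> T. x ** x = x}"


section \<open>Green's relations\<close>

definition green_L :: "(complex^'n^'n) set \<Rightarrow> (complex^'n^'n) rel" where
  "green_L M = {(a, b). a \<in> M \<and> b \<in> M \<and> {x ** a | x. x \<in> M} = {x ** b | x. x \<in> M}}"

definition green_R :: "(complex^'n^'n) set \<Rightarrow> (complex^'n^'n) rel" where
  "green_R M = {(a, b). a \<in> M \<and> b \<in> M \<and> {a ** x | x. x \<in> M} = {b ** x | x. x \<in> M}}"

definition green_D :: "(complex^'n^'n) set \<Rightarrow> (complex^'n^'n) rel" where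
  "green_D M = \<Inter> {r. equiv M r \<and> green_L M \<subseteq> r \<and> green_R M \<subseteq> r}"

definition L_class :: "(complex^'n^'n) set \<Rightarrow> complex^'n^'n \<Rightarrow> (complex^'n^'n) set" where
  "L_class M e = green_L M `` {e}"

definition R_class :: "(complex^'n^'n) set \<Rightarrow> complex^'n^'n \<Rightarrow> (complex^'n^'n) set" where
  "R_class M e = green_R M `` {e}"

definition D_class :: "(complex^'n^'n) set \<Rightarrow> complex^'n^'n \<Rightarrow> (complex^'n^'n) set" where
  "D_class M e = green_D M `` {e}"


section \<open>Complex manifolds and embedded submanifolds\<close>

definition coord_space :: "'i set \<Rightarrow> (complex^'i) set" where
  "coord_space J = {y. \<forall>i. i \<notin> J \<longrightarrow> y $ i = 0}"

text \<open>A chart \<open>(J, U, \<phi>)\<close> has domain \<open>U\<close> and takes values in the coordinate space \<open>\<complex>\<^sup>J\<close>, which is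
  realised inside \<open>complex^'i\<close>. The index set \<open>J\<close> is part of the chart because the dimension of a
  Grassmann manifold is not the cardinality of a type. A manifold is a carrier with an atlas.\<close>

type_synonym ('p, 'i) chart = "'i set \<times> 'p set \<times> ('p \<Rightarrow> complex^'i)"
type_synonym ('p, 'i) manifold = "'p set \<times> ('p, 'i) chart set"

definition chart_on :: "'p set \<Rightarrow> ('p, 'i::finite) chart \<Rightarrow> bool" where
  "chart_on X = (\<lambda>(J, U, \<phi>).
     U \<subseteq> X \<and> inj_on \<phi> U \<and> openin (top_of_set (coord_space J)) (\<phi> ` U))"

text \<open>Used below only for relatively open subsets \<open>S\<close> of \<open>coord_space J\<close>. The derivative within
  \<open>coord_space J\<close> only sees vectors of \<open>coord_space J\<close>; the values of \<open>f'\<close> elsewhere are irrelevant,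
  and every complex linear map on \<open>coord_space J\<close> extends to a complex linear \<open>f'\<close>.\<close>

definition holomorphic_map ::
    "'i set \<Rightarrow> (complex^'i) set \<Rightarrow> (complex^'i \<Rightarrow> complex^'i::finite) \<Rightarrow> bool" where
  "holomorphic_map J S f \<longleftrightarrow>
     (\<forall>x\<in>S. \<exists>f'. Vector_Spaces.linear (*s) (*s) f' \<and>
                  (f has_derivative f') (at x within coord_space J))"

definition chart_compatible :: "('p, 'i::finite) chart \<Rightarrow> ('p, 'i) chart \<Rightarrow> bool" where
  "chart_compatible = (\<lambda>(J, U, \<phi>) (K, V, \<psi>).
     openin (top_of_set (coord_space J)) (\<phi> ` (U \<inter> V)) \<and>
     openin (top_of_set (coord_space K)) (\<psi> ` (U \<inter> V)) \<and>
     holomorphic_map J (\<phi> ` (U \<inter> V)) (\<psi> \<circ> inv_into U \<phi>) \<and>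
     holomorphic_map K (\<psi> ` (U \<inter> V)) (\<phi> \<circ> inv_into V \<psi>))"

definition maximal_atlas :: "('p, 'i::finite) manifold \<Rightarrow> ('p, 'i) chart set" where
  "maximal_atlas = (\<lambda>(X, A). {c. chart_on X c \<and> (\<forall>c'\<in>A. chart_compatible c c')})"

text \<open>Slice charts, with the same dimension \<open>d\<close> at all points.\<close>

definition embedded_submanifold ::
    "('p, 'i::finite) manifold \<Rightarrow> nat \<Rightarrow> 'p set \<Rightarrow> bool" where
  "embedded_submanifold X d S \<longleftrightarrow>
     S \<subseteq> fst X \<and>
     (\<forall>p\<in>S. \<exists>J U \<phi> K. (J, U, \<phi>) \<in> maximal_atlas X \<and> p \<in> U \<and>
        K \<subseteq> J \<and> card K = d \<and> \<phi> ` (U \<inter> S) = \<phi> ` U \<inter> coord_space K)"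

definition is_submanifold :: "('p, 'i::finite) manifold \<Rightarrow> 'p set \<Rightarrow> bool" where
  "is_submanifold X S \<longleftrightarrow> (\<exists>d. embedded_submanifold X d S)"

text \<open>Meaningful for nonempty submanifolds, where the dimension exists and is unique.\<close>

definition manifold_dim :: "('p, 'i::finite) manifold \<Rightarrow> 'p set \<Rightarrow> nat" where
  "manifold_dim X S = (THE d. embedded_submanifold X d S)"


section \<open>The matrix space and the Grassmann manifolds\<close>

definition matrix_manifold :: "(complex^'n^'n, 'n \<times> 'n) manifold" where
  "matrix_manifold = (UNIV, {(UNIV, UNIV, \<lambda>x. \<chi> p. x $ fst p $ snd p)})"

definition grassmannian :: "nat \<Rightarrow> (complex^'n) set set" where
  "grassmannian k = {W. vec.subspace W \<and> vec.dim W = k}"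

text \<open>The standard atlas. If \<open>card I = k\<close>, a \<open>k\<close>-dimensional subspace meeting \<open>coord_space (- I)\<close>
  trivially is the graph of a unique linear map from \<open>coord_space I\<close> to \<open>coord_space (- I)\<close>; its
  coordinates are the entries of the matrix of that map, indexed by \<open>I \<times> - I\<close> and acting on
  row vectors.\<close>

definition graph_subspace :: "'n set \<Rightarrow> complex^('n \<times> 'n) \<Rightarrow> (complex^'n::finite) set" where
  "graph_subspace I A = {v. \<forall>j. j \<notin> I \<longrightarrow> v $ j = (\<Sum>i\<in>I. v $ i * A $ (i, j))}"

definition grassmann_chart :: "nat \<Rightarrow> 'n set \<Rightarrow> ((complex^'n::finite) set, 'n \<times> 'n) chart" where
  "grassmann_chart k I =
     (I \<times> - I,
      {W \<in> grassmannian k. W \<inter> coord_space (- I) = {0}},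
      \<lambda>W. THE A. A \<in> coord_space (I \<times> - I) \<and> W = graph_subspace I A)"

definition grassmann_manifold :: "nat \<Rightarrow> ((complex^'n::finite) set, 'n \<times> 'n) manifold" where
  "grassmann_manifold k = (grassmannian k, grassmann_chart k ` {I. card I = k})"


section \<open>Range and null space for the right action on row vectors\<close>

definition range_space :: "complex^'n^'n \<Rightarrow> (complex^'n) set" where
  "range_space x = {v v* x | v. True}"

definition null_space :: "complex^'n^'n \<Rightarrow> (complex^'n) set" where
  "null_space x = {v. v v* x = 0}"

definition G_l :: "(complex^'n^'n) set \<Rightarrow> complex^'n^'n \<Rightarrow> (complex^'n) set set" where
  "G_l M e = {range_space x | x. x \<in> D_class M e}"

definition G_r :: "(complex^'n^'n) set \<Rightarrow> complex^'n^'n \<Rightarrow> (complex^'n) set set" where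
  "G_r M e = {null_space x | x. x \<in> D_class M e}"

end

theory Submission
  imports Defs "HOL-Complex_Analysis.Cauchy_Integral_Formula"
begin

text \<open>An idempotent \<open>f\<close> is L-related to \<open>e\<close> exactly if \<open>f ** e = f\<close> and \<open>e ** f = e\<close>; it has the range
  of \<open>e\<close> and is determined by its null space, a complement of that range. The complements of the range
  of \<open>e\<close> form an affine chart of the Grassmann manifold in which the coordinates of the null space of \<open>f\<close>
  are, in a suitable basis and up to sign, the entries of \<open>f - e\<close>. Conversely, by regularity
  of \<open>M\<close>, every member of \<open>G_r M e\<close> in this chart is the null space of such an idempotent
  (\<open>idempotent_slice\<close>). So in suitable coordinates the idempotents of the L-class and the part of \<open>G_r M e\<close> in this chart are the same algebraic set \<open>A\<close>,
  and everything reduces to showing that \<open>A\<close> and \<open>G_r M e\<close> are smooth of one constant dimension.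

  Some point of \<open>A\<close> is smooth, and so is every point of \<open>A\<close> where a certain polynomial \<open>\<delta>\<close> does not vanish
  (\<open>smooth_locus\<close>). This spreads to all points by homogeneity. An invertible element of \<open>M\<close> has its
  inverse in \<open>M\<close> because \<open>M\<close> is regular, and the units are Zariski dense in \<open>M\<close> because \<open>M\<close> is
  irreducible; they act on \<open>G_r M e\<close> by automorphisms of the Grassmann manifold. Density takes the
  place of transitivity of this action: given \<open>y\<close> in the L-class of \<open>e\<close> and a good point \<open>u\<close> of \<open>A\<close>, some
  element of \<open>M\<close> sends \<open>y\<close> to \<open>u\<close>, hence by density some unit moves the null space of \<open>y\<close> to a point of
  \<open>A\<close> where \<open>\<delta>\<close> does not vanish (\<open>generic_unit_left\<close>). So \<open>G_r M e\<close> is a submanifold of constant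
  dimension, and \<open>A\<close>, being an open part of it in coordinates, is one of the same dimension
  (\<open>homogeneous_family\<close>, \<open>family_submanifolds\<close>). That the dimension is well defined follows from
  invariance of dimension (\<open>manifold_dim_eqI\<close>). The statement on R-classes and ranges is obtained in the
  same way; the facts about the monoid are transferred by passing to the transposed matrices.\<close>

section \<open>Polynomial functions\<close>

text \<open>The counterpart of \<open>entry_polynomial\<close> for functions of a vector: charts take values in
  coordinate vectors, and it is there that gradients and Jacobians are taken.\<close>

inductive poly_fun :: "(complex^'i \<Rightarrow> complex) \<Rightarrow> bool" where
  coord: "poly_fun (\<lambda>x. x $ i)"
| const: "poly_fun (\<lambda>x. c)"
| add: "poly_fun p \<Longrightarrow> poly_fun q \<Longrightarrow> poly_fun (\<lambda>x. p x + q x)"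
| mult: "poly_fun p \<Longrightarrow> poly_fun q \<Longrightarrow> poly_fun (\<lambda>x. p x * q x)"

lemma poly_fun_sum: "(\<And>i. i \<in> S \<Longrightarrow> poly_fun (\<lambda>x. p i x)) \<Longrightarrow> poly_fun (\<lambda>x. \<Sum>i\<in>S. p i x)"
  by (induction S rule: infinite_finite_induct) (auto intro: poly_fun.intros)

lemma poly_fun_prod: "(\<And>i. i \<in> S \<Longrightarrow> poly_fun (\<lambda>x. p i x)) \<Longrightarrow> poly_fun (\<lambda>x. \<Prod>i\<in>S. p i x)"
  by (induction S rule: infinite_finite_induct) (auto intro: poly_fun.intros)

lemma poly_fun_minus: "poly_fun p \<Longrightarrow> poly_fun (\<lambda>x. - p x)"
  using poly_fun.mult[OF poly_fun.const[of "-1"]] by simp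

lemma poly_fun_diff: "poly_fun p \<Longrightarrow> poly_fun q \<Longrightarrow> poly_fun (\<lambda>x. p x - q x)"
  using poly_fun.add[OF _ poly_fun_minus, of p q] by simp

lemmas poly_fun_intros =
  poly_fun.intros poly_fun_sum poly_fun_prod poly_fun_minus poly_fun_diff

lemma poly_fun_det:
  "(\<And>i j. poly_fun (\<lambda>x. A x $ i $ j)) \<Longrightarrow> poly_fun (\<lambda>x. det (A x))"
  unfolding det_def by (intro poly_fun_intros)

lemma poly_fun_if: "(b \<Longrightarrow> poly_fun p) \<Longrightarrow> (\<not> b \<Longrightarrow> poly_fun q) \<Longrightarrow> poly_fun (\<lambda>x. if b then p x else q x)"
  by (cases b) auto

lemma poly_fun_continuous: "poly_fun p \<Longrightarrow> continuous_on S p"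
  by (induction rule: poly_fun.induct) (auto intro!: continuous_intros)

lemma poly_fun_gradient:
  "poly_fun p \<Longrightarrow> \<exists>P. (\<forall>j. poly_fun (P j)) \<and>
     (\<forall>x. (p has_derivative (\<lambda>h. \<Sum>j\<in>UNIV. P j x * h $ j)) (at x))"
proof (induction rule: poly_fun.induct)
  case (coord i)
  have "((\<lambda>x::complex^'a. x $ i) has_derivative (\<lambda>h. \<Sum>j\<in>UNIV. (if j = i then 1 else 0) * h $ j)) (at x)" for x
    by (simp add: if_distrib[of "\<lambda>c. c * _"] cong: if_cong)
       (rule bounded_linear_imp_has_derivative, rule bounded_linear_vec_nth)
  then show ?case
    by (intro exI[of _ "\<lambda>j x. if j = i then 1 else 0"]) (auto intro: poly_fun.const)
next
  case (const c)
  show ?case by (intro exI[of _ "\<lambda>j x. 0"]) (auto intro: poly_fun.const)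
next
  case (add p q)
  then obtain P Q where P: "\<And>j. poly_fun (P j)" "\<And>x. (p has_derivative (\<lambda>h. \<Sum>j\<in>UNIV. P j x * h $ j)) (at x)"
    and Q: "\<And>j. poly_fun (Q j)" "\<And>x. (q has_derivative (\<lambda>h. \<Sum>j\<in>UNIV. Q j x * h $ j)) (at x)" by blast
  show ?case
    by (intro exI[of _ "\<lambda>j x. P j x + Q j x"] conjI allI poly_fun.add P(1) Q(1)
          has_derivative_eq_rhs[OF has_derivative_add[OF P(2) Q(2)]])
       (simp add: sum.distrib algebra_simps)
next
  case (mult p q)
  then obtain P Q where P: "\<And>j. poly_fun (P j)" "\<And>x. (p has_derivative (\<lambda>h. \<Sum>j\<in>UNIV. P j x * h $ j)) (at x)"
    and Q: "\<And>j. poly_fun (Q j)" "\<And>x. (q has_derivative (\<lambda>h. \<Sum>j\<in>UNIV. Q j x * h $ j)) (at x)" by blast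
  show ?case
    by (intro exI[of _ "\<lambda>j x. p x * Q j x + P j x * q x"] conjI allI poly_fun.add poly_fun.mult P(1) Q(1) mult(1,2)
          has_derivative_eq_rhs[OF has_derivative_mult[OF P(2) Q(2)]])
       (simp add: sum.distrib algebra_simps sum_distrib_left)
qed

section \<open>Local inverses\<close>

lemma matrix_inv_props:
  fixes A :: "complex^'i^'i"
  assumes "det A \<noteq> 0"
  shows "A ** matrix_inv A = mat 1" "matrix_inv A ** A = mat 1"
  using someI_ex[of "\<lambda>B. A ** B = mat 1 \<and> B ** A = mat 1"] assms
  by (auto simp: matrix_inv_def invertible_det_nz[symmetric] invertible_def)

lemma bounded_linear_matrix:
  fixes A :: "complex^'i^'i"
  shows "bounded_linear ((*v) A)"
proof -
  have "linear ((*v) A)"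
    by (rule linearI)
       (auto simp: vec_eq_iff matrix_vector_mult_def scaleR_sum_right sum.distrib algebra_simps)
  then show ?thesis by (simp add: linear_conv_bounded_linear)
qed

text \<open>The inverse function theorem, with the neighbourhood cut down so that its image is a ball: the
  segments from the centre of the ball then lift to curves through \<open>a\<close>.\<close>

lemma local_inverse_ball:
  fixes f :: "complex^'i \<Rightarrow> complex^'i" and Df :: "complex^'i \<Rightarrow> complex^'i^'i"
  assumes der: "\<And>x. (f has_derivative ((*v) (Df x))) (at x)"
    and cont: "\<And>i j. continuous_on UNIV (\<lambda>x. Df x $ i $ j)"
    and det: "det (Df a) \<noteq> 0" and N: "open N" "a \<in> N"
  obtains r g U where "r > 0" "open U" "a \<in> U" "U \<subseteq> N" "f ` U = ball (f a) r"
    "\<And>x. x \<in> U \<Longrightarrow> g (f x) = x"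
    "\<And>y. y \<in> ball (f a) r \<Longrightarrow> g y \<in> U"
    "\<And>y. y \<in> ball (f a) r \<Longrightarrow> f (g y) = y"
    "\<And>y. y \<in> ball (f a) r \<Longrightarrow> det (Df (g y)) \<noteq> 0"
    "\<And>y. y \<in> ball (f a) r \<Longrightarrow> (g has_derivative ((*v) (matrix_inv (Df (g y))))) (at y)"
proof -
  let ?F = "\<lambda>x. Blinfun ((*v) (Df x))"
  have F: "blinfun_apply (?F x) = (*v) (Df x)" for x
    by (simp add: bounded_linear_Blinfun_apply bounded_linear_matrix)
  have contF: "continuous_on UNIV ?F"
  proof (rule continuous_on_blinfun_componentwise)
    fix v :: "complex^'i"
    show "continuous_on UNIV (\<lambda>x. blinfun_apply (?F x) v)"
      unfolding F matrix_vector_mult_def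
      by (intro continuous_on_vec_lambda continuous_on_sum continuous_on_mult cont continuous_on_const)
  qed
  let ?inv = "Blinfun ((*v) (matrix_inv (Df a)))"
  have "?inv o\<^sub>L ?F a = id_blinfun"
    by (rule blinfun_eqI)
       (simp add: F bounded_linear_Blinfun_apply bounded_linear_matrix matrix_vector_mul_assoc matrix_inv_props det)
  from inverse_function_theorem[OF N(1) _ continuous_on_subset[OF contF] N(2) this, of f] der
  obtain U' V g g' where *: "open U'" "U' \<subseteq> N" "a \<in> U'" "open V" "f a \<in> V" "homeomorphism U' V f g"
    "\<And>y. y \<in> V \<Longrightarrow> (g has_derivative (g' y)) (at y)"
    "\<And>y. y \<in> V \<Longrightarrow> g' y = inv ((*v) (Df (g y)))"
    "\<And>y. y \<in> V \<Longrightarrow> bij ((*v) (Df (g y)))"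
    unfolding F by (metis subset_UNIV)
  obtain r where r: "r > 0" "ball (f a) r \<subseteq> V" using *(4,5) open_contains_ball by blast
  let ?B = "ball (f a) r"
  have gB: "g ` ?B = U' \<inter> f -` ?B"
    using *(6) r(2) by (force simp: homeomorphism_def)
  have contf: "continuous_on UNIV f"
    using der by (meson continuous_at_imp_continuous_on has_derivative_continuous)
  have openU: "open (g ` ?B)"
    unfolding gB by (intro open_Int * open_vimage contf open_ball)
  have det': "det (Df (g y)) \<noteq> 0" if "y \<in> V" for y
  proof -
    have "inj ((*v) (Df (g y)))" using *(9)[OF that] by (simp add: bij_is_inj)
    then show ?thesis using det_nz_iff_inj_gen[of "(*v) (Df (g y))"] by (auto simp: matrix_vector_mul_linear_gen)
  qed
  have inv': "g' y = (*v) (matrix_inv (Df (g y)))" if "y \<in> V" for y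
    unfolding *(8)[OF that]
    by (rule inv_unique_comp)
       (auto simp: fun_eq_iff matrix_vector_mul_assoc matrix_inv_props det' that)
  show ?thesis
  proof (rule that[of r "g ` ?B" g])
    show "g y \<in> g ` ?B" if "y \<in> ?B" for y using that by blast
    show "f ` g ` ?B = ?B" "\<And>x. x \<in> g ` ?B \<Longrightarrow> g (f x) = x" "\<And>y. y \<in> ?B \<Longrightarrow> f (g y) = y"
      using *(6) r(2) unfolding homeomorphism_def by (force simp: image_image)+
    show "a \<in> g ` ?B" unfolding gB using *(3) r by auto
  qed (use openU r *(2) gB det' inv' *(7) in \<open>auto simp: subset_iff\<close>)
qed

text \<open>Pairing a row with the solution \<open>v\<close> of \<open>A *v v = w\<close> is, up to \<open>det A\<close>, a combination of the
  determinants in which that row replaces a row of \<open>A\<close>. The right-hand side needs no inverse, so it is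
  polynomial in \<open>A\<close> and \<open>b\<close>; this is what keeps the ideal argument in the proof of \<open>smooth_locus\<close>
  inside the polynomials.\<close>

lemma cramer_row_pairing:
  fixes A :: "complex^'i^'i"
  assumes "det A \<noteq> 0"
  shows "det A * (\<Sum>j\<in>UNIV. b $ j * (matrix_inv A *v w) $ j)
       = (\<Sum>k\<in>UNIV. w $ k * det (\<chi> i. if i = k then b else A $ i))"
proof -
  define r where "r = b v* matrix_inv A"
  define v where "v = matrix_inv A *v w"
  have w: "w = A *v v"
    unfolding v_def by (simp add: matrix_vector_mul_assoc matrix_inv_props assms)
  have b: "b = r v* A"
    unfolding r_def by (simp add: vector_matrix_mul_assoc matrix_inv_props assms)
  have "b = (\<Sum>i\<in>UNIV. r $ i *s row i A)"
    by (subst b) (simp add: vec_eq_iff vector_matrix_mult_def row_def mult.commute)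
  then have k: "det (\<chi> i. if i = k then b else A $ i) = r $ k * det A" for k
    using cramer_lemma_transpose[of k r A] by (simp add: row_def cong: if_cong)
  have "(\<Sum>j\<in>UNIV. b $ j * v $ j) = (\<Sum>k\<in>UNIV. r $ k * w $ k)"
    unfolding b w
    by (simp add: vector_matrix_mult_def matrix_vector_mult_def sum_distrib_left sum_distrib_right)
       (subst sum.swap, simp add: mult_ac)
  then show ?thesis
    unfolding k v_def[symmetric] by (simp add: sum_distrib_left mult_ac)
qed

section \<open>Holomorphic maps between coordinate spaces\<close>

lemma holomorphic_mapI_at:
  assumes "\<And>x. x \<in> S \<Longrightarrow> (f has_derivative ((*v) (D x))) (at x)"
  shows "holomorphic_map J S f"
  unfolding holomorphic_map_def
  using assms has_derivative_at_withinI matrix_vector_mul_linear_gen by blast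

definition biholomorphic_on ::
    "'i::finite set \<Rightarrow> (complex^'i) set \<Rightarrow> (complex^'i \<Rightarrow> complex^'i) \<Rightarrow> (complex^'i \<Rightarrow> complex^'i) \<Rightarrow> bool" where
  "biholomorphic_on J U \<phi> \<psi> \<longleftrightarrow>
     openin (top_of_set (coord_space J)) U \<and> openin (top_of_set (coord_space J)) (\<phi> ` U) \<and>
     (\<forall>x\<in>U. \<psi> (\<phi> x) = x) \<and> holomorphic_map J U \<phi> \<and> holomorphic_map J (\<phi> ` U) \<psi>"

text \<open>The coordinate form of being an embedded submanifold of dimension \<open>d\<close> near one point: a
  holomorphic change of coordinates of \<open>\<complex>\<^sup>J\<close> carries \<open>S\<close> to a coordinate subspace.\<close>

definition local_slice ::
    "'i::finite set \<Rightarrow> nat \<Rightarrow> (complex^'i) set \<Rightarrow> complex^'i \<Rightarrow> bool" where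
  "local_slice J d S a \<longleftrightarrow>
     (\<exists>U \<phi> \<psi> K. a \<in> U \<and> biholomorphic_on J U \<phi> \<psi> \<and> K \<subseteq> J \<and> card K = d \<and>
        \<phi> ` (U \<inter> S) = \<phi> ` U \<inter> coord_space K)"

section \<open>The smooth locus of an algebraic set\<close>

text \<open>A family of functions that all vanish at one point and is closed under differentiation up to
  holomorphic factors vanishes identically: by Leibniz' rule and induction on the order, every
  derivative of every member is zero at that point.\<close>

lemma holomorphic_family_vanishes:
  assumes T: "open T" "connected T" "z \<in> T"
    and hol: "\<And>h. h \<in> H \<Longrightarrow> h holomorphic_on T" and zero: "\<And>h. h \<in> H \<Longrightarrow> h z = 0"
    and der: "\<And>h. h \<in> H \<Longrightarrow> \<exists>k\<in>H. \<exists>u. u holomorphic_on T \<and> (\<forall>t\<in>T. deriv h t = u t * k t)"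
    and "h \<in> H" "t \<in> T"
  shows "h t = 0"
proof -
  have "\<forall>h\<in>H. (deriv ^^ n) h z = 0" for n
  proof (induction n rule: less_induct)
    case (less n)
    show ?case
    proof
      fix h assume h: "h \<in> H"
      show "(deriv ^^ n) h z = 0"
      proof (cases n)
        case 0
        then show ?thesis using zero h by simp
      next
        case (Suc m)
        obtain k u where ku: "k \<in> H" "u holomorphic_on T" "\<And>t. t \<in> T \<Longrightarrow> deriv h t = u t * k t"
          using der[OF h] by blast
        have "(deriv ^^ n) h z = (deriv ^^ m) (deriv h) z"
          by (simp add: Suc funpow_Suc_right del: funpow.simps)
        also have "\<dots> = (deriv ^^ m) (\<lambda>t. u t * k t) z"
          by (rule higher_deriv_transform_within_open[of _ T])
             (use T ku hol h in \<open>auto intro!: holomorphic_intros holomorphic_deriv\<close>)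
        also have "\<dots> = (\<Sum>i = 0..m. of_nat (m choose i) * (deriv ^^ i) u z * (deriv ^^ (m - i)) k z)"
          by (rule higher_deriv_mult[of _ T]) (use T ku hol in auto)
        also have "\<dots> = 0"
          using less ku(1) by (intro sum.neutral) (auto simp: Suc)
        finally show ?thesis .
      qed
    qed
  qed
  then show ?thesis
    using holomorphic_fun_eq_0_on_connected[of h T z t] T hol assms(7,8) by blast
qed

text \<open>Chosen rather than computed: all that matters is that the partial derivatives of a polynomial are
  again polynomials.\<close>

definition gradient :: "(complex^'i \<Rightarrow> complex) \<Rightarrow> 'i \<Rightarrow> complex^'i \<Rightarrow> complex" where
  "gradient p = (SOME P. (\<forall>j. poly_fun (P j)) \<and>
     (\<forall>x. (p has_derivative (\<lambda>h. \<Sum>j\<in>UNIV. P j x * h $ j)) (at x)))"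

lemma gradient:
  assumes "poly_fun p"
  shows "poly_fun (gradient p j)"
    "(p has_derivative (\<lambda>h. \<Sum>j\<in>UNIV. gradient p j x * h $ j)) (at x)"
  using someI_ex[OF poly_fun_gradient[OF assms]] unfolding gradient_def by blast+

text \<open>The Jacobian of the map that replaces the coordinates \<open>x\<^sub>i\<close>, \<open>i \<in> C\<close>, by \<open>p\<^sub>i\<close> and keeps the others.
  Its determinant is the minor of the functions \<open>p\<^sub>i\<close> with respect to the variables in \<open>C\<close>.\<close>

definition jacobi_matrix :: "'i set \<Rightarrow> ('i \<Rightarrow> complex^'i \<Rightarrow> complex) \<Rightarrow> complex^'i \<Rightarrow> complex^'i^'i" where
  "jacobi_matrix C p x = (\<chi> i j. if i \<in> C then gradient (p i) j x else if i = j then 1 else 0)"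

lemma poly_fun_jacobi_matrix:
  "(\<And>i. i \<in> C \<Longrightarrow> poly_fun (p i)) \<Longrightarrow> poly_fun (\<lambda>x. jacobi_matrix C p x $ i $ j)"
  unfolding jacobi_matrix_def by (cases "i \<in> C") (auto intro: gradient poly_fun.const poly_fun_if)

lemma has_derivative_vecI:
  fixes f :: "_ \<Rightarrow> complex^'i"
  assumes "\<And>i. ((\<lambda>x. f x $ i) has_derivative (\<lambda>h. f' h $ i)) (at x within S)"
  shows "(f has_derivative f') (at x within S)"
  unfolding has_derivative_componentwise_within[of f]
proof
  fix b :: "complex^'i" assume "b \<in> Basis"
  then obtain i u where b: "b = axis i u" by (auto simp: Basis_vec_def)
  show "((\<lambda>x. f x \<bullet> b) has_derivative (\<lambda>h. f' h \<bullet> b)) (at x within S)"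
    unfolding b inner_axis by (intro has_derivative_inner_left assms)
qed

text \<open>An algebraic set is smooth of constant dimension wherever a minor of maximal size of its ideal is
  nonzero. Choose functions \<open>p\<^sub>i\<close> (\<open>i \<in> C\<close>) of the ideal whose minor \<open>\<delta>\<close> is nonzero somewhere on \<open>A\<close>,
  with \<open>card C\<close> as large as possible. Near a point \<open>a \<in> A\<close> with \<open>\<delta> a \<noteq> 0\<close> the functions \<open>p\<^sub>i\<close> and the
  remaining coordinates form a chart, and \<open>A\<close> lies in the slice where all \<open>p\<^sub>i\<close> vanish. Conversely, let
  \<open>\<gamma>\<close> be the preimage of a segment in that slice starting at \<open>a\<close>. For \<open>q\<close> in the ideal, the derivative
  of \<open>q \<circ> \<gamma>\<close> times \<open>\<delta> \<circ> \<gamma>\<close> is a combination of minors of size \<open>card C + 1\<close> by \<open>cramer_row_pairing\<close>.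
  By maximality these minors vanish on \<open>A\<close>, that is, they belong to the ideal again. Hence
  \<open>holomorphic_family_vanishes\<close> applies to the functions \<open>q \<circ> \<gamma>\<close>, and \<open>\<gamma>\<close> stays in \<open>A\<close>.\<close>

lemma smooth_locus:
  fixes A :: "(complex^'i) set"
  assumes AJ: "A \<subseteq> coord_space J" and P: "\<And>p. p \<in> P \<Longrightarrow> poly_fun p" "A = {x. \<forall>p\<in>P. p x = 0}"
    and "A \<noteq> {}"
  obtains \<delta> d where "poly_fun \<delta>" "\<exists>a\<in>A. \<delta> a \<noteq> 0" "\<And>a. a \<in> A \<Longrightarrow> \<delta> a \<noteq> 0 \<Longrightarrow> local_slice J d A a"
proof -
  let ?I = "{p. poly_fun p \<and> (\<forall>a\<in>A. p a = 0)}"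
  define ok where "ok = (\<lambda>(C, p). C \<subseteq> J \<and> p ` C \<subseteq> ?I \<and> (\<exists>a\<in>A. det (jacobi_matrix C p a) \<noteq> 0))"
  have "jacobi_matrix {} p a = mat 1" for p :: "'i \<Rightarrow> complex^'i \<Rightarrow> complex" and a
    by (simp add: jacobi_matrix_def mat_def)
  then have ok0: "ok ({}, \<lambda>_ _. 0)" using \<open>A \<noteq> {}\<close> by (auto simp: ok_def)
  have bound: "\<forall>y. ok y \<longrightarrow> card (fst y) < Suc CARD('i)" by (auto intro: card_mono simp: less_Suc_eq_le)
  from ex_has_greatest_nat[of ok, OF ok0 bound] obtain x0 where x0: "ok x0"
    "\<And>y. ok y \<Longrightarrow> card (fst y) \<le> card (fst x0)" by blast
  obtain C p where Cp_eq: "x0 = (C, p)" by (cases x0)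
  have Cp: "ok (C, p)" and max: "\<And>D q. ok (D, q) \<Longrightarrow> card D \<le> card C"
    using x0 unfolding Cp_eq by fastforce+
  have CJ: "C \<subseteq> J" and pI: "\<And>i. i \<in> C \<Longrightarrow> poly_fun (p i)" "\<And>i a. i \<in> C \<Longrightarrow> a \<in> A \<Longrightarrow> p i a = 0"
    using Cp by (auto simp: ok_def)
  define K where "K = J - C"
  (* the chart near the good points: on C the functions of the ideal, elsewhere the coordinates *)
  define \<delta> where "\<delta> x = det (jacobi_matrix C p x)" for x
  define f where "f x = (\<chi> i. if i \<in> C then p i x else x $ i)" for x
  have f_der: "(f has_derivative ((*v) (jacobi_matrix C p x))) (at x)" for x
  proof (rule has_derivative_vecI)
    fix i
    show "((\<lambda>x. f x $ i) has_derivative (\<lambda>h. (jacobi_matrix C p x *v h) $ i)) (at x)"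
    proof (cases "i \<in> C")
      case True
      then show ?thesis
        using gradient(2)[OF pI(1)[OF True]] by (simp add: f_def jacobi_matrix_def matrix_vector_mult_def)
    next
      case False
      then have "(\<lambda>h. (jacobi_matrix C p x *v h) $ i) = (\<lambda>h. h $ i)"
        by (simp add: fun_eq_iff jacobi_matrix_def matrix_vector_mult_def if_distrib[of "\<lambda>c. c * _"] cong: if_cong)
      with False show ?thesis
        by (simp add: f_def) (rule bounded_linear_imp_has_derivative, rule bounded_linear_vec_nth)
    qed
  qed
  have fJ: "f x \<in> coord_space J \<longleftrightarrow> x \<in> coord_space J" for x
    using CJ by (auto simp: coord_space_def f_def)
  have fK: "f x \<in> coord_space K" if "x \<in> A" for x
    using that AJ pI(2) by (auto simp: coord_space_def f_def K_def)
  have slice: "local_slice J (card K) A a" if a: "a \<in> A" "\<delta> a \<noteq> 0" for a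
  proof -
    have "continuous_on UNIV (\<lambda>x. jacobi_matrix C p x $ i $ j)" for i j
      by (rule poly_fun_continuous, rule poly_fun_jacobi_matrix, rule pI)
    from local_inverse_ball[of f "jacobi_matrix C p" a UNIV, OF f_der this a(2)[unfolded \<delta>_def] open_UNIV UNIV_I]
    obtain r g U0 where g: "r > 0" "open U0" "a \<in> U0" "f ` U0 = ball (f a) r"
      "\<And>x. x \<in> U0 \<Longrightarrow> g (f x) = x"
      "\<And>y. y \<in> ball (f a) r \<Longrightarrow> g y \<in> U0"
      "\<And>y. y \<in> ball (f a) r \<Longrightarrow> f (g y) = y"
      "\<And>y. y \<in> ball (f a) r \<Longrightarrow> \<delta> (g y) \<noteq> 0"
      "\<And>y. y \<in> ball (f a) r \<Longrightarrow> (g has_derivative ((*v) (matrix_inv (jacobi_matrix C p (g y))))) (at y)"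
      unfolding \<delta>_def by metis
    define U where "U = U0 \<inter> coord_space J"
    have fU: "f ` U = ball (f a) r \<inter> coord_space J"
      unfolding U_def g(4)[symmetric] using fJ by auto
    have mem: "x \<in> A" if x: "x \<in> U0" "f x \<in> coord_space K" for x
    proof -
      define w where "w = f x - f a"
      define T where "T = {t::complex. f a + t *s w \<in> ball (f a) r}"
      define \<gamma> where "\<gamma> t = g (f a + t *s w)" for t
      have wK: "w \<in> coord_space K"
        using x(2) fK[OF a(1)] by (auto simp: w_def coord_space_def)
      have lin: "bounded_linear (\<lambda>t::complex. t *s w)"
      proof -
        have "linear (\<lambda>t::complex. t *s w)"
          by (rule linearI) (auto simp: vec_eq_iff algebra_simps)
        then show ?thesis by (simp add: linear_conv_bounded_linear)
      qed
      have T_eq: "T = (\<lambda>t. t *s w) -` ball 0 r"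
        by (auto simp: T_def dist_norm)
      have "open T" unfolding T_eq
        by (intro open_vimage open_ball linear_continuous_on lin)
      have "convex T" unfolding T_eq
        by (intro convex_linear_vimage bounded_linear.linear lin convex_ball)
      have "1 \<in> T" using x(1) g(4) by (auto simp: T_def w_def)
      have "0 \<in> T" using g(1) by (simp add: T_def)
      have \<gamma>_der: "(\<gamma> has_derivative (\<lambda>s. s *s (matrix_inv (jacobi_matrix C p (\<gamma> t)) *v w))) (at t)" if "t \<in> T" for t
      proof -
        have "((\<lambda>t. f a + t *s w) has_derivative (\<lambda>t. t *s w)) (at t)"
          by (auto intro!: derivative_eq_intros bounded_linear_imp_has_derivative lin)
        from has_derivative_compose[OF this g(9)] that
        show ?thesis by (simp add: T_def \<gamma>_def[abs_def] vector_scalar_commute)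
      qed
      define dot where "dot q t = (\<Sum>j\<in>UNIV. gradient q j (\<gamma> t) * (matrix_inv (jacobi_matrix C p (\<gamma> t)) *v w) $ j)" for q t
      have h_der: "((\<lambda>t. q (\<gamma> t)) has_field_derivative dot q t) (at t)"
        if "poly_fun q" "t \<in> T" for q t
        unfolding has_field_derivative_def
        by (rule has_derivative_eq_rhs[OF has_derivative_compose[OF \<gamma>_der[OF that(2)] gradient(2)[OF that(1)]]])
           (simp add: dot_def fun_eq_iff sum_distrib_left sum_distrib_right mult_ac)
      have hol: "(\<lambda>t. q (\<gamma> t)) holomorphic_on T" if "poly_fun q" for q
        using h_der[OF that] \<open>open T\<close> by (auto simp: holomorphic_on_open)
      (* Q q is the derivative of q along w, multiplied by \<delta> to make it polynomial *)
      define Q where "Q q x = (\<Sum>k\<in>K. w $ k * det (jacobi_matrix (insert k C) (p(k := q)) x))" for q x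
      have QI: "Q q \<in> ?I" if q: "q \<in> ?I" for q
      proof -
        have "poly_fun (\<lambda>x. det (jacobi_matrix (insert k C) (p(k := q)) x))" for k
          by (intro poly_fun_det poly_fun_jacobi_matrix) (use q pI in auto)
        moreover have "det (jacobi_matrix (insert k C) (p(k := q)) y) = 0" if "k \<in> K" "y \<in> A" for k y
        proof (rule ccontr)
          (* otherwise insert k C would contradict the maximality of C *)
          assume "det (jacobi_matrix (insert k C) (p(k := q)) y) \<noteq> 0"
          then have "ok (insert k C, p(k := q))"
            using that q pI CJ by (auto simp: ok_def K_def)
          from max[OF this] show False using that(1) by (simp add: K_def)
        qed
        ultimately show ?thesis by (auto simp: Q_def[abs_def] intro!: poly_fun_intros)
      qed
      have key: "\<delta> (\<gamma> t) * dot q t = Q q (\<gamma> t)" if "t \<in> T" for q t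
      proof -
        have nz: "det (jacobi_matrix C p (\<gamma> t)) \<noteq> 0"
          using g(8) that by (simp add: T_def \<gamma>_def \<delta>_def)
        have "(\<chi> i. if i = k then \<chi> j. gradient q j y else jacobi_matrix C p y $ i)
             = jacobi_matrix (insert k C) (p(k := q)) y" if "k \<in> K" for k y
          using that by (auto simp: jacobi_matrix_def vec_eq_iff K_def)
        then have "(\<Sum>k\<in>UNIV. w $ k * det (\<chi> i. if i = k then \<chi> j. gradient q j (\<gamma> t) else jacobi_matrix C p (\<gamma> t) $ i))
            = Q q (\<gamma> t)"
          unfolding Q_def using wK
          by (intro sum.mono_neutral_cong_right) (auto simp: coord_space_def)
        with cramer_row_pairing[OF nz, of "\<chi> j. gradient q j (\<gamma> t)" w] show ?thesis
          by (simp add: dot_def \<delta>_def)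
      qed
      have "q x = 0" if "q \<in> ?I" for q
      proof -
        have "(\<lambda>t. q (\<gamma> t)) 1 = 0"
        proof (rule holomorphic_family_vanishes[where T = T and z = 0 and H = "(\<lambda>q t. q (\<gamma> t)) ` ?I"
            and h = "\<lambda>t. q (\<gamma> t)" and t = 1])
          fix h assume "h \<in> (\<lambda>q t. q (\<gamma> t)) ` ?I"
          then obtain q where q: "q \<in> ?I" and h: "h = (\<lambda>t. q (\<gamma> t))" by blast
          show "h holomorphic_on T" unfolding h using q hol by simp
          show "h 0 = 0" unfolding h \<gamma>_def using q a(1) g(3,5) by simp
          show "\<exists>k\<in>(\<lambda>q t. q (\<gamma> t)) ` ?I. \<exists>u. u holomorphic_on T \<and> (\<forall>t\<in>T. deriv h t = u t * k t)"
          proof (intro bexI[of _ "\<lambda>t. Q q (\<gamma> t)"] exI[of _ "\<lambda>t. inverse (\<delta> (\<gamma> t))"] conjI ballI)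
            have "\<delta> (\<gamma> t) \<noteq> 0" if "t \<in> T" for t
              using g(8) that by (simp add: T_def \<gamma>_def)
            moreover have "poly_fun \<delta>" unfolding \<delta>_def[abs_def]
              by (intro poly_fun_det poly_fun_jacobi_matrix pI)
            ultimately show "(\<lambda>t. inverse (\<delta> (\<gamma> t))) holomorphic_on T"
              by (intro holomorphic_intros hol) auto
            fix t assume t: "t \<in> T"
            have "deriv h t = dot q t"
              unfolding h using h_der[OF _ t, of q] q by (intro DERIV_imp_deriv) auto
            then show "deriv h t = inverse (\<delta> (\<gamma> t)) * Q q (\<gamma> t)"
              using key[OF t, of q] g(8) t by (auto simp: T_def \<gamma>_def field_simps)
          qed (use QI[OF q] in blast)
        qed (use \<open>open T\<close> \<open>convex T\<close> \<open>0 \<in> T\<close> \<open>1 \<in> T\<close> that convex_connected in auto)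
        then show ?thesis using g(5)[OF x(1)] by (simp add: \<gamma>_def w_def)
      qed
      then show ?thesis using P by auto
    qed
    show ?thesis
      unfolding local_slice_def
    proof (intro exI conjI)
      show "a \<in> U" using g(3) a(1) AJ by (auto simp: U_def)
      show "biholomorphic_on J U f g"
        unfolding biholomorphic_on_def
      proof (intro conjI ballI)
        show "openin (top_of_set (coord_space J)) U" "openin (top_of_set (coord_space J)) (f ` U)"
          unfolding fU unfolding U_def using g(2) by (auto simp: openin_open Int_commute)
        show "holomorphic_map J U f" by (rule holomorphic_mapI_at, rule f_der)
        show "holomorphic_map J (f ` U) g"
          unfolding fU by (rule holomorphic_mapI_at, rule g(9)) auto
      qed (use g(5) in \<open>auto simp: U_def\<close>)
      show "K \<subseteq> J" by (auto simp: K_def)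
      have "coord_space K \<subseteq> coord_space J" by (auto simp: K_def coord_space_def)
      show "f ` (U \<inter> A) = f ` U \<inter> coord_space K"
        using fK mem AJ by (auto simp: U_def)
    qed simp
  qed
  show ?thesis
    by (rule that[of \<delta> "card K"])
       (use Cp slice pI in \<open>auto simp: \<delta>_def[abs_def] ok_def intro!: poly_fun_det poly_fun_jacobi_matrix\<close>)
qed

section \<open>Coordinate spaces and holomorphic maps\<close>

lemma subspace_coord_space: "subspace (coord_space J)"
  by (auto simp: subspace_def coord_space_def)

lemma coord_space_UNIV [simp]: "coord_space UNIV = UNIV"
  by (simp add: coord_space_def)

lemma coord_space_mono: "K \<subseteq> J \<Longrightarrow> coord_space K \<subseteq> coord_space J"
  by (auto simp: coord_space_def)

lemma zero_in_coord_space [simp]: "0 \<in> coord_space J"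
  by (simp add: coord_space_def)

text \<open>The real dimension, to be used with the topological invariance of dimension.\<close>

lemma dim_coord_space: "dim (coord_space K :: (complex^'i) set) = 2 * card K"
proof -
  let ?d = "(\<lambda>(i, u). axis i u) ` (K \<times> (Basis :: complex set)) :: (complex^'i) set"
  have d: "?d \<subseteq> Basis" by (auto simp: Basis_vec_def)
  have mem: "axis i u \<in> ?d \<longleftrightarrow> i \<in> K" if "u \<in> Basis" for i and u :: complex
    using that nonzero_Basis by (force simp: axis_eq_axis)
  have "coord_space K = {x. \<forall>b\<in>Basis. b \<notin> ?d \<longrightarrow> x \<bullet> b = 0}"
  proof safe
    fix x :: "complex^'i" and b :: "complex^'i"
    assume "x \<in> coord_space K" "b \<in> Basis" "b \<notin> ?d"
    then show "x \<bullet> b = 0"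
      by (force simp: Basis_vec_def coord_space_def inner_axis)
  next
    fix x :: "complex^'i" assume x: "\<forall>b\<in>Basis. b \<notin> ?d \<longrightarrow> x \<bullet> b = 0"
    show "x \<in> coord_space K"
      unfolding coord_space_def
    proof safe
      fix i assume "i \<notin> K"
      then have "x $ i \<bullet> u = 0" if "u \<in> Basis" for u
        using x[rule_format, of "axis i u"] mem[OF that, of i] that
        by (auto simp: inner_axis axis_in_Basis_iff)
      then show "x $ i = 0" by (simp add: euclidean_eq_iff[of "x $ i" 0])
    qed
  qed
  then have "dim (coord_space K :: (complex^'i) set) = card ?d"
    using dim_substandard[OF d] by simp
  also have "\<dots> = card (K \<times> (Basis :: complex set))"
    using nonzero_Basis by (intro card_image) (auto simp: inj_on_def axis_eq_axis)
  finally show ?thesis by (simp add: card_cartesian_product)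
qed

lemma complex_linear_iff:
  fixes f :: "complex^'i \<Rightarrow> complex^'j"
  shows "Vector_Spaces.linear (*s) (*s) f \<longleftrightarrow>
    (\<forall>x y. f (x + y) = f x + f y) \<and> (\<forall>c x. f (c *s x) = c *s f x)"
  by (simp add: Vector_Spaces.linear_iff vec.vector_space_axioms)

text \<open>On a relatively open set it makes no difference whether the derivative is taken within that set;
  this form is the one that is stable under composition and under changing the map elsewhere.\<close>

lemma holomorphic_map_within:
  assumes "openin (top_of_set (coord_space J)) S"
  shows "holomorphic_map J S f \<longleftrightarrow>
    (\<forall>x\<in>S. \<exists>f'. Vector_Spaces.linear (*s) (*s) f' \<and> (f has_derivative f') (at x within S))"
proof -
  obtain T where T: "open T" "S = coord_space J \<inter> T" using assms by (auto simp: openin_open)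
  have "at x within S = at x within coord_space J" if "x \<in> S" for x
    using that T by (intro at_within_nhd[of _ T]) auto
  then show ?thesis by (auto simp: holomorphic_map_def)
qed

lemma holomorphic_map_cong:
  assumes "openin (top_of_set (coord_space J)) S" "holomorphic_map J S f" "\<And>x. x \<in> S \<Longrightarrow> g x = f x"
  shows "holomorphic_map J S g"
  using assms(2,3) unfolding holomorphic_map_within[OF assms(1)]
  by (meson has_derivative_transform)

lemma holomorphic_map_subset: "holomorphic_map J S f \<Longrightarrow> T \<subseteq> S \<Longrightarrow> holomorphic_map J T f"
  by (auto simp: holomorphic_map_def)

lemma holomorphic_map_id: "holomorphic_map J S (\<lambda>x. x)"
  unfolding holomorphic_map_def
  using has_derivative_ident vec.linear_ident by blast

lemma holomorphic_map_continuous: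
  assumes "holomorphic_map J S f" "S \<subseteq> coord_space J"
  shows "continuous_on S f"
  unfolding continuous_on_eq_continuous_within
proof
  fix x assume "x \<in> S"
  then obtain f' where "(f has_derivative f') (at x within coord_space J)"
    using assms(1) by (auto simp: holomorphic_map_def)
  then show "continuous (at x within S) f"
    using assms(2) has_derivative_continuous continuous_within_subset by blast
qed

lemma holomorphic_map_compose:
  assumes S: "openin (top_of_set (coord_space J)) S" "holomorphic_map J S f"
    and T: "f ` S \<subseteq> T" "T \<subseteq> coord_space K" "holomorphic_map K T g"
  shows "holomorphic_map J S (g \<circ> f)"
  unfolding holomorphic_map_within[OF S(1)]
proof
  fix x assume x: "x \<in> S"
  obtain f' where f': "Vector_Spaces.linear (*s) (*s) f'" "(f has_derivative f') (at x within S)"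
    using S(2) x unfolding holomorphic_map_within[OF S(1)] by blast
  obtain g' where g': "Vector_Spaces.linear (*s) (*s) g'" "(g has_derivative g') (at (f x) within coord_space K)"
    using T x unfolding holomorphic_map_def by blast
  have "(g has_derivative g') (at (f x) within f ` S)"
    using has_derivative_subset[OF g'(2)] T by blast
  from diff_chain_within[OF f'(2) this]
  show "\<exists>h. Vector_Spaces.linear (*s) (*s) h \<and> (g \<circ> f has_derivative h) (at x within S)"
    using Vector_Spaces.linear_compose[OF f'(1) g'(1)] by blast
qed

lemma openin_preimage:
  assumes "openin (top_of_set (coord_space J)) S" "continuous_on S f" "f ` S \<subseteq> coord_space K"
    "openin (top_of_set (coord_space K)) T"
  shows "openin (top_of_set (coord_space J)) {x \<in> S. f x \<in> T}"
proof -
  have "openin (top_of_set S) (S \<inter> f -` T)"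
    using continuous_openin_preimage[OF assms(2) _ assms(4)] assms(3) by blast
  then have "openin (top_of_set (coord_space J)) (S \<inter> f -` T)"
    using assms(1) openin_trans by blast
  then show ?thesis by (simp add: vimage_def Int_def)
qed

section \<open>Biholomorphic maps and slices\<close>

lemma slice_mem_iff:
  assumes "inj_on f U" "f ` (U \<inter> S) = f ` U \<inter> A" "x \<in> U"
  shows "f x \<in> A \<longleftrightarrow> x \<in> S"
proof
  assume "f x \<in> A"
  then have "f x \<in> f ` (U \<inter> S)" using assms by blast
  then obtain y where "y \<in> U" "y \<in> S" "f x = f y" by blast
  then show "x \<in> S" using assms by (metis inj_onD)
qed (use assms in blast)

lemma biholomorphic_on_inverse:
  "biholomorphic_on J U \<phi> \<psi> \<Longrightarrow> biholomorphic_on J (\<phi> ` U) \<psi> \<phi>"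
  by (auto simp: biholomorphic_on_def image_image cong: image_cong_simp)

lemma biholomorphic_on_subset_coord:
  "biholomorphic_on J U \<phi> \<psi> \<Longrightarrow> U \<subseteq> coord_space J \<and> \<phi> ` U \<subseteq> coord_space J"
  unfolding biholomorphic_on_def by (metis openin_imp_subset)

lemma biholomorphic_on_restrict:
  assumes "biholomorphic_on J U \<phi> \<psi>" "openin (top_of_set (coord_space J)) V"
  shows "biholomorphic_on J (U \<inter> V) \<phi> \<psi>"
  unfolding biholomorphic_on_def
proof (intro conjI)
  have b: "openin (top_of_set (coord_space J)) U" "openin (top_of_set (coord_space J)) (\<phi> ` U)"
    "\<And>x. x \<in> U \<Longrightarrow> \<psi> (\<phi> x) = x" "holomorphic_map J U \<phi>" "holomorphic_map J (\<phi> ` U) \<psi>"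
    using assms(1) by (auto simp: biholomorphic_on_def)
  have sub: "U \<subseteq> coord_space J" "\<phi> ` U \<subseteq> coord_space J"
    using biholomorphic_on_subset_coord[OF assms(1)] by auto
  show "openin (top_of_set (coord_space J)) (U \<inter> V)" using b(1) assms(2) by blast
  have "openin (top_of_set (coord_space J)) {y \<in> \<phi> ` U. \<psi> y \<in> V}"
    by (rule openin_preimage[OF b(2) holomorphic_map_continuous[OF b(5) sub(2)] _ assms(2)])
       (use sub b(3) in auto)
  also have "{y \<in> \<phi> ` U. \<psi> y \<in> V} = \<phi> ` (U \<inter> V)" using b(3) by auto
  finally show "openin (top_of_set (coord_space J)) (\<phi> ` (U \<inter> V))" .
  show "holomorphic_map J (U \<inter> V) \<phi>" "holomorphic_map J (\<phi> ` (U \<inter> V)) \<psi>"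
    by (rule holomorphic_map_subset[OF b(4)], blast) (rule holomorphic_map_subset[OF b(5)], blast)
qed (use assms(1) in \<open>auto simp: biholomorphic_on_def\<close>)

lemma biholomorphic_on_compose:
  assumes 1: "biholomorphic_on J U \<phi> \<psi>" and 2: "biholomorphic_on J V \<phi>' \<psi>'" and sub: "\<phi> ` U \<subseteq> V"
  shows "biholomorphic_on J U (\<phi>' \<circ> \<phi>) (\<psi> \<circ> \<psi>')"
proof -
  have "biholomorphic_on J (V \<inter> \<phi> ` U) \<phi>' \<psi>'"
    using 1 by (intro biholomorphic_on_restrict[OF 2]) (auto simp: biholomorphic_on_def)
  moreover have "V \<inter> \<phi> ` U = \<phi> ` U" using sub by auto
  ultimately have 3: "biholomorphic_on J (\<phi> ` U) \<phi>' \<psi>'" by simp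
  have s: "\<phi> ` U \<subseteq> coord_space J" "\<phi>' ` \<phi> ` U \<subseteq> coord_space J"
    using biholomorphic_on_subset_coord[OF 3] by auto
  show ?thesis
    using 1 3 s unfolding biholomorphic_on_def image_comp[symmetric]
    by (auto intro!: holomorphic_map_compose[of J U \<phi> "\<phi> ` U" J]
        holomorphic_map_compose[of J "\<phi>' ` \<phi> ` U" \<psi>' "\<phi> ` U" J])
qed

lemma local_slice_transport:
  assumes \<tau>: "biholomorphic_on J U \<tau> \<sigma>" "a \<in> U" and im: "\<tau> ` (U \<inter> A) = \<tau> ` U \<inter> B"
    and slice: "local_slice J d B (\<tau> a)"
  shows "local_slice J d A a"
proof -
  obtain V \<phi> \<psi> K where *: "\<tau> a \<in> V" "biholomorphic_on J V \<phi> \<psi>" "K \<subseteq> J" "card K = d"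
    "\<phi> ` (V \<inter> B) = \<phi> ` V \<inter> coord_space K"
    using slice unfolding local_slice_def by blast
  let ?W = "\<tau> ` U \<inter> V"
  have oV: "openin (top_of_set (coord_space J)) V" using *(2) by (simp add: biholomorphic_on_def)
  from biholomorphic_on_inverse[OF biholomorphic_on_restrict[OF biholomorphic_on_inverse[OF \<tau>(1)] oV]]
  have W: "biholomorphic_on J (\<sigma> ` ?W) \<tau> \<sigma>" .
  have \<sigma>: "\<sigma> (\<tau> x) = x" if "x \<in> U" for x using that \<tau>(1) by (auto simp: biholomorphic_on_def)
  have \<psi>: "\<psi> (\<phi> x) = x" if "x \<in> V" for x using that *(2) by (auto simp: biholomorphic_on_def)
  have \<sigma>W: "\<sigma> ` ?W = {x \<in> U. \<tau> x \<in> V}" using \<sigma> by force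
  have inj: "inj_on \<tau> U" "inj_on \<phi> V" using \<sigma> \<psi> by (metis inj_onI)+
  note B = slice_mem_iff[OF inj(1) im] and C = slice_mem_iff[OF inj(2) *(5)]
  show ?thesis
    unfolding local_slice_def
  proof (intro exI conjI)
    show "a \<in> \<sigma> ` ?W" using \<tau>(2) *(1) by (simp add: \<sigma>W)
    show "biholomorphic_on J (\<sigma> ` ?W) (\<phi> \<circ> \<tau>) (\<sigma> \<circ> \<psi>)"
      by (rule biholomorphic_on_compose[OF W *(2)]) (auto simp: \<sigma>W)
    show "(\<phi> \<circ> \<tau>) ` (\<sigma> ` ?W \<inter> A) = (\<phi> \<circ> \<tau>) ` (\<sigma> ` ?W) \<inter> coord_space K"
      unfolding \<sigma>W using B C by auto
  qed (use * in auto)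
qed

definition coord_proj :: "'i set \<Rightarrow> complex^'i \<Rightarrow> complex^'i::finite" where
  "coord_proj J x = (\<chi> i. if i \<in> J then x $ i else 0)"

lemma coord_proj_in [simp]: "coord_proj J x \<in> coord_space J"
  by (simp add: coord_proj_def coord_space_def)

lemma coord_proj_same: "x \<in> coord_space J \<Longrightarrow> coord_proj J x = x"
  by (auto simp: coord_proj_def coord_space_def vec_eq_iff)

lemma linear_coord_proj: "Vector_Spaces.linear (*s) (*s) (coord_proj J)" "bounded_linear (coord_proj J)"
proof -
  show "Vector_Spaces.linear (*s) (*s) (coord_proj J)"
    by unfold_locales (auto simp: coord_proj_def vec_eq_iff algebra_simps)
  have "linear (coord_proj J)"
    by (rule linearI) (auto simp: coord_proj_def vec_eq_iff algebra_simps)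
  then show "bounded_linear (coord_proj J)" by (simp add: linear_conv_bounded_linear)
qed

text \<open>Acts as \<open>f\<close> on the coordinates in \<open>J\<close> and as the identity on the others; it turns a chart of \<open>\<complex>\<^sup>J\<close>
  into a chart of the whole space.\<close>

definition extend_id :: "'i set \<Rightarrow> (complex^'i \<Rightarrow> complex^'i) \<Rightarrow> complex^'i \<Rightarrow> complex^'i::finite" where
  "extend_id J f x = f (coord_proj J x) + (x - coord_proj J x)"

lemma extend_id_holomorphic:
  assumes "holomorphic_map J U f"
  shows "holomorphic_map UNIV {x. coord_proj J x \<in> U} (extend_id J f)"
  unfolding holomorphic_map_def
proof
  fix x assume "x \<in> {x. coord_proj J x \<in> U}"
  then obtain f' where f': "Vector_Spaces.linear (*s) (*s) f'"
    "(f has_derivative f') (at (coord_proj J x) within coord_space J)"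
    using assms by (auto simp: holomorphic_map_def)
  have p: "(coord_proj J has_derivative coord_proj J) (at x)"
    by (rule bounded_linear_imp_has_derivative, rule linear_coord_proj)
  have "(f has_derivative f') (at (coord_proj J x) within coord_proj J ` UNIV)"
    by (rule has_derivative_subset[OF f'(2)]) auto
  from diff_chain_within[OF p this]
  have "((\<lambda>x. f (coord_proj J x)) has_derivative (\<lambda>h. f' (coord_proj J h))) (at x)"
    by (simp add: o_def)
  then have "(extend_id J f has_derivative (\<lambda>h. f' (coord_proj J h) + (h - coord_proj J h))) (at x)"
    unfolding extend_id_def[abs_def] by (intro has_derivative_add has_derivative_diff has_derivative_ident p)
  moreover have "Vector_Spaces.linear (*s) (*s) (\<lambda>h. f' (coord_proj J h) + (h - coord_proj J h))"
    using f'(1) linear_coord_proj(1)[of J]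
    by (simp add: complex_linear_iff algebra_simps)
  ultimately show "\<exists>h. Vector_Spaces.linear (*s) (*s) h \<and> (extend_id J f has_derivative h) (at x within coord_space UNIV)"
    by auto
qed

lemma local_slice_extend:
  assumes slice: "local_slice J d A a" and A: "A \<subseteq> coord_space J"
  shows "local_slice UNIV d A a"
proof -
  obtain U \<phi> \<psi> K where *: "a \<in> U" "biholomorphic_on J U \<phi> \<psi>" "K \<subseteq> J" "card K = d"
    "\<phi> ` (U \<inter> A) = \<phi> ` U \<inter> coord_space K"
    using slice unfolding local_slice_def by blast
  have UJ: "U \<subseteq> coord_space J" "\<phi> ` U \<subseteq> coord_space J"
    using biholomorphic_on_subset_coord[OF *(2)] by auto
  have b: "openin (top_of_set (coord_space J)) U" "openin (top_of_set (coord_space J)) (\<phi> ` U)"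
    "\<And>x. x \<in> U \<Longrightarrow> \<psi> (\<phi> x) = x" "holomorphic_map J U \<phi>" "holomorphic_map J (\<phi> ` U) \<psi>"
    using *(2) by (auto simp: biholomorphic_on_def)
  let ?E = "\<lambda>S. {x. coord_proj J x \<in> S}"
  have op: "open (?E S)" if "openin (top_of_set (coord_space J)) S" for S
    using openin_preimage[of UNIV UNIV "coord_proj J" J S] that
    by (simp add: linear_continuous_on linear_coord_proj image_subset_iff)
  have proj_ext: "coord_proj J (extend_id J f x) = f (coord_proj J x)"
    if "f (coord_proj J x) \<in> coord_space J" for f x
    using that by (auto simp: extend_id_def coord_proj_def coord_space_def vec_eq_iff)
  have \<phi>E: "coord_proj J (extend_id J \<phi> x) = \<phi> (coord_proj J x)" if "x \<in> ?E U" for x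
    using that UJ by (intro proj_ext) auto
  have \<psi>E: "coord_proj J (extend_id J \<psi> y) = \<psi> (coord_proj J y)" if "y \<in> ?E (\<phi> ` U)" for y
    using that UJ b(3) by (intro proj_ext) auto
  have left: "extend_id J \<psi> (extend_id J \<phi> x) = x" if "x \<in> ?E U" for x
    unfolding extend_id_def[of J \<psi>] \<phi>E[OF that] using that b(3) by (simp add: extend_id_def)
  have right: "extend_id J \<phi> (extend_id J \<psi> y) = y" if y: "y \<in> ?E (\<phi> ` U)" for y
  proof -
    have "\<phi> (\<psi> (coord_proj J y)) = coord_proj J y" using y b(3) by auto
    then show ?thesis
      unfolding extend_id_def[of J \<phi>] \<psi>E[OF y] by (simp add: extend_id_def)
  qed
  have im: "extend_id J \<phi> ` ?E U = ?E (\<phi> ` U)"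
  proof (intro equalityI subsetI)
    fix y assume "y \<in> ?E (\<phi> ` U)"
    moreover then have "extend_id J \<psi> y \<in> ?E U" using \<psi>E b(3) by auto
    ultimately show "y \<in> extend_id J \<phi> ` ?E U" using right by (metis imageI)
  qed (use \<phi>E in auto)
  show ?thesis
    unfolding local_slice_def
  proof (intro exI conjI)
    have "coord_proj J a = a" using *(1) UJ coord_proj_same by blast
    then show "a \<in> ?E U" using *(1) by simp
    show "biholomorphic_on UNIV (?E U) (extend_id J \<phi>) (extend_id J \<psi>)"
      unfolding biholomorphic_on_def im
      using op b left by (auto intro: extend_id_holomorphic)
    show "extend_id J \<phi> ` (?E U \<inter> A) = extend_id J \<phi> ` ?E U \<inter> coord_space K"
    proof -
      have same: "extend_id J \<phi> x = \<phi> x" if "x \<in> coord_space J" for x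
        using coord_proj_same[OF that] by (simp add: extend_id_def)
      have "coord_proj J x = x" if "x \<in> A" for x using that A coord_proj_same by blast
      then have "?E U \<inter> A = U \<inter> A" by auto
      then have "extend_id J \<phi> ` (?E U \<inter> A) = \<phi> ` (U \<inter> A)"
        using same A by (auto intro!: image_cong)
      also have "\<dots> = \<phi> ` U \<inter> coord_space K" by (rule *)
      also have "\<dots> = ?E (\<phi> ` U) \<inter> coord_space K"
      proof -
        have "coord_proj J x = x" if "x \<in> coord_space K" for x
          using that coord_space_mono[OF *(3)] coord_proj_same by blast
        then show ?thesis by auto
      qed
      finally show ?thesis unfolding im .
    qed
  qed (use * in auto)
qed

section \<open>Charts\<close>

text \<open>One half of \<open>chart_compatible\<close>. The halves compose, so that each statement about compatible
  charts has to be proved in one direction only.\<close>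

definition transition_holomorphic :: "('p, 'i::finite) chart \<Rightarrow> ('p, 'i) chart \<Rightarrow> bool" where
  "transition_holomorphic = (\<lambda>(J, U, \<phi>) (K, V, \<psi>).
     openin (top_of_set (coord_space J)) (\<phi> ` (U \<inter> V)) \<and>
     holomorphic_map J (\<phi> ` (U \<inter> V)) (\<psi> \<circ> inv_into U \<phi>))"

lemma chart_compatible_iff:
  "chart_compatible c c' \<longleftrightarrow> transition_holomorphic c c' \<and> transition_holomorphic c' c"
  by (auto simp: chart_compatible_def transition_holomorphic_def Int_commute split: prod.splits)

lemma transition_holomorphic_iff:
  assumes "\<And>p. p \<in> U \<Longrightarrow> \<phi>i (\<phi> p) = p"
  shows "transition_holomorphic (J, U, \<phi>) (K, V, \<psi>) \<longleftrightarrow>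
     openin (top_of_set (coord_space J)) (\<phi> ` (U \<inter> V)) \<and>
     holomorphic_map J (\<phi> ` (U \<inter> V)) (\<psi> \<circ> \<phi>i)"
proof -
  have "inj_on \<phi> U" using assms by (metis inj_onI)
  then have "inv_into U \<phi> (\<phi> p) = \<phi>i (\<phi> p)" if "p \<in> U" for p
    using assms that by simp
  then have eq: "(\<psi> \<circ> inv_into U \<phi>) y = (\<psi> \<circ> \<phi>i) y" if "y \<in> \<phi> ` (U \<inter> V)" for y
    using that by auto
  show ?thesis
    unfolding transition_holomorphic_def
    using holomorphic_map_cong[of J "\<phi> ` (U \<inter> V)" _ ] eq by (metis (no_types, lifting) case_prod_conv)
qed

text \<open>Both openness and holomorphy of a transition map are local, and near a given point the transition
  can be taken through an intermediate chart that contains the point.\<close>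

lemma transition_holomorphic_trans:
  assumes c1: "chart_on X (J1, U1, \<phi>1)" and c2: "chart_on X (J2, U2, \<phi>2)"
    and cover: "\<And>p. p \<in> U1 \<inter> U2 \<Longrightarrow> \<exists>c. chart_on X c \<and> p \<in> fst (snd c) \<and>
        transition_holomorphic (J1, U1, \<phi>1) c \<and> transition_holomorphic c (J1, U1, \<phi>1) \<and>
        transition_holomorphic c (J2, U2, \<phi>2)"
  shows "transition_holomorphic (J1, U1, \<phi>1) (J2, U2, \<phi>2)"
proof -
  define \<phi>1i where "\<phi>1i = inv_into U1 \<phi>1"
  have i1: "\<phi>1i (\<phi>1 p) = p" if "p \<in> U1" for p
    using c1 that by (simp add: \<phi>1i_def chart_on_def)
  have "\<exists>T. openin (top_of_set (coord_space J1)) T \<and> y \<in> T \<and> T \<subseteq> \<phi>1 ` (U1 \<inter> U2) \<and>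
          holomorphic_map J1 T (\<phi>2 \<circ> \<phi>1i)" if "y \<in> \<phi>1 ` (U1 \<inter> U2)" for y
  proof -
    obtain p where p: "p \<in> U1" "p \<in> U2" "y = \<phi>1 p" using \<open>y \<in> _\<close> by blast
    then obtain J0 U0 \<phi>0 where c0: "chart_on X (J0, U0, \<phi>0)" "p \<in> U0"
      and t: "transition_holomorphic (J1, U1, \<phi>1) (J0, U0, \<phi>0)"
        "transition_holomorphic (J0, U0, \<phi>0) (J1, U1, \<phi>1)"
        "transition_holomorphic (J0, U0, \<phi>0) (J2, U2, \<phi>2)"
      using cover[of p] by auto
    define \<phi>0i where "\<phi>0i = inv_into U0 \<phi>0"
    have i0: "\<phi>0i (\<phi>0 p) = p" if "p \<in> U0" for p
      using c0 that by (simp add: \<phi>0i_def chart_on_def)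
    have "openin (top_of_set (coord_space J0)) (\<phi>0 ` (U0 \<inter> U1) \<inter> \<phi>0 ` (U0 \<inter> U2))"
      using t by (auto simp: transition_holomorphic_def)
    moreover have "\<phi>0 ` (U0 \<inter> U1) \<inter> \<phi>0 ` (U0 \<inter> U2) = \<phi>0 ` (U0 \<inter> U1 \<inter> U2)"
    proof -
      have "inj_on \<phi>0 U0" using c0(1) by (simp add: chart_on_def)
      then have "\<phi>0 ` ((U0 \<inter> U1) \<inter> (U0 \<inter> U2)) = \<phi>0 ` (U0 \<inter> U1) \<inter> \<phi>0 ` (U0 \<inter> U2)"
        by (rule inj_on_image_Int) auto
      moreover have "(U0 \<inter> U1) \<inter> (U0 \<inter> U2) = U0 \<inter> U1 \<inter> U2" by auto
      ultimately show ?thesis by simp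
    qed
    ultimately have o0: "openin (top_of_set (coord_space J0)) (\<phi>0 ` (U0 \<inter> U1 \<inter> U2))" by simp
    have h1: "openin (top_of_set (coord_space J1)) (\<phi>1 ` (U1 \<inter> U0))"
      "holomorphic_map J1 (\<phi>1 ` (U1 \<inter> U0)) (\<phi>0 \<circ> \<phi>1i)"
      using t(1) transition_holomorphic_iff[where \<phi> = \<phi>1 and \<phi>i = \<phi>1i, OF i1] by auto
    have h0: "holomorphic_map J0 (\<phi>0 ` (U0 \<inter> U2)) (\<phi>2 \<circ> \<phi>0i)"
      using t(3) transition_holomorphic_iff[where \<phi> = \<phi>0 and \<phi>i = \<phi>0i, OF i0] by auto
    let ?T = "{x \<in> \<phi>1 ` (U1 \<inter> U0). (\<phi>0 \<circ> \<phi>1i) x \<in> \<phi>0 ` (U0 \<inter> U1 \<inter> U2)}"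
    have T: "?T = \<phi>1 ` (U1 \<inter> U0 \<inter> U2)"
    proof -
      have "\<phi>0 q \<in> \<phi>0 ` (U0 \<inter> U1 \<inter> U2) \<longleftrightarrow> q \<in> U2" if "q \<in> U1 \<inter> U0" for q
        using that inj_on_image_mem_iff[of \<phi>0 U0 q "U0 \<inter> U1 \<inter> U2"] c0(1) by (auto simp: chart_on_def)
      then have "?T = \<phi>1 ` {q \<in> U1 \<inter> U0. q \<in> U2}" using i1 by fastforce
      then show ?thesis by (simp add: Int_def conj_ac)
    qed
    have s1: "\<phi>1 ` (U1 \<inter> U0) \<subseteq> coord_space J1" using openin_imp_subset[OF h1(1)] .
    have s0: "\<phi>0 ` U0 \<subseteq> coord_space J0"
      using c0(1) openin_imp_subset by (force simp: chart_on_def)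
    have "openin (top_of_set (coord_space J1)) ?T"
      by (rule openin_preimage[OF h1(1) holomorphic_map_continuous[OF h1(2) s1] _ o0])
         (use i1 s0 in auto)
    then have oT: "openin (top_of_set (coord_space J1)) (\<phi>1 ` (U1 \<inter> U0 \<inter> U2))" by (simp only: T)
    have "holomorphic_map J1 (\<phi>1 ` (U1 \<inter> U0 \<inter> U2)) ((\<phi>2 \<circ> \<phi>0i) \<circ> (\<phi>0 \<circ> \<phi>1i))"
      by (rule holomorphic_map_compose[OF oT holomorphic_map_subset[OF h1(2)] _ _ h0])
         (use i1 s0 in auto)
    then have "holomorphic_map J1 (\<phi>1 ` (U1 \<inter> U0 \<inter> U2)) (\<phi>2 \<circ> \<phi>1i)"
      by (rule holomorphic_map_cong[OF oT]) (use i1 i0 in auto)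
    with oT p c0(2) show ?thesis by (intro exI[of _ "\<phi>1 ` (U1 \<inter> U0 \<inter> U2)"]) auto
  qed
  note loc = this
  have "openin (top_of_set (coord_space J1)) (\<phi>1 ` (U1 \<inter> U2))"
    using loc by (subst openin_subopen) meson
  moreover have "holomorphic_map J1 (\<phi>1 ` (U1 \<inter> U2)) (\<phi>2 \<circ> \<phi>1i)"
    unfolding holomorphic_map_def
  proof
    fix y assume "y \<in> \<phi>1 ` (U1 \<inter> U2)"
    then obtain T where "y \<in> T" "holomorphic_map J1 T (\<phi>2 \<circ> \<phi>1i)" using loc by meson
    then show "\<exists>f'. Vector_Spaces.linear (*s) (*s) f' \<and>
        (\<phi>2 \<circ> \<phi>1i has_derivative f') (at y within coord_space J1)"
      unfolding holomorphic_map_def by blast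
  qed
  ultimately show ?thesis
    using transition_holomorphic_iff[where \<phi> = \<phi>1 and \<phi>i = \<phi>1i, OF i1] by auto
qed

text \<open>The atlas has to cover the carrier: otherwise charts of the maximal atlas that avoid the given
  charts would be compatible with them for trivial reasons, but not always with each other.\<close>

definition is_manifold :: "('p, 'i::finite) manifold \<Rightarrow> bool" where
  "is_manifold = (\<lambda>(X, A). (\<forall>c\<in>A. chart_on X c) \<and> (\<forall>p\<in>X. \<exists>c\<in>A. p \<in> fst (snd c)))"

lemma maximal_atlas_compatible:
  assumes M: "is_manifold X" and c: "c1 \<in> maximal_atlas X" "c2 \<in> maximal_atlas X"
  shows "chart_compatible c1 c2"
proof -
  obtain Y A where X: "X = (Y, A)" by (cases X)
  have *: "transition_holomorphic c c'" if c: "c \<in> maximal_atlas X" "c' \<in> maximal_atlas X" for c c'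
  proof -
    obtain J1 U1 \<phi>1 J2 U2 \<phi>2 where cc: "c = (J1, U1, \<phi>1)" "c' = (J2, U2, \<phi>2)"
      by (metis prod_cases3)
    show ?thesis
      unfolding cc
    proof (rule transition_holomorphic_trans)
      show "chart_on Y (J1, U1, \<phi>1)" "chart_on Y (J2, U2, \<phi>2)"
        using c by (auto simp: maximal_atlas_def X cc)
      fix p assume p: "p \<in> U1 \<inter> U2"
      then have "p \<in> Y" using c by (auto simp: maximal_atlas_def X cc chart_on_def)
      then obtain c0 where "c0 \<in> A" "p \<in> fst (snd c0)" "chart_on Y c0"
        using M by (auto simp: is_manifold_def X)
      then show "\<exists>c. chart_on Y c \<and> p \<in> fst (snd c) \<and>
        transition_holomorphic (J1, U1, \<phi>1) c \<and> transition_holomorphic c (J1, U1, \<phi>1) \<and>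
        transition_holomorphic c (J2, U2, \<phi>2)"
        using c by (intro exI[of _ c0]) (auto simp: maximal_atlas_def X cc chart_compatible_iff)
    qed
  qed
  show ?thesis using * c by (simp add: chart_compatible_iff)
qed

text \<open>The transition between two slice charts at a common point restricts to a continuous injection of a
  relatively open part of one slice into the other, so invariance of dimension applies.\<close>

lemma embedded_submanifold_dim_le:
  assumes M: "is_manifold X" and d: "embedded_submanifold X d S" "embedded_submanifold X d' S" and "S \<noteq> {}"
  shows "d \<le> d'"
proof -
  obtain p where p: "p \<in> S" using \<open>S \<noteq> {}\<close> by blast
  obtain J U \<phi> K where c1: "(J, U, \<phi>) \<in> maximal_atlas X" "p \<in> U" "K \<subseteq> J" "card K = d"
    "\<phi> ` (U \<inter> S) = \<phi> ` U \<inter> coord_space K"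
    using d(1) p unfolding embedded_submanifold_def by metis
  obtain J' U' \<phi>' K' where c2: "(J', U', \<phi>') \<in> maximal_atlas X" "p \<in> U'" "K' \<subseteq> J'" "card K' = d'"
    "\<phi>' ` (U' \<inter> S) = \<phi>' ` U' \<inter> coord_space K'"
    using d(2) p unfolding embedded_submanifold_def by metis
  have inj: "inj_on \<phi> U" "inj_on \<phi>' U'"
    using c1(1) c2(1) by (auto simp: maximal_atlas_def chart_on_def split: prod.splits)
  let ?f = "\<phi>' \<circ> inv_into U \<phi>"
  let ?S = "\<phi> ` (U \<inter> U') \<inter> coord_space K"
  have t: "openin (top_of_set (coord_space J)) (\<phi> ` (U \<inter> U'))" "holomorphic_map J (\<phi> ` (U \<inter> U')) ?f"
    using maximal_atlas_compatible[OF M c1(1) c2(1)] by (auto simp: chart_compatible_iff transition_holomorphic_def)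
  have S: "?S = \<phi> ` (U \<inter> U' \<inter> S)"
    using c1(5) inj(1) by (fastforce simp: inj_on_def)
  have "dim (coord_space K) \<le> dim (coord_space K')"
  proof (rule invariance_of_dimension_subspaces)
    show "openin (top_of_set (coord_space K)) ?S"
    proof -
      obtain T where "open T" "\<phi> ` (U \<inter> U') = coord_space J \<inter> T" using t(1) by (auto simp: openin_open)
      moreover then have "?S = coord_space K \<inter> T" using coord_space_mono[OF c1(3)] by auto
      ultimately show ?thesis by (auto simp: openin_open)
    qed
    show "continuous_on ?S ?f"
      by (rule continuous_on_subset[OF holomorphic_map_continuous[OF t(2) openin_imp_subset[OF t(1)]]]) auto
    show "?f \<in> ?S \<rightarrow> coord_space K'"
      unfolding S using c2(5) inj by auto
    show "inj_on ?f ?S"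
      unfolding S using inj by (auto simp: inj_on_def)
    show "?S \<noteq> {}" unfolding S using p c1(2) c2(2) by auto
  qed (rule subspace_coord_space)+
  then show ?thesis using c1(4) c2(4) by (simp add: dim_coord_space)
qed

lemma manifold_dim_eqI:
  assumes "is_manifold X" "embedded_submanifold X d S" "S \<noteq> {}"
  shows "manifold_dim X S = d"
  unfolding manifold_dim_def
  using assms by (intro the_equality) (auto intro!: antisym embedded_submanifold_dim_le[OF assms(1) _ _ assms(3)])

lemma maximal_atlas_compose:
  assumes M: "is_manifold X" and c: "(J, V, \<theta>) \<in> maximal_atlas X" and b: "biholomorphic_on J U \<phi> \<psi>"
  shows "(J, {p \<in> V. \<theta> p \<in> U}, \<phi> \<circ> \<theta>) \<in> maximal_atlas X"
proof -
  obtain Y A where X: "X = (Y, A)" by (cases X)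
  let ?V = "{p \<in> V. \<theta> p \<in> U}"
  have c0: "chart_on Y (J, V, \<theta>)" using c by (auto simp: maximal_atlas_def X)
  have inj: "inj_on \<theta> V" and VY: "V \<subseteq> Y" and oV: "openin (top_of_set (coord_space J)) (\<theta> ` V)"
    using c0 by (auto simp: chart_on_def)
  have i: "inv_into V \<theta> (\<theta> p) = p" if "p \<in> V" for p using inj that by simp
  have \<psi>: "\<psi> (\<phi> x) = x" if "x \<in> U" for x using b that by (auto simp: biholomorphic_on_def)
  have b': "biholomorphic_on J (U \<inter> \<theta> ` V) \<phi> \<psi>" by (rule biholomorphic_on_restrict[OF b oV])
  have im: "\<theta> ` ?V = U \<inter> \<theta> ` V" "(\<phi> \<circ> \<theta>) ` ?V = \<phi> ` (U \<inter> \<theta> ` V)" by auto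
  have VV: "?V \<inter> V = ?V" "V \<inter> ?V = ?V" by auto
  have c1: "chart_on Y (J, ?V, \<phi> \<circ> \<theta>)"
    using b' VY unfolding chart_on_def biholomorphic_on_def prod.case im
    by (auto intro!: inj_onI) (metis i \<psi>)
  have t1: "transition_holomorphic (J, ?V, \<phi> \<circ> \<theta>) (J, V, \<theta>)"
  proof (subst transition_holomorphic_iff[where \<phi>i = "inv_into V \<theta> \<circ> \<psi>"])
    show "(inv_into V \<theta> \<circ> \<psi>) ((\<phi> \<circ> \<theta>) p) = p" if "p \<in> ?V" for p using that i \<psi> by simp
    have "holomorphic_map J (\<phi> ` (U \<inter> \<theta> ` V)) (\<theta> \<circ> (inv_into V \<theta> \<circ> \<psi>))"
      by (rule holomorphic_map_cong[of _ _ \<psi>]) (use b' \<psi> i in \<open>auto simp: biholomorphic_on_def\<close>)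
    then show "openin (top_of_set (coord_space J)) ((\<phi> \<circ> \<theta>) ` (?V \<inter> V)) \<and>
      holomorphic_map J ((\<phi> \<circ> \<theta>) ` (?V \<inter> V)) (\<theta> \<circ> (inv_into V \<theta> \<circ> \<psi>))"
      using b' unfolding VV im by (auto simp: biholomorphic_on_def)
  qed
  have t2: "transition_holomorphic (J, V, \<theta>) (J, ?V, \<phi> \<circ> \<theta>)"
  proof (subst transition_holomorphic_iff[where \<phi>i = "inv_into V \<theta>"])
    show "inv_into V \<theta> (\<theta> p) = p" if "p \<in> V" for p using that i by simp
    have "holomorphic_map J (U \<inter> \<theta> ` V) (\<phi> \<circ> \<theta> \<circ> inv_into V \<theta>)"
      by (rule holomorphic_map_cong[of _ _ \<phi>]) (use b' i in \<open>auto simp: biholomorphic_on_def\<close>)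
    then show "openin (top_of_set (coord_space J)) (\<theta> ` (V \<inter> ?V)) \<and>
      holomorphic_map J (\<theta> ` (V \<inter> ?V)) (\<phi> \<circ> \<theta> \<circ> inv_into V \<theta>)"
      using b' unfolding VV im by (auto simp: biholomorphic_on_def)
  qed
  have "chart_compatible (J, ?V, \<phi> \<circ> \<theta>) c'" if c': "c' \<in> A" "chart_on Y c'" for c'
  proof -
    have comp: "transition_holomorphic (J, V, \<theta>) c'" "transition_holomorphic c' (J, V, \<theta>)"
      using c c' by (auto simp: maximal_atlas_def X chart_compatible_iff)
    obtain J' V' \<theta>' where c'_eq: "c' = (J', V', \<theta>')" by (cases c')
    have 1: "transition_holomorphic (J, ?V, \<phi> \<circ> \<theta>) c'"
      unfolding c'_eq
      by (rule transition_holomorphic_trans[OF c1 c'(2)[unfolded c'_eq]], rule exI[of _ "(J, V, \<theta>)"])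
         (use t1 t2 comp c0 c'_eq in auto)
    have 2: "transition_holomorphic c' (J, ?V, \<phi> \<circ> \<theta>)"
      unfolding c'_eq
      by (rule transition_holomorphic_trans[OF c'(2)[unfolded c'_eq] c1], rule exI[of _ "(J, V, \<theta>)"])
         (use t1 t2 comp c0 c'_eq in auto)
    show ?thesis using 1 2 by (simp add: chart_compatible_iff)
  qed
  then show ?thesis using c1 M unfolding maximal_atlas_def X is_manifold_def by blast
qed

lemma slice_chart_at:
  assumes M: "is_manifold X" and c: "(J, V, \<theta>) \<in> maximal_atlas X" and p: "p \<in> V" and im: "\<theta> ` (V \<inter> S) = \<theta> ` V \<inter> A"
    and slice: "local_slice J d A (\<theta> p)"
  shows "\<exists>J U \<phi> K. (J, U, \<phi>) \<in> maximal_atlas X \<and> p \<in> U \<and>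
        K \<subseteq> J \<and> card K = d \<and> \<phi> ` (U \<inter> S) = \<phi> ` U \<inter> coord_space K"
proof -
  obtain U \<phi> \<psi> K where *: "\<theta> p \<in> U" "biholomorphic_on J U \<phi> \<psi>" "K \<subseteq> J" "card K = d"
    "\<phi> ` (U \<inter> A) = \<phi> ` U \<inter> coord_space K"
    using slice unfolding local_slice_def by blast
  have inj: "inj_on \<theta> V" using c by (auto simp: maximal_atlas_def chart_on_def split: prod.splits)
  have \<phi>: "inj_on \<phi> U" using *(2) unfolding biholomorphic_on_def by (metis inj_onI)
  let ?V = "{q \<in> V. \<theta> q \<in> U}"
  note A = slice_mem_iff[OF inj im] and K = slice_mem_iff[OF \<phi> *(5)]
  have "(\<phi> \<circ> \<theta>) ` (?V \<inter> S) = (\<phi> \<circ> \<theta>) ` ?V \<inter> coord_space K"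
    using A K by auto
  with maximal_atlas_compose[OF M c *(2)] p * show ?thesis
    by (intro exI[of _ J] exI[of _ ?V] exI[of _ "\<phi> \<circ> \<theta>"] exI[of _ K]) auto
qed

text \<open>Two charts with values in the same \<open>\<complex>\<^sup>J\<close> that describe \<open>S\<close> by \<open>A\<close> and \<open>A'\<close>: being a slice at a
  point may be tested in either of them.\<close>

lemma local_slice_change_chart:
  assumes M: "is_manifold X" and c: "(J, V, \<theta>) \<in> maximal_atlas X" "(J, V', \<theta>') \<in> maximal_atlas X"
    and p: "p \<in> V" "p \<in> V'"
    and im: "\<theta> ` (V \<inter> S) = \<theta> ` V \<inter> A" "\<theta>' ` (V' \<inter> S) = \<theta>' ` V' \<inter> A'"
    and slice: "local_slice J d A' (\<theta>' p)"
  shows "local_slice J d A (\<theta> p)"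
proof -
  let ?U = "\<theta> ` (V \<inter> V')"
  have t: "transition_holomorphic (J, V, \<theta>) (J, V', \<theta>')" "transition_holomorphic (J, V', \<theta>') (J, V, \<theta>)"
    using maximal_atlas_compatible[OF M c] by (auto simp: chart_compatible_iff)
  have inj: "inj_on \<theta> V" "inj_on \<theta>' V'"
    using c by (auto simp: maximal_atlas_def chart_on_def split: prod.splits)
  note A = slice_mem_iff[OF inj(1) im(1)] and A' = slice_mem_iff[OF inj(2) im(2)]
  have U': "(\<theta>' \<circ> inv_into V \<theta>) ` ?U = \<theta>' ` (V' \<inter> V)"
    using inj by (auto simp: image_iff)
  show ?thesis
  proof (rule local_slice_transport[where \<tau> = "\<theta>' \<circ> inv_into V \<theta>" and B = A'])
    show "biholomorphic_on J ?U (\<theta>' \<circ> inv_into V \<theta>) (\<theta> \<circ> inv_into V' \<theta>')"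
      unfolding biholomorphic_on_def U' using t inj by (auto simp: transition_holomorphic_def)
    show "\<theta> p \<in> ?U" using p by auto
    show "(\<theta>' \<circ> inv_into V \<theta>) ` (?U \<inter> A) = (\<theta>' \<circ> inv_into V \<theta>) ` ?U \<inter> A'"
      using A A' inj by (auto simp: image_iff)
    show "local_slice J d A' ((\<theta>' \<circ> inv_into V \<theta>) (\<theta> p))" using slice p inj by simp
  qed
qed

lemma chart_compatible_refl:
  assumes "chart_on X c"
  shows "chart_compatible c c"
proof -
  obtain J U \<phi> where c: "c = (J, U, \<phi>)" by (cases c)
  have "holomorphic_map J (\<phi> ` U) (\<phi> \<circ> inv_into U \<phi>)"
    by (rule holomorphic_map_cong[OF _ holomorphic_map_id])
       (use assms in \<open>auto simp: chart_on_def c\<close>)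
  then show ?thesis using assms by (auto simp: chart_compatible_def chart_on_def c)
qed

section \<open>Rational maps\<close>

lemma holomorphic_map_rational:
  fixes f :: "complex^'i \<Rightarrow> complex^'i"
  assumes poly: "\<And>i. poly_fun (N i)" "poly_fun d" and nz: "\<And>x. x \<in> S \<Longrightarrow> d x \<noteq> 0"
    and S: "openin (top_of_set (coord_space J)) S"
    and f: "\<And>x i. x \<in> S \<Longrightarrow> f x $ i = N i x / d x"
  shows "holomorphic_map J S f"
proof (rule holomorphic_map_cong[OF S])
  let ?g = "\<lambda>x. \<chi> i. N i x / d x"
  let ?D = "\<lambda>x. \<chi> i j. (gradient (N i) j x * d x - N i x * gradient d j x) / (d x * d x)"
  show "holomorphic_map J S ?g"
  proof (rule holomorphic_mapI_at)
    fix x assume x: "x \<in> S"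
    show "(?g has_derivative ((*v) (?D x))) (at x)"
    proof (rule has_derivative_vecI)
      fix i
      have "((\<lambda>x. N i x / d x) has_derivative
          (\<lambda>h. ((\<Sum>j\<in>UNIV. gradient (N i) j x * h $ j) * d x - N i x * (\<Sum>j\<in>UNIV. gradient d j x * h $ j)) / (d x * d x))) (at x)"
        using has_derivative_divide'[OF gradient(2)[OF poly(1)] gradient(2)[OF poly(2)] nz[OF x], of i] .
      then show "((\<lambda>x. ?g x $ i) has_derivative (\<lambda>h. (?D x *v h) $ i)) (at x)"
        by (simp add: matrix_vector_mult_def sum_distrib_left sum_distrib_right sum_divide_distrib
            sum_subtractf[symmetric] field_simps)
    qed
  qed
qed (use f in \<open>simp add: vec_eq_iff\<close>)

text \<open>By Cramer's rule these are the entries of the adjugate matrix; they are polynomial in \<open>X\<close>.\<close>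

definition adjugate_entry :: "complex^'n^'n \<Rightarrow> 'n \<Rightarrow> 'n \<Rightarrow> complex" where
  "adjugate_entry X i k = det (\<chi> a b. if b = i then (if a = k then 1 else 0) else X $ a $ b)"

lemma matrix_inv_entry:
  fixes X :: "complex^'n^'n"
  assumes "det X \<noteq> 0"
  shows "matrix_inv X $ i $ k = adjugate_entry X i k / det X"
proof -
  let ?e = "(\<chi> a. if a = k then 1 else 0) :: complex^'n"
  have "X *v (matrix_inv X *v ?e) = ?e"
    by (simp add: matrix_vector_mul_assoc matrix_inv_props assms)
  then have "matrix_inv X *v ?e = (\<chi> i. det (\<chi> a b. if b = i then ?e $ a else X $ a $ b) / det X)"
    using cramer[OF assms] by blast
  then have "(matrix_inv X *v ?e) $ i = adjugate_entry X i k / det X"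
    by (simp add: adjugate_entry_def cong: if_cong)
  moreover have "(matrix_inv X *v ?e) $ i = matrix_inv X $ i $ k"
    by (simp add: matrix_vector_mult_def if_distrib[of "\<lambda>c. _ * c"] cong: if_cong)
  ultimately show ?thesis by simp
qed

lemma det_nz_iff_row_kernel:
  fixes X :: "complex^'n^'n"
  shows "det X \<noteq> 0 \<longleftrightarrow> (\<forall>v. v v* X = 0 \<longrightarrow> v = 0)"
proof -
  have "det X \<noteq> 0 \<longleftrightarrow> invertible (transpose X)" by (simp add: invertible_det_nz)
  also have "\<dots> \<longleftrightarrow> (\<exists>B. B ** transpose X = mat 1)" by (rule invertible_left_inverse)
  also have "\<dots> \<longleftrightarrow> (\<forall>v. transpose X *v v = 0 \<longrightarrow> v = 0)" by (rule matrix_left_invertible_ker)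
  finally show ?thesis by simp
qed

section \<open>Coordinates on the Grassmannian\<close>

definition diag_mat :: "'n set \<Rightarrow> complex^'n^'n::finite" where
  "diag_mat I = (\<chi> i j. if i = j \<and> i \<in> I then 1 else 0)"

text \<open>The idempotent whose row space is the graph with coordinates \<open>A\<close>, see \<open>range_graph_matrix\<close>.\<close>

definition graph_matrix :: "'n set \<Rightarrow> complex^('n \<times> 'n) \<Rightarrow> complex^'n^'n::finite" where
  "graph_matrix I A = (\<chi> i j. if i \<in> I then (if j \<in> I then (if i = j then 1 else 0) else A $ (i, j)) else 0)"

definition off_diag :: "'n set \<Rightarrow> complex^'n^'n \<Rightarrow> complex^('n \<times> 'n::finite)" where
  "off_diag I T = (\<chi> p. if p \<in> I \<times> - I then T $ fst p $ snd p else 0)"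

definition translate :: "(complex^'n) set \<Rightarrow> complex^'n^'n \<Rightarrow> (complex^'n) set" where
  "translate W g = (\<lambda>v. v v* g) ` W"

lemma translate_translate: "translate (translate W g) h = translate W (g ** h)"
  by (simp add: translate_def image_image vector_matrix_mul_assoc)

lemma translate_mat_1 [simp]: "translate W (mat 1) = W"
  by (simp add: translate_def)

lemma sum_delta_restrict:
  fixes f :: "'n::finite \<Rightarrow> complex"
  shows "(\<Sum>i\<in>UNIV. f i * (if i = j \<and> P i then 1 else 0)) = (if P j then f j else 0)"
    "(\<Sum>i\<in>UNIV. (if j = i \<and> P j then 1 else 0) * f i) = (if P j then f j else 0)"
proof -
  have "(\<Sum>i\<in>UNIV. f i * (if i = j \<and> P i then 1 else 0)) = (\<Sum>i\<in>UNIV. if i = j then (if P j then f j else 0) else 0)"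
    by (rule sum.cong) auto
  then show "(\<Sum>i\<in>UNIV. f i * (if i = j \<and> P i then 1 else 0)) = (if P j then f j else 0)" by simp
  have "(\<Sum>i\<in>UNIV. (if j = i \<and> P j then 1 else 0) * f i) = (\<Sum>i\<in>UNIV. if i = j then (if P j then f j else 0) else 0)"
    by (rule sum.cong) auto
  then show "(\<Sum>i\<in>UNIV. (if j = i \<and> P j then 1 else 0) * f i) = (if P j then f j else 0)" by simp
qed

lemma vec_diag_mat: "v v* diag_mat I = coord_proj I v"
  unfolding vec_eq_iff vector_matrix_mult_def diag_mat_def coord_proj_def vec_lambda_beta sum_delta_restrict
  by simp

lemma off_diag_in [simp]: "off_diag I T \<in> coord_space (I \<times> - I)"
  by (simp add: off_diag_def coord_space_def)

lemma vec_graph_matrix: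
  "(v v* graph_matrix I A) $ j = (if j \<in> I then v $ j else (\<Sum>i\<in>I. v $ i * A $ (i, j)))"
proof (cases "j \<in> I")
  case True
  have "(v v* graph_matrix I A) $ j = (\<Sum>i\<in>UNIV. if i = j then v $ j else 0)"
    unfolding vector_matrix_mult_def graph_matrix_def vec_lambda_beta
    by (rule sum.cong) (use True in auto)
  then show ?thesis using True by simp
next
  case False
  have "(v v* graph_matrix I A) $ j = (\<Sum>i\<in>UNIV. if i \<in> I then v $ i * A $ (i, j) else 0)"
    unfolding vector_matrix_mult_def graph_matrix_def vec_lambda_beta
    by (rule sum.cong) (use False in auto)
  then show ?thesis using False by (simp add: sum.If_cases)
qed

lemma graph_subspace_iff: "v \<in> graph_subspace I A \<longleftrightarrow> v v* graph_matrix I A = v"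
  by (auto simp: graph_subspace_def vec_eq_iff vec_graph_matrix)

lemma range_graph_matrix: "range_space (graph_matrix I A) = graph_subspace I A"
proof -
  have "v v* graph_matrix I A \<in> graph_subspace I A" for v
    by (auto simp: graph_subspace_def vec_graph_matrix)
  moreover have "v \<in> range_space (graph_matrix I A)" if "v \<in> graph_subspace I A" for v
    using that unfolding range_space_def graph_subspace_iff by (metis (mono_tags, lifting) mem_Collect_eq)
  ultimately show ?thesis by (auto simp: range_space_def)
qed

lemma graph_subspace_Int: "graph_subspace I A \<inter> coord_space (- I) = {0}"
proof -
  have "v = 0" if v: "v \<in> graph_subspace I A" "v \<in> coord_space (- I)" for v
  proof -
    have I: "v $ i = 0" if "i \<in> I" for i using v(2) that by (simp add: coord_space_def)
    have "v $ j = 0" for j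
      by (cases "j \<in> I") (use I v(1) in \<open>auto simp: graph_subspace_def\<close>)
    then show ?thesis by (simp add: vec_eq_iff)
  qed
  moreover have "0 \<in> graph_subspace I A" by (simp add: graph_subspace_def)
  ultimately show ?thesis by auto
qed

lemma graph_subspace_inject:
  assumes "A \<in> coord_space (I \<times> - I)" "B \<in> coord_space (I \<times> - I)" "graph_subspace I A = graph_subspace I B"
  shows "A = B"
proof -
  have "A $ (i, j) = B $ (i, j)" for i j
  proof (cases "i \<in> I \<and> j \<notin> I")
    case True
    let ?v = "graph_matrix I A $ i"
    have "?v = axis i 1 v* graph_matrix I A"
      by (simp add: vec_eq_iff vector_matrix_mult_def axis_def if_distrib[of "\<lambda>c. c * _"] cong: if_cong)
    then have "?v \<in> graph_subspace I A" using range_graph_matrix[of I A] by (auto simp: range_space_def)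
    then have "?v \<in> graph_subspace I B" using assms by simp
    then have "?v $ j = (\<Sum>k\<in>I. ?v $ k * B $ (k, j))" using True by (simp add: graph_subspace_def)
    also have "\<dots> = (\<Sum>k\<in>I. if k = i then B $ (i, j) else 0)"
      using True by (intro sum.cong) (auto simp: graph_matrix_def)
    finally show ?thesis using True by (simp add: graph_matrix_def)
  next
    case False
    then show ?thesis using assms by (auto simp: coord_space_def)
  qed
  then show ?thesis by (simp add: vec_eq_iff)
qed

lemma subspace_graph_subspace: "vec.subspace (graph_subspace I A)"
  by (auto simp: vec.subspace_def graph_subspace_def algebra_simps sum.distrib sum_distrib_left)

lemma linear_vector_matrix: "Vector_Spaces.linear (*s) (*s) (\<lambda>v::complex^'n. v v* (g :: complex^'m^'n))"
  by (simp add: complex_linear_iff vector_matrix_left_distrib scalar_vector_matrix_assoc)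

lemma subspace_coord_space_complex: "vec.subspace (coord_space I)"
  by (auto simp: vec.subspace_def coord_space_def)

lemma dim_coord_space_complex: "vec.dim (coord_space I) = card I"
  unfolding coord_space_def by (rule dim_substandard_cart)

lemma dim_graph_subspace: "vec.dim (graph_subspace I A) = card I"
proof -
  let ?f = "\<lambda>v. v v* graph_matrix I A"
  have "?f ` coord_space I = graph_subspace I A"
  proof (intro equalityI subsetI)
    fix w assume w: "w \<in> graph_subspace I A"
    have "?f (coord_proj I w) = w"
      using w by (auto simp: vec_eq_iff vec_graph_matrix coord_proj_def graph_subspace_def)
    then show "w \<in> ?f ` coord_space I" by (metis coord_proj_in image_eqI)
  qed (use range_graph_matrix[of I A] in \<open>auto simp: range_space_def\<close>)
  moreover have "inj_on ?f (vec.span (coord_space I))"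
  proof (rule inj_onI)
    fix x y assume "x \<in> vec.span (coord_space I)" "y \<in> vec.span (coord_space I)" and eq: "?f x = ?f y"
    then have "x \<in> coord_space I" "y \<in> coord_space I"
      using vec.span_eq_iff subspace_coord_space_complex by blast+
    moreover have "x $ i = y $ i" if "i \<in> I" for i
      using arg_cong[OF eq, of "\<lambda>v. v $ i"] that by (simp add: vec_graph_matrix)
    ultimately show "x = y" unfolding vec_eq_iff coord_space_def by (metis (mono_tags, lifting) mem_Collect_eq)
  qed
  ultimately show ?thesis
    using vec.dim_image_eq[OF linear_vector_matrix, of "graph_matrix I A" "coord_space I"]
    by (simp add: dim_coord_space_complex)
qed

lemma graph_subspace_grassmannian: "graph_subspace I A \<in> grassmannian (card I)"
  by (simp add: grassmannian_def subspace_graph_subspace dim_graph_subspace)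

lemma inj_translate:
  fixes g :: "complex^'n^'n"
  assumes "det g \<noteq> 0"
  shows "inj (\<lambda>v. v v* g)"
  by (rule inj_on_inverseI[where g = "\<lambda>v. v v* matrix_inv g"])
     (simp add: vector_matrix_mul_assoc matrix_inv_props assms)

lemma translate_grassmannian:
  fixes g :: "complex^'n^'n"
  assumes "det g \<noteq> 0" "W \<in> grassmannian k"
  shows "translate W g \<in> grassmannian k"
proof -
  have "vec.dim (translate W g) = vec.dim W"
    unfolding translate_def
    by (rule vec.dim_image_eq[OF linear_vector_matrix]) (rule inj_on_subset[OF inj_translate[OF assms(1)]], auto)
  moreover have "vec.subspace (translate W g)"
    using assms(2) unfolding translate_def grassmannian_def
    by (intro vec.linear_subspace_image[OF linear_vector_matrix]) auto
  ultimately show ?thesis using assms(2) by (simp add: grassmannian_def)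
qed

text \<open>The projection to \<open>\<complex>\<^sup>I\<close> is injective on \<open>W\<close>, hence bijective by dimension; the preimages of the
  unit vectors are the rows of the matrix that defines the graph.\<close>

lemma graph_subspace_exists:
  fixes W :: "(complex^'n) set"
  assumes W: "W \<in> grassmannian (card I)" and Int: "W \<inter> coord_space (- I) = {0}"
  shows "\<exists>A\<in>coord_space (I \<times> - I). W = graph_subspace I A"
proof -
  have sub: "vec.subspace W" and dim: "vec.dim W = card I" using W by (auto simp: grassmannian_def)
  have ker: "v = 0" if "v \<in> W" "\<And>i. i \<in> I \<Longrightarrow> v $ i = 0" for v
    using Int that by (auto simp: coord_space_def)
  have lin: "Vector_Spaces.linear (*s) (*s) (coord_proj I :: complex^'n \<Rightarrow> _)" by (rule linear_coord_proj)
  have inj: "inj_on (coord_proj I) W"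
  proof (rule inj_onI)
    fix x y assume xy: "x \<in> W" "y \<in> W" "coord_proj I x = coord_proj I y"
    have "x - y = 0"
    proof (rule ker)
      show "x - y \<in> W" using xy sub by (simp add: vec.subspace_diff)
      show "(x - y) $ i = 0" if "i \<in> I" for i
        using arg_cong[OF xy(3), of "\<lambda>v. v $ i"] that by (simp add: coord_proj_def)
    qed
    then show "x = y" by simp
  qed
  have "vec.dim (coord_proj I ` W) = card I"
    using vec.dim_image_eq[OF lin, of W] inj sub dim by (simp add: vec.span_eq_iff[THEN iffD2])
  then have im: "coord_proj I ` W = coord_space I"
    by (intro vec.subspace_dim_equal vec.linear_subspace_image[OF lin] sub subspace_coord_space_complex)
       (auto simp: dim_coord_space_complex)
  have "\<exists>w\<in>W. coord_proj I w = axis i 1" if "i \<in> I" for i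
  proof -
    have "axis i 1 \<in> coord_proj I ` W" unfolding im using that by (auto simp: coord_space_def axis_def)
    then show ?thesis by force
  qed
  then obtain w where w: "\<And>i. i \<in> I \<Longrightarrow> w i \<in> W" "\<And>i. i \<in> I \<Longrightarrow> coord_proj I (w i) = axis i 1"
    by metis
  have wI: "w i $ j = (if i = j then 1 else 0)" if "i \<in> I" "j \<in> I" for i j
    using arg_cong[OF w(2)[OF that(1)], of "\<lambda>v. v $ j"] that(2) by (auto simp: coord_proj_def axis_def)
  define A where "A = (\<chi> p. if p \<in> I \<times> - I then w (fst p) $ snd p else 0)"
  have sum_in: "(\<Sum>i\<in>I. v $ i *s w i) \<in> W" for v :: "complex^'n"
    using w(1) sub by (intro vec.subspace_sum vec.subspace_scale) auto
  have sum_I: "(\<Sum>i\<in>I. v $ i *s w i) $ j = v $ j" if "j \<in> I" for v :: "complex^'n" and j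
  proof -
    have "(\<Sum>i\<in>I. v $ i *s w i) $ j = (\<Sum>i\<in>I. if i = j then v $ j else 0)"
      unfolding sum_component by (rule sum.cong) (use wI that in auto)
    then show ?thesis using that by simp
  qed
  have sum_nI: "(\<Sum>i\<in>I. v $ i *s w i) $ j = (\<Sum>i\<in>I. v $ i * A $ (i, j))" if "j \<notin> I" for v :: "complex^'n" and j
    using that by (simp add: A_def)
  have "W = graph_subspace I A"
  proof (intro equalityI subsetI)
    fix v assume v: "v \<in> W"
    have "v - (\<Sum>i\<in>I. v $ i *s w i) = 0"
      by (rule ker) (use v sub sum_in sum_I in \<open>auto simp: vec.subspace_diff simp del: sum_component\<close>)
    then have "v = (\<Sum>i\<in>I. v $ i *s w i)" by simp
    then have v_eq: "v $ j = (\<Sum>i\<in>I. v $ i *s w i) $ j" for j by (rule arg_cong)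
    show "v \<in> graph_subspace I A"
      unfolding graph_subspace_def mem_Collect_eq
    proof (intro allI impI)
      fix j assume "j \<notin> I"
      show "v $ j = (\<Sum>i\<in>I. v $ i * A $ (i, j))"
        using v_eq[of j] sum_nI[OF \<open>j \<notin> I\<close>, of v] by (rule trans)
    qed
  next
    fix v assume v: "v \<in> graph_subspace I A"
    have "v $ j = (\<Sum>i\<in>I. v $ i *s w i) $ j" for j
    proof (cases "j \<in> I")
      case True
      show ?thesis using sum_I[OF True, of v] by (rule sym)
    next
      case False
      then have "v $ j = (\<Sum>i\<in>I. v $ i * A $ (i, j))" using v by (simp add: graph_subspace_def)
      also note sum_nI[OF False, of v, symmetric]
      finally show ?thesis .
    qed
    then have "v = (\<Sum>i\<in>I. v $ i *s w i)" unfolding vec_eq_iff by blast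
    then show "v \<in> W" using sum_in by metis
  qed
  moreover have "A \<in> coord_space (I \<times> - I)" by (simp add: A_def coord_space_def)
  ultimately show ?thesis by blast
qed

definition graph_coord :: "'n set \<Rightarrow> (complex^'n) set \<Rightarrow> complex^('n \<times> 'n::finite)" where
  "graph_coord I W = (THE A. A \<in> coord_space (I \<times> - I) \<and> W = graph_subspace I A)"

lemma graph_coord_graph:
  "A \<in> coord_space (I \<times> - I) \<Longrightarrow> graph_coord I (graph_subspace I A) = A"
  unfolding graph_coord_def by (rule the_equality) (simp, metis graph_subspace_inject)

lemma graph_coord:
  assumes "W \<in> grassmannian (card I)" "W \<inter> coord_space (- I) = {0}"
  shows "graph_coord I W \<in> coord_space (I \<times> - I)" "graph_subspace I (graph_coord I W) = W"
proof -
  obtain A where A: "A \<in> coord_space (I \<times> - I)" "W = graph_subspace I A"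
    using graph_subspace_exists[OF assms] by blast
  then have "graph_coord I W = A" using graph_coord_graph by blast
  then show "graph_coord I W \<in> coord_space (I \<times> - I)" "graph_subspace I (graph_coord I W) = W"
    using A by simp_all
qed

section \<open>Charts of the Grassmannian in moved coordinates\<close>

text \<open>The standard chart after a change of basis by \<open>g\<close>. Such charts are needed twice: the unit group
  moves charts, and the range and the null space of an idempotent become coordinate subspaces only after
  a change of basis.\<close>

definition moved_chart :: "'n set \<Rightarrow> complex^'n^'n \<Rightarrow> ((complex^'n::finite) set, 'n \<times> 'n) chart" where
  "moved_chart I g = (I \<times> - I,
     {W \<in> grassmannian (card I). translate W g \<inter> coord_space (- I) = {0}},
     \<lambda>W. graph_coord I (translate W g))"

lemma grassmann_chart_eq: "card I = k \<Longrightarrow> grassmann_chart k I = moved_chart I (mat 1)"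
  by (simp add: grassmann_chart_def moved_chart_def graph_coord_def[abs_def])

text \<open>The rows of \<open>T\<close> with index in \<open>I\<close>, renumbered by a bijection \<open>\<sigma>\<close> from \<open>I'\<close> to \<open>I\<close>, so that a basis
  of a subspace given in the chart of \<open>I\<close> is put in the place where the chart of \<open>I'\<close> expects it.\<close>

definition frame :: "'n set \<Rightarrow> ('n \<Rightarrow> 'n) \<Rightarrow> complex^'n^'n \<Rightarrow> complex^'n^'n::finite" where
  "frame I' \<sigma> T = (\<chi> i j. if i \<in> I' then T $ \<sigma> i $ j else 0)"

text \<open>For \<open>F\<close> with rows in \<open>I'\<close> only, the block of \<open>F\<close> in the rows and columns \<open>I'\<close>, completed by the
  identity so as to become a square matrix of full size.\<close>

definition frame_minor :: "'n set \<Rightarrow> complex^'n^'n \<Rightarrow> complex^'n^'n::finite" where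
  "frame_minor I' F = F ** diag_mat I' + mat 1 - diag_mat I'"

lemma axis_vector_matrix: "axis i 1 v* A = A $ i"
  by (simp add: vec_eq_iff vector_matrix_mult_def axis_def if_distrib[of "\<lambda>c. c * _"] cong: if_cong)

lemma matrix_eq_rowI:
  fixes A B :: "complex^'n^'m"
  assumes "\<And>v. v v* A = v v* B"
  shows "A = B"
  using assms[of "axis i 1" for i] by (simp add: axis_vector_matrix vec_eq_iff)

lemma diag_mat_mult: "(diag_mat I ** F) $ i $ j = (if i \<in> I then F $ i $ j else 0)"
  unfolding matrix_matrix_mult_def diag_mat_def vec_lambda_beta
  by (rule sum_delta_restrict(2)[where P = "\<lambda>i. i \<in> I" and f = "\<lambda>k. F $ k $ j"])

lemma mult_diag_mat: "(F ** diag_mat I) $ i $ j = (if j \<in> I then F $ i $ j else 0)"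
  unfolding matrix_matrix_mult_def diag_mat_def vec_lambda_beta sum_delta_restrict by (rule refl)

lemma vec_frame_minor: "v v* frame_minor I F = coord_proj I (v v* F) + v - coord_proj I v"
  by (simp add: frame_minor_def vector_matrix_mult_diff_rdistrib vector_matrix_mult_add_rdistrib
      vector_matrix_mul_assoc[symmetric] vec_diag_mat)

lemma coord_proj_add: "coord_proj I (x + y) = coord_proj I x + coord_proj I y"
  and coord_proj_diff: "coord_proj I (x - y) = coord_proj I x - coord_proj I y"
  by (auto simp: coord_proj_def vec_eq_iff)

text \<open>Row reduction: multiplying \<open>F\<close> from the left by the inverse of its block in the columns \<open>I\<close> keeps
  the row space and turns that block into the identity, so the other columns hold the graph
  coordinates.\<close>

lemma frame_normal_form:
  fixes F :: "complex^'n^'n"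
  assumes EF: "diag_mat I ** F = F" and det: "det (frame_minor I F) \<noteq> 0"
  shows "range_space F = graph_subspace I (off_diag I (matrix_inv (frame_minor I F) ** F))"
proof -
  let ?E = "diag_mat I" and ?X = "frame_minor I F"
  define Z where "Z = matrix_inv ?X"
  have XZ: "?X ** Z = mat 1" and ZX: "Z ** ?X = mat 1"
    unfolding Z_def by (rule matrix_inv_props[OF det])+
  have EF': "coord_proj I v v* F = v v* F" for v
    using arg_cong[OF EF, of "\<lambda>M. v v* M"] by (simp add: vector_matrix_mul_assoc[symmetric] vec_diag_mat)
  have XE: "?X ** ?E = F ** ?E" and EX: "?E ** ?X = F ** ?E"
    by (rule matrix_eq_rowI; simp add: vector_matrix_mul_assoc[symmetric] vec_frame_minor vec_diag_mat
        coord_proj_add coord_proj_diff coord_proj_same EF')+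
  have ZE: "Z ** ?E = ?E ** Z"
  proof -
    have "Z ** (?X ** ?E) ** Z = Z ** (?E ** ?X) ** Z" using XE EX by simp
    then have "(Z ** ?X) ** ?E ** Z = Z ** ?E ** (?X ** Z)" by (simp add: matrix_mul_assoc)
    then show ?thesis by (simp add: XZ ZX)
  qed
  define T where "T = Z ** F"
  have TE: "T ** ?E = ?E"
  proof -
    have "T ** ?E = Z ** (?X ** ?E)" by (simp add: T_def XE matrix_mul_assoc)
    then show ?thesis by (simp add: matrix_mul_assoc ZX)
  qed
  have ET: "?E ** T = T"
    unfolding T_def matrix_mul_assoc ZE[symmetric] by (simp add: matrix_mul_assoc[symmetric] EF)
  have "T = graph_matrix I (off_diag I T)"
  proof -
    have 1: "T $ i $ j = 0" if "i \<notin> I" for i j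
      using arg_cong[OF ET, of "\<lambda>M. M $ i $ j"] that by (simp add: diag_mat_mult)
    have 2: "T $ i $ j = ?E $ i $ j" if "j \<in> I" for i j
      using arg_cong[OF TE, of "\<lambda>M. M $ i $ j"] that by (simp add: mult_diag_mat)
    show ?thesis
      using 1 2 by (auto simp: vec_eq_iff graph_matrix_def off_diag_def diag_mat_def)
  qed
  then have "range_space T = graph_subspace I (off_diag I T)"
    using range_graph_matrix[of I "off_diag I T"] by simp
  moreover have "range_space T = range_space F"
  proof -
    have "v v* T = (v v* Z) v* F" "v v* F = (v v* ?X) v* T" for v
      unfolding T_def vector_matrix_mul_assoc matrix_mul_assoc XZ by simp_all
    then show ?thesis unfolding range_space_def by blast
  qed
  ultimately show ?thesis by (simp add: T_def Z_def)
qed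

lemma frame_facts:
  fixes h :: "complex^'n^'n"
  assumes h: "det h \<noteq> 0" and \<sigma>: "bij_betw \<sigma> I' I"
  defines "F A \<equiv> frame I' \<sigma> (graph_matrix I A ** h)"
  shows "diag_mat I' ** F A = F A"
    "range_space (F A) = translate (graph_subspace I A) h"
    "translate (graph_subspace I A) h \<inter> coord_space (- I') = {0} \<longleftrightarrow> det (frame_minor I' (F A)) \<noteq> 0"
proof -
  show EF: "diag_mat I' ** F A = F A"
    by (simp add: vec_eq_iff diag_mat_mult F_def frame_def)
  let ?T = "graph_matrix I A ** h"
  have T0: "?T $ i $ j = 0" if "i \<notin> I" for i j
    using that by (simp add: matrix_matrix_mult_def graph_matrix_def)
  have key: "v v* F A = u v* ?T" if "\<And>i. i \<in> I' \<Longrightarrow> u $ \<sigma> i = v $ i" for u v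
  proof -
    have "(v v* F A) $ j = (u v* ?T) $ j" for j
    proof -
      have "(v v* F A) $ j = (\<Sum>i\<in>UNIV. if i \<in> I' then v $ i * ?T $ \<sigma> i $ j else 0)"
        by (auto simp: vector_matrix_mult_def F_def frame_def intro!: sum.cong)
      also have "\<dots> = (\<Sum>i\<in>I'. u $ \<sigma> i * ?T $ \<sigma> i $ j)"
        using that by (simp add: sum.If_cases)
      also have "\<dots> = (\<Sum>i\<in>I. u $ i * ?T $ i $ j)"
        by (rule sum.reindex_bij_betw[OF \<sigma>])
      also have "\<dots> = (u v* ?T) $ j"
        unfolding vector_matrix_mult_def vec_lambda_beta using T0
        by (intro sum.mono_neutral_left) auto
      finally show ?thesis .
    qed
    then show ?thesis by (simp add: vec_eq_iff)
  qed
  have forward: "\<exists>u. (\<forall>i\<in>I'. u $ \<sigma> i = v $ i)" for v :: "complex^'n"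
    by (rule exI[of _ "\<chi> i. v $ inv_into I' \<sigma> i"]) (use \<sigma> in \<open>auto simp: bij_betw_def\<close>)
  have backward: "\<exists>v. (\<forall>i\<in>I'. u $ \<sigma> i = v $ i)" for u :: "complex^'n"
    by (rule exI[of _ "\<chi> i. u $ \<sigma> i"]) simp
  have T: "u v* ?T = (u v* graph_matrix I A) v* h" for u by (simp add: vector_matrix_mul_assoc)
  show R: "range_space (F A) = translate (graph_subspace I A) h"
  proof -
    have "range_space (F A) = range_space ?T"
    proof (intro equalityI subsetI)
      fix w assume "w \<in> range_space (F A)"
      then obtain v where v: "w = v v* F A" by (auto simp: range_space_def)
      obtain u where "\<And>i. i \<in> I' \<Longrightarrow> u $ \<sigma> i = v $ i" using forward by blast
      then show "w \<in> range_space ?T" unfolding v using key by (auto simp: range_space_def)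
    next
      fix w assume "w \<in> range_space ?T"
      then obtain u where u: "w = u v* ?T" by (auto simp: range_space_def)
      obtain v where "\<And>i. i \<in> I' \<Longrightarrow> u $ \<sigma> i = v $ i" using backward by blast
      then have "w = v v* F A" unfolding u using key[of u v] by simp
      then show "w \<in> range_space (F A)" by (auto simp: range_space_def)
    qed
    also have "\<dots> = translate (range_space (graph_matrix I A)) h"
      unfolding range_space_def translate_def T by blast
    finally show ?thesis by (simp add: range_graph_matrix)
  qed
  let ?X = "frame_minor I' (F A)"
  show "translate (graph_subspace I A) h \<inter> coord_space (- I') = {0} \<longleftrightarrow> det ?X \<noteq> 0"
  proof
    assume "det ?X \<noteq> 0"
    from frame_normal_form[OF EF this] show "translate (graph_subspace I A) h \<inter> coord_space (- I') = {0}"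
      using R graph_subspace_Int by metis
  next
    assume Int: "translate (graph_subspace I A) h \<inter> coord_space (- I') = {0}"
    show "det ?X \<noteq> 0"
      unfolding det_nz_iff_row_kernel
    proof (intro allI impI)
      fix v assume "v v* ?X = 0"
      then have e: "coord_proj I' (v v* F A) + v - coord_proj I' v = 0" unfolding vec_frame_minor .
      have 1: "(v v* F A) $ i = 0" if "i \<in> I'" for i
        using arg_cong[OF e, of "\<lambda>v. v $ i"] that by (simp add: coord_proj_def)
      have 2: "v $ i = 0" if "i \<notin> I'" for i
        using arg_cong[OF e, of "\<lambda>v. v $ i"] that by (simp add: coord_proj_def)
      have "v v* F A \<in> translate (graph_subspace I A) h \<inter> coord_space (- I')"
        using R 1 by (auto simp: range_space_def coord_space_def)
      then have 0: "v v* F A = 0" using Int by simp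
      obtain u where u: "\<And>i. i \<in> I' \<Longrightarrow> u $ \<sigma> i = v $ i" using forward by blast
      have "(u v* graph_matrix I A) v* h = 0" using key[OF u] 0 T by simp
      then have "u v* graph_matrix I A = 0" using h det_nz_iff_row_kernel by blast
      then have "u $ i = 0" if "i \<in> I" for i
        using arg_cong[of _ _ "\<lambda>v. v $ i"] that by (metis vec_graph_matrix zero_index)
      then have "v $ i = 0" if "i \<in> I'" for i
        using u \<sigma> that by (metis bij_betwE)
      then show "v = 0" using 2 by (auto simp: vec_eq_iff)
    qed
  qed
qed

lemma poly_fun_matrix_mult:
  "(\<And>i j. poly_fun (\<lambda>x. P x $ i $ j)) \<Longrightarrow> (\<And>i j. poly_fun (\<lambda>x. Q x $ i $ j)) \<Longrightarrow>
   poly_fun (\<lambda>x. (P x ** Q x) $ i $ j)"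
  by (simp add: matrix_matrix_mult_def) (intro poly_fun_intros)

text \<open>Row reduction expresses the new coordinates as rational functions of the old ones, with the
  determinant of \<open>frame_minor\<close> as common denominator. That determinant is nonzero exactly where the new
  chart is defined.\<close>

lemma grassmann_transition:
  fixes h :: "complex^'n^'n"
  assumes h: "det h \<noteq> 0" and card: "card I = card I'"
  defines "D \<equiv> {A \<in> coord_space (I \<times> - I). translate (graph_subspace I A) h \<inter> coord_space (- I') = {0}}"
  shows "openin (top_of_set (coord_space (I \<times> - I))) D"
    "holomorphic_map (I \<times> - I) D (\<lambda>A. graph_coord I' (translate (graph_subspace I A) h))"
proof -
  obtain \<sigma> where \<sigma>: "bij_betw \<sigma> I' I"
    using card finite_same_card_bij[of I' I] by auto
  define F where "F A = frame I' \<sigma> (graph_matrix I A ** h)" for A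
  note F = frame_facts[OF h \<sigma>, folded F_def]
  have "poly_fun (\<lambda>A. graph_matrix I A $ i $ j)" for i j
    unfolding graph_matrix_def by (cases "i \<in> I"; cases "j \<in> I") (auto intro: poly_fun.intros)
  then have "poly_fun (\<lambda>A. (graph_matrix I A ** h) $ i $ j)" for i j
    by (intro poly_fun_matrix_mult poly_fun.const)
  then have pF: "poly_fun (\<lambda>A. F A $ i $ j)" for i j
    unfolding F_def frame_def by (cases "i \<in> I'") (auto intro: poly_fun.const)
  have pX: "poly_fun (\<lambda>A. frame_minor I' (F A) $ i $ j)" for i j
    unfolding frame_minor_def
    by (simp, intro poly_fun_intros poly_fun_matrix_mult pF)
  let ?d = "\<lambda>A. det (frame_minor I' (F A))"
  have pd: "poly_fun ?d" by (intro poly_fun_det pX)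
  have D: "D = {A \<in> coord_space (I \<times> - I). ?d A \<noteq> 0}"
    unfolding D_def F(3) ..
  have "open {A. ?d A \<noteq> 0}"
    by (intro open_Collect_neq poly_fun_continuous pd continuous_on_const)
  then show oD: "openin (top_of_set (coord_space (I \<times> - I))) D"
    unfolding D openin_open by (auto intro!: exI[of _ "{A. ?d A \<noteq> 0}"])
  let ?N = "\<lambda>p A. if p \<in> I' \<times> - I' then
      (\<Sum>k\<in>UNIV. adjugate_entry (frame_minor I' (F A)) (fst p) k * F A $ k $ snd p) else 0"
  show "holomorphic_map (I \<times> - I) D (\<lambda>A. graph_coord I' (translate (graph_subspace I A) h))"
  proof (rule holomorphic_map_rational[where N = ?N and d = ?d])
    have "poly_fun (\<lambda>A. adjugate_entry (frame_minor I' (F A)) i k)" for i k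
      unfolding adjugate_entry_def
      by (intro poly_fun_det) (auto intro!: poly_fun_if pX poly_fun.const)
    then show "poly_fun (?N p)" for p
      by (intro poly_fun_if poly_fun_intros pF)
    show "poly_fun ?d" by (rule pd)
    show "openin (top_of_set (coord_space (I \<times> - I))) D" by (rule oD)
    show nz: "?d A \<noteq> 0" if "A \<in> D" for A using that D by simp
    fix A p assume A: "A \<in> D"
    let ?B = "off_diag I' (matrix_inv (frame_minor I' (F A)) ** F A)"
    have "translate (graph_subspace I A) h = graph_subspace I' ?B"
      using frame_normal_form[OF F(1) nz[OF A]] F(2) by simp
    then have "graph_coord I' (translate (graph_subspace I A) h) = ?B"
      by (simp add: graph_coord_graph)
    then show "graph_coord I' (translate (graph_subspace I A) h) $ p = ?N p A / ?d A"
      by (simp add: off_diag_def matrix_matrix_mult_def matrix_inv_entry nz[OF A] sum_divide_distrib)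
  qed
qed

lemma det_matrix_inv:
  fixes g :: "complex^'n^'n"
  assumes "det g \<noteq> 0"
  shows "det (matrix_inv g) \<noteq> 0"
  using arg_cong[OF matrix_inv_props(1)[OF assms], of det] by (auto simp: det_mul)

lemma moved_chart_on:
  assumes g: "det g \<noteq> 0" and I: "card I = k"
  shows "chart_on (grassmannian k) (moved_chart I g)"
    "(\<lambda>W. graph_coord I (translate W g)) ` {W \<in> grassmannian k. translate W g \<inter> coord_space (- I) = {0}} = coord_space (I \<times> - I)"
    "\<And>W. W \<in> grassmannian k \<Longrightarrow> translate W g \<inter> coord_space (- I) = {0} \<Longrightarrow>
        translate (graph_subspace I (graph_coord I (translate W g))) (matrix_inv g) = W"
proof -
  let ?U = "{W \<in> grassmannian k. translate W g \<inter> coord_space (- I) = {0}}"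
  let ?\<phi> = "\<lambda>W. graph_coord I (translate W g)"
  note det_inv = det_matrix_inv[OF g]
  have W: "?\<phi> W \<in> coord_space (I \<times> - I)" "graph_subspace I (?\<phi> W) = translate W g" if "W \<in> ?U" for W
    using graph_coord[of "translate W g" I] translate_grassmannian[OF g, of W k] that I by auto
  show left: "translate (graph_subspace I (?\<phi> W)) (matrix_inv g) = W"
    if "W \<in> grassmannian k" "translate W g \<inter> coord_space (- I) = {0}" for W
    using W(2)[of W] that by (simp add: translate_translate matrix_inv_props[OF g])
  have right: "translate (graph_subspace I A) (matrix_inv g) \<in> ?U"
     "?\<phi> (translate (graph_subspace I A) (matrix_inv g)) = A" if "A \<in> coord_space (I \<times> - I)" for A
    using translate_grassmannian[OF det_inv graph_subspace_grassmannian[of I A]] that I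
    by (auto simp: translate_translate matrix_inv_props[OF g] graph_subspace_Int graph_coord_graph)
  show im: "?\<phi> ` ?U = coord_space (I \<times> - I)"
  proof (intro equalityI subsetI)
    fix A assume "A \<in> coord_space (I \<times> - I)"
    from right[OF this] show "A \<in> ?\<phi> ` ?U" by (metis (no_types, lifting) image_eqI)
  qed (use W(1) in auto)
  have "inj_on ?\<phi> ?U" by (rule inj_on_inverseI[where g = "\<lambda>A. translate (graph_subspace I A) (matrix_inv g)"])
      (use left in auto)
  then show "chart_on (grassmannian k) (moved_chart I g)"
    unfolding chart_on_def moved_chart_def prod.case I im by auto
qed

lemma moved_chart_transition:
  assumes g: "det g \<noteq> 0" "det g' \<noteq> 0" and I: "card I = k" "card I' = k"
  shows "transition_holomorphic (moved_chart I g) (moved_chart I' g')"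
proof -
  let ?U = "{W \<in> grassmannian k. translate W g \<inter> coord_space (- I) = {0}}"
  let ?U' = "{W \<in> grassmannian k. translate W g' \<inter> coord_space (- I') = {0}}"
  let ?\<phi> = "\<lambda>W. graph_coord I (translate W g)"
  let ?\<phi>i = "\<lambda>A. translate (graph_subspace I A) (matrix_inv g)"
  let ?h = "matrix_inv g ** g'"
  let ?D = "{A \<in> coord_space (I \<times> - I). translate (graph_subspace I A) ?h \<inter> coord_space (- I') = {0}}"
  have left: "?\<phi>i (?\<phi> W) = W" if "W \<in> ?U" for W using moved_chart_on(3)[OF g(1) I(1)] that by auto
  have h: "det ?h \<noteq> 0" using det_matrix_inv[OF g(1)] g(2) by (simp add: det_mul)
  have im: "?\<phi> ` (?U \<inter> ?U') = ?D"
  proof -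
    have "?\<phi> ` (?U \<inter> ?U') = {A \<in> ?\<phi> ` ?U. ?\<phi>i A \<in> ?U'}" using left by force
    also have "\<dots> = ?D"
      unfolding moved_chart_on(2)[OF g(1) I(1)]
      using translate_grassmannian[OF det_matrix_inv[OF g(1)] graph_subspace_grassmannian[of I]] I(1)
      by (auto simp: translate_translate)
    finally show ?thesis .
  qed
  have "(\<lambda>W. graph_coord I' (translate W g')) \<circ> ?\<phi>i
      = (\<lambda>A. graph_coord I' (translate (graph_subspace I A) ?h))"
    by (simp add: fun_eq_iff translate_translate)
  then show ?thesis
    unfolding moved_chart_def I
    using grassmann_transition[OF h, of I I'] I im
    by (subst transition_holomorphic_iff[where \<phi>i = ?\<phi>i]) (use left in auto)
qed

lemma moved_chart_maximal:
  fixes g :: "complex^'n^'n"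
  assumes "det g \<noteq> 0" "card I = k"
  shows "moved_chart I g \<in> maximal_atlas (grassmann_manifold k)"
proof -
  have "det (mat 1 :: complex^'n^'n) \<noteq> 0" by simp
  then show ?thesis
    using moved_chart_on(1)[OF assms] moved_chart_transition[of g "mat 1" I k]
      moved_chart_transition[of "mat 1" g _ k I] assms
    by (auto simp: maximal_atlas_def grassmann_manifold_def chart_compatible_iff grassmann_chart_eq)
qed

text \<open>Take a largest coordinate subspace that meets \<open>W\<close> trivially. By maximality \<open>W\<close> together with it
  contains every unit vector, so the two are complementary.\<close>

lemma coordinate_complement:
  fixes W :: "(complex^'n) set"
  assumes W: "W \<in> grassmannian k"
  shows "\<exists>I. card I = k \<and> W \<inter> coord_space (- I) = {0}"
proof -
  have sub: "vec.subspace W" and dim: "vec.dim W = k" using W by (auto simp: grassmannian_def)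
  have 0: "0 \<in> W" using sub by (rule vec.subspace_0)
  let ?P = "\<lambda>J. W \<inter> coord_space J = {0}"
  have "?P {}" using 0 by (auto simp: coord_space_def vec_eq_iff)
  moreover have "\<forall>J. ?P J \<longrightarrow> card J < Suc CARD('n)" by (simp add: less_Suc_eq_le card_mono)
  ultimately obtain J where J: "?P J" "\<And>J'. ?P J' \<Longrightarrow> card J' \<le> card J"
    using ex_has_greatest_nat[of ?P "{}" card "Suc CARD('n)"] by blast
  let ?S = "{x + y | x y. x \<in> W \<and> y \<in> coord_space J}"
  have S: "vec.subspace ?S" by (rule vec.subspace_sums[OF sub subspace_coord_space_complex])
  have "axis i 1 \<in> ?S" for i
  proof (cases "i \<in> J")
    case True
    then have "axis i 1 \<in> coord_space J" by (auto simp: coord_space_def axis_def)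
    then show ?thesis using 0 by force
  next
    case False
    then have "\<not> ?P (insert i J)" using J(2)[of "insert i J"] by auto
    then obtain v where v: "v \<in> W" "v \<in> coord_space (insert i J)" "v \<noteq> 0" using 0 by auto
    have vi: "v $ i \<noteq> 0"
    proof
      assume "v $ i = 0"
      then have "v \<in> coord_space J" using v(2) by (auto simp: coord_space_def)
      then show False using v J(1) by auto
    qed
    (* the multiple of v with entry 1 at i: it differs from the unit vector by an element of \<complex>^J *)
    let ?x = "inverse (v $ i) *s v"
    have "axis i 1 - ?x \<in> coord_space J"
      using v(2) vi False by (auto simp: coord_space_def axis_def)
    moreover have "?x \<in> W" using sub v(1) by (simp add: vec.subspace_scale)
    moreover have "axis i 1 = ?x + (axis i 1 - ?x)" by simp
    ultimately show ?thesis by blast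
  qed
  then have "cart_basis \<subseteq> ?S" by (auto simp: cart_basis_def)
  then have "vec.span cart_basis \<subseteq> ?S" using S by (rule vec.span_minimal)
  then have "?S = UNIV" by (simp add: span_cart_basis top.extremum_unique)
  then have "CARD('n) = k + card J"
    using vec.dim_sums_Int[OF sub subspace_coord_space_complex, of J] J(1) dim
    by (simp add: dim_coord_space_complex vec.dim_UNIV card_cart_basis)
  then have "card (- J) = k" by (simp add: Compl_eq_Diff_UNIV card_Diff_subset)
  then show ?thesis using J(1) by (intro exI[of _ "- J"]) auto
qed

lemma is_manifold_grassmann: "is_manifold (grassmann_manifold k :: ((complex^'n) set, 'n \<times> 'n::finite) manifold)"
  unfolding is_manifold_def grassmann_manifold_def prod.case
proof (intro conjI ballI)
  fix c :: "((complex^'n) set, 'n \<times> 'n) chart" assume "c \<in> grassmann_chart k ` {I. card I = k}"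
  then show "chart_on (grassmannian k) c"
    using moved_chart_on(1)[of "mat 1"] by (auto simp: grassmann_chart_eq)
next
  fix W :: "(complex^'n) set" assume "W \<in> grassmannian k"
  then show "\<exists>c\<in>grassmann_chart k ` {I. card I = k}. W \<in> fst (snd c)"
    using coordinate_complement[of W k] by (fastforce simp: grassmann_chart_def)
qed

lemma range_space_rank: "range_space e \<in> grassmannian (rank e)"
proof -
  have "range_space e = vec.span (rows e)"
  proof (intro equalityI subsetI)
    fix w assume "w \<in> range_space e"
    then obtain v where "w = v v* e" by (auto simp: range_space_def)
    then have "w = (\<Sum>i\<in>UNIV. v $ i *s row i e)"
      by (simp add: vec_eq_iff vector_matrix_mult_def row_def)
    also have "\<dots> \<in> vec.span (rows e)"
      by (intro vec.span_sum vec.span_scale vec.span_base) (auto simp: rows_def)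
    finally show "w \<in> vec.span (rows e)" .
  next
    have "range_space e = range (\<lambda>v. v v* e)" by (auto simp: range_space_def)
    then have "vec.subspace (range_space e)"
      using vec.linear_subspace_image[OF linear_vector_matrix vec.subspace_UNIV, of e] by (rule ssubst)
    moreover have "rows e \<subseteq> range_space e"
    proof
      fix w assume "w \<in> rows e"
      then obtain i where "w = axis i 1 v* e" by (auto simp: rows_def row_def axis_vector_matrix)
      then show "w \<in> range_space e" by (auto simp: range_space_def)
    qed
    ultimately show "w \<in> range_space e" if "w \<in> vec.span (rows e)" for w
      using that vec.span_minimal by blast
  qed
  then show ?thesis
    by (simp add: grassmannian_def row_rank_def_gen vec.dim_span)
qed

text \<open>The rows of \<open>b\<close> are a basis of the range of \<open>e\<close>, placed at indices \<open>I\<close> that make the range a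
  graph, and the projections along the range of the remaining unit vectors, which form a basis of the
  null space.\<close>

lemma idempotent_diagonalizable:
  fixes e :: "complex^'n^'n"
  assumes e: "e ** e = e"
  obtains b I where "det b \<noteq> 0" "card I = rank e" "b ** e ** matrix_inv b = diag_mat I"
    "e ** matrix_inv b = matrix_inv b ** diag_mat I"
proof -
  obtain I where I: "card I = rank e" "range_space e \<inter> coord_space (- I) = {0}"
    using coordinate_complement[OF range_space_rank] by blast
  obtain A where A: "range_space e = graph_subspace I A"
    using graph_subspace_exists[of "range_space e" I] range_space_rank[of e] I by auto
  let ?T = "graph_matrix I A"
  define b where "b = ?T + (mat 1 - diag_mat I) ** (mat 1 - e)"
  have eR: "v v* e = v" if "v \<in> range_space e" for v
    using that e by (auto simp: range_space_def vector_matrix_mul_assoc)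
  have Te: "(v v* ?T) v* e = v v* ?T" for v
    by (rule eR) (use A range_graph_matrix[of I A] in \<open>auto simp: range_space_def\<close>)
  have vb: "v v* b = v v* ?T + ((v - coord_proj I v) - (v - coord_proj I v) v* e)" for v
    by (simp add: b_def vector_matrix_mult_add_rdistrib vector_matrix_mul_assoc[symmetric]
        vector_matrix_mult_diff_rdistrib vec_diag_mat)
  have ee: "(v v* e) v* e = v v* e" for v by (simp add: vector_matrix_mul_assoc e)
  have vbe: "(v v* b) v* e = v v* ?T" for v
  proof -
    let ?u = "v - coord_proj I v"
    have "(v v* b) v* e = (v v* ?T) v* e + (?u v* e - (?u v* e) v* e)"
      unfolding vb by (simp only: vector_matrix_left_distrib vector_matrix_mult_diff_distrib)
    then show ?thesis unfolding Te ee by simp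
  qed
  have ET: "coord_proj I v v* ?T = v v* ?T" for v
    by (simp add: vec_eq_iff vec_graph_matrix coord_proj_def)
  have be: "b ** e = diag_mat I ** b"
  proof (rule matrix_eq_rowI)
    fix v
    have "v v* (diag_mat I ** b) = coord_proj I v v* b"
      by (simp add: vector_matrix_mul_assoc[symmetric] vec_diag_mat)
    also have "\<dots> = v v* ?T" unfolding vb ET by (simp add: coord_proj_same)
    finally show "v v* (b ** e) = v v* (diag_mat I ** b)"
      using vbe by (simp add: vector_matrix_mul_assoc)
  qed
  have det: "det b \<noteq> 0"
    unfolding det_nz_iff_row_kernel
  proof (intro allI impI)
    fix v assume v: "v v* b = 0"
    have T0: "v v* ?T = 0" using vbe[of v] v by simp
    have "v $ i = 0" if "i \<in> I" for i
      using arg_cong[OF T0, of "\<lambda>v. v $ i"] that by (simp add: vec_graph_matrix)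
    then have vI: "coord_proj I v = 0" "v \<in> coord_space (- I)"
      by (auto simp: coord_proj_def coord_space_def vec_eq_iff)
    have "v = v v* e" using v vb[of v] T0 vI by simp
    then have "v \<in> range_space e" by (auto simp: range_space_def)
    then show "v = 0" using vI(2) I(2) by auto
  qed
  note bb = matrix_inv_props[OF det]
  have ce: "b ** e ** matrix_inv b = diag_mat I"
    unfolding be by (simp add: matrix_mul_assoc[symmetric] bb)
  have "matrix_inv b ** (b ** e ** matrix_inv b) = (matrix_inv b ** b) ** e ** matrix_inv b"
    by (simp only: matrix_mul_assoc)
  then have "e ** matrix_inv b = matrix_inv b ** diag_mat I" unfolding ce by (simp add: bb)
  then show ?thesis by (rule that[OF det I(1) ce])
qed

section \<open>Polynomials in the matrix entries\<close>

definition flatten :: "complex^'n^'n \<Rightarrow> complex^('n \<times> 'n::finite)" where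
  "flatten x = (\<chi> p. x $ fst p $ snd p)"

definition unflatten :: "complex^('n \<times> 'n::finite) \<Rightarrow> complex^'n^'n" where
  "unflatten a = (\<chi> i j. a $ (i, j))"

lemma flatten_unflatten [simp]: "flatten (unflatten a) = a" "unflatten (flatten x) = x"
  by (simp_all add: flatten_def unflatten_def vec_eq_iff)

lemma entry_polynomial_poly_fun_comp:
  fixes f :: "complex^'n^'n \<Rightarrow> complex^'i"
  shows
  "poly_fun q \<Longrightarrow> (\<And>i. entry_polynomial (\<lambda>x. f x $ i)) \<Longrightarrow> entry_polynomial (\<lambda>x. q (f x))"
  by (induction rule: poly_fun.induct) (auto intro: entry_polynomial.intros)

lemma poly_fun_entry_polynomial_comp:
  fixes f :: "complex^'i \<Rightarrow> complex^'n^'n"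
  shows
  "entry_polynomial q \<Longrightarrow> (\<And>i j. poly_fun (\<lambda>x. f x $ i $ j)) \<Longrightarrow> poly_fun (\<lambda>x. q (f x))"
  by (induction rule: entry_polynomial.induct) (auto intro: poly_fun.intros)

lemma entry_polynomial_iff: "entry_polynomial p \<longleftrightarrow> poly_fun (\<lambda>a. p (unflatten a))"
proof
  assume "entry_polynomial p"
  then show "poly_fun (\<lambda>a. p (unflatten a))"
    by (rule poly_fun_entry_polynomial_comp) (simp add: unflatten_def poly_fun.coord)
next
  assume "poly_fun (\<lambda>a. p (unflatten a))"
  then have "entry_polynomial (\<lambda>x. p (unflatten (flatten x)))"
    by (rule entry_polynomial_poly_fun_comp) (simp add: flatten_def entry_polynomial.entry)
  then show "entry_polynomial p" by simp
qed

lemma entry_polynomial_det: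
  fixes f :: "complex^'n^'n \<Rightarrow> complex^'m^'m"
  shows
  "(\<And>i j. entry_polynomial (\<lambda>x. f x $ i $ j)) \<Longrightarrow> entry_polynomial (\<lambda>x. det (f x))"
  unfolding entry_polynomial_iff by (rule poly_fun_det)

lemma entry_polynomial_matrix_mult:
  fixes P :: "complex^'n^'n \<Rightarrow> complex^'k^'m" and Q :: "complex^'n^'n \<Rightarrow> complex^'l^'k"
  shows
  "(\<And>i j. entry_polynomial (\<lambda>x. P x $ i $ j)) \<Longrightarrow> (\<And>i j. entry_polynomial (\<lambda>x. Q x $ i $ j)) \<Longrightarrow>
   entry_polynomial (\<lambda>x. (P x ** Q x) $ i $ j)"
  unfolding entry_polynomial_iff by (rule poly_fun_matrix_mult)

lemma entry_polynomial_diff: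
  "entry_polynomial p \<Longrightarrow> entry_polynomial q \<Longrightarrow> entry_polynomial (\<lambda>x. p x - q x)"
  unfolding entry_polynomial_iff by (rule poly_fun_diff)

lemma entry_polynomial_adjugate_entry:
  fixes f :: "complex^'n^'n \<Rightarrow> complex^'m^'m"
  assumes "\<And>i j. entry_polynomial (\<lambda>x. f x $ i $ j)"
  shows "entry_polynomial (\<lambda>x. adjugate_entry (f x) i k)"
  unfolding adjugate_entry_def
proof (rule entry_polynomial_det)
  fix a b
  show "entry_polynomial (\<lambda>x. (\<chi> a b. if b = i then if a = k then 1 else 0 else f x $ a $ b) $ a $ b)"
    by (cases "b = i"; cases "a = k") (auto intro: assms entry_polynomial.const)
qed

text \<open>A rational substitution in a polynomial becomes polynomial after multiplication by a power of the
  denominator; this brings generic conditions on \<open>g\<close> into the form required by \<open>units_dense\<close>.\<close>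

lemma clear_denominators:
  fixes N :: "complex^'n^'n \<Rightarrow> complex^'n^'n"
  assumes "entry_polynomial p" and N: "\<And>i j. entry_polynomial (\<lambda>g. N g $ i $ j)" and d: "entry_polynomial d"
  shows "\<exists>Q m. entry_polynomial Q \<and>
    (\<forall>g. d g \<noteq> 0 \<longrightarrow> Q g = d g ^ m * p (\<chi> i j. N g $ i $ j / d g))"
  using assms(1)
proof (induction rule: entry_polynomial.induct)
  case (entry i j)
  show ?case by (rule exI[of _ "\<lambda>g. N g $ i $ j"], rule exI[of _ 1]) (simp add: N)
next
  case (const c)
  show ?case by (rule exI[of _ "\<lambda>g. c"], rule exI[of _ 0]) (simp add: entry_polynomial.const)
next
  case (add p q)
  have pow: "entry_polynomial (\<lambda>g. d g ^ m)" for m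
    by (induction m) (auto intro: entry_polynomial.intros d)
  obtain P m where P: "entry_polynomial P" "\<And>g. d g \<noteq> 0 \<Longrightarrow> P g = d g ^ m * p (\<chi> i j. N g $ i $ j / d g)"
    using add by blast
  obtain Q l where Q: "entry_polynomial Q" "\<And>g. d g \<noteq> 0 \<Longrightarrow> Q g = d g ^ l * q (\<chi> i j. N g $ i $ j / d g)"
    using add by blast
  show ?case
    by (rule exI[of _ "\<lambda>g. d g ^ l * P g + d g ^ m * Q g"], rule exI[of _ "m + l"])
       (auto intro!: entry_polynomial.intros(3,4) pow P(1) Q(1) simp: P(2) Q(2) power_add algebra_simps)
next
  case (mult p q)
  obtain P m where P: "entry_polynomial P" "\<And>g. d g \<noteq> 0 \<Longrightarrow> P g = d g ^ m * p (\<chi> i j. N g $ i $ j / d g)"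
    using mult by blast
  obtain Q l where Q: "entry_polynomial Q" "\<And>g. d g \<noteq> 0 \<Longrightarrow> Q g = d g ^ l * q (\<chi> i j. N g $ i $ j / d g)"
    using mult by blast
  show ?case
    by (rule exI[of _ "\<lambda>g. P g * Q g"], rule exI[of _ "m + l"])
       (auto intro!: entry_polynomial.intros(3,4) P(1) Q(1) simp: P(2) Q(2) power_add algebra_simps)
qed

section \<open>The matrix space as a manifold\<close>

lemma is_manifold_matrix: "is_manifold (matrix_manifold :: (complex^'n^'n, 'n \<times> 'n) manifold)"
  and flatten_chart: "(UNIV, UNIV, flatten) \<in> maximal_atlas (matrix_manifold :: (complex^'n^'n, 'n \<times> 'n) manifold)"
proof -
  have eq: "(\<lambda>x. \<chi> p. x $ fst p $ snd p) = (flatten :: complex^'n^'n \<Rightarrow> _)"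
    by (simp add: fun_eq_iff flatten_def)
  have surj: "range (flatten :: complex^'n^'n \<Rightarrow> _) = UNIV" by (metis flatten_unflatten(1) surjI)
  have "inj (flatten :: complex^'n^'n \<Rightarrow> _)" by (metis flatten_unflatten(2) injI)
  then have c: "chart_on UNIV (UNIV, UNIV, flatten :: complex^'n^'n \<Rightarrow> _)"
    by (simp add: chart_on_def surj)
  then show "is_manifold (matrix_manifold :: (complex^'n^'n, 'n \<times> 'n) manifold)"
    by (auto simp: is_manifold_def matrix_manifold_def eq)
  show "(UNIV, UNIV, flatten) \<in> maximal_atlas (matrix_manifold :: (complex^'n^'n, 'n \<times> 'n) manifold)"
    using c chart_compatible_refl[OF c] by (auto simp: maximal_atlas_def matrix_manifold_def eq)
qed

text \<open>Here \<open>\<beta>\<close> is a polynomial isomorphism of the matrix space with polynomial inverse \<open>\<gamma>\<close>, hence a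
  global chart.\<close>

lemma matrix_submanifoldI:
  fixes \<beta> :: "complex^'n^'n \<Rightarrow> complex^('n \<times> 'n)" and \<gamma> :: "complex^('n \<times> 'n) \<Rightarrow> complex^'n^'n"
  assumes poly: "\<And>p. entry_polynomial (\<lambda>x. \<beta> x $ p)" "\<And>i j. poly_fun (\<lambda>a. \<gamma> a $ i $ j)"
    and inv: "\<And>x. \<gamma> (\<beta> x) = x" "\<And>a. \<beta> (\<gamma> a) = a"
    and A: "A \<subseteq> coord_space J" "\<And>a. a \<in> A \<Longrightarrow> local_slice J d A a"
  shows "embedded_submanifold matrix_manifold d {x. \<beta> x \<in> A}"
proof -
  let ?\<phi> = "\<lambda>a. \<beta> (unflatten a)" and ?\<psi> = "\<lambda>a. flatten (\<gamma> a)"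
  have surj: "range ?\<phi> = UNIV" by (rule surjI[of _ ?\<psi>]) (simp add: inv)
  have surj': "range \<beta> = UNIV" by (rule surjI[of _ \<gamma>]) (simp add: inv)
  have "holomorphic_map UNIV UNIV ?\<phi>"
    by (rule holomorphic_map_rational[where N = "\<lambda>p a. \<beta> (unflatten a) $ p" and d = "\<lambda>_. 1"])
       (use poly(1) in \<open>auto simp: entry_polynomial_iff intro: poly_fun.const\<close>)
  moreover have "holomorphic_map UNIV UNIV ?\<psi>"
    by (rule holomorphic_map_rational[where N = "\<lambda>p a. flatten (\<gamma> a) $ p" and d = "\<lambda>_. 1"])
       (use poly(2) in \<open>auto simp: flatten_def intro: poly_fun.const\<close>)
  ultimately have "biholomorphic_on UNIV UNIV ?\<phi> ?\<psi>"
    by (simp add: biholomorphic_on_def surj inv)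
  from maximal_atlas_compose[OF is_manifold_matrix flatten_chart this]
  have c: "(UNIV, UNIV, \<beta>) \<in> maximal_atlas matrix_manifold" by (simp add: o_def)
  have im: "\<beta> ` (UNIV \<inter> {x. \<beta> x \<in> A}) = \<beta> ` UNIV \<inter> A"
    using surj' by auto
  show ?thesis
    unfolding embedded_submanifold_def
  proof (intro conjI ballI)
    show "{x. \<beta> x \<in> A} \<subseteq> fst matrix_manifold" by (simp add: matrix_manifold_def)
    fix p assume "p \<in> {x. \<beta> x \<in> A}"
    then have "local_slice UNIV d A (\<beta> p)" using A by (auto intro: local_slice_extend)
    from slice_chart_at[OF is_manifold_matrix c _ im this]
    show "\<exists>J U \<phi> K. (J, U, \<phi>) \<in> maximal_atlas matrix_manifold \<and> p \<in> U \<and> K \<subseteq> J \<and> card K = d \<and>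
        \<phi> ` (U \<inter> {x. \<beta> x \<in> A}) = \<phi> ` U \<inter> coord_space K" by simp
  qed
qed

section \<open>Homogeneous families of subspaces\<close>

text \<open>In the chart moved by \<open>b\<close> the family \<open>S\<close> is the algebraic set \<open>A\<close>. Take \<open>\<delta>\<close> from \<open>smooth_locus\<close>.
  Every member of \<open>S\<close> can be moved, by a transformation that preserves \<open>S\<close>, to a point of \<open>A\<close> where \<open>\<delta>\<close>
  is nonzero. The correspondingly moved chart therefore shows \<open>S\<close> as a slice near that member, and the
  dimension is the same everywhere. Changing back to the original chart, \<open>A\<close> is a slice at each of its
  points, also where \<open>\<delta>\<close> vanishes.\<close>

lemma homogeneous_family:
  fixes S :: "(complex^'n) set set" and b :: "complex^'n^'n"
  assumes S: "S \<subseteq> grassmannian k" and I: "card I = k" and b: "det b \<noteq> 0"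
    and A: "A \<subseteq> coord_space (I \<times> - I)" "\<And>p. p \<in> P \<Longrightarrow> poly_fun p" "A = {x. \<forall>p\<in>P. p x = 0}" "A \<noteq> {}"
    and chart: "\<And>W. W \<in> grassmannian k \<Longrightarrow> translate W b \<inter> coord_space (- I) = {0} \<Longrightarrow>
        W \<in> S \<longleftrightarrow> graph_coord I (translate W b) \<in> A"
    and move: "\<And>W \<delta>. W \<in> S \<Longrightarrow> poly_fun \<delta> \<Longrightarrow> \<exists>a\<in>A. \<delta> a \<noteq> 0 \<Longrightarrow>
        \<exists>g. det g \<noteq> 0 \<and> (\<forall>W'. W' \<in> S \<longleftrightarrow> translate W' g \<in> S) \<and>
          translate (translate W g) b \<inter> coord_space (- I) = {0} \<and>
          \<delta> (graph_coord I (translate (translate W g) b)) \<noteq> 0"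
  shows "\<exists>d. embedded_submanifold (grassmann_manifold k) d S \<and> (\<forall>a\<in>A. local_slice (I \<times> - I) d A a)"
proof -
  obtain \<delta> d where \<delta>: "poly_fun \<delta>" "\<exists>a\<in>A. \<delta> a \<noteq> 0"
    "\<And>a. a \<in> A \<Longrightarrow> \<delta> a \<noteq> 0 \<Longrightarrow> local_slice (I \<times> - I) d A a"
    using smooth_locus[OF A] by metis
  let ?V = "\<lambda>g. {W \<in> grassmannian k. translate W g \<inter> coord_space (- I) = {0}}"
  let ?\<theta> = "\<lambda>g W. graph_coord I (translate W g)"
  have im: "?\<theta> (g ** b) ` (?V (g ** b) \<inter> S) = ?\<theta> (g ** b) ` ?V (g ** b) \<inter> A"
    if g: "det g \<noteq> 0" "\<And>W'. W' \<in> S \<longleftrightarrow> translate W' g \<in> S" for g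
  proof -
    have "W \<in> S \<longleftrightarrow> ?\<theta> (g ** b) W \<in> A" if "W \<in> ?V (g ** b)" for W
      using chart[of "translate W g"] that g translate_grassmannian[OF g(1), of W k]
      by (simp add: translate_translate)
    then show ?thesis by auto
  qed
  have atlas: "(I \<times> - I, ?V g, ?\<theta> g) \<in> maximal_atlas (grassmann_manifold k)" if "det g \<noteq> 0" for g
    using moved_chart_maximal[OF that I] by (simp add: moved_chart_def I)
  have good: "\<exists>g. det g \<noteq> 0 \<and> (\<forall>W'. W' \<in> S \<longleftrightarrow> translate W' g \<in> S) \<and> W \<in> ?V (g ** b) \<and>
      local_slice (I \<times> - I) d A (?\<theta> (g ** b) W)" if W: "W \<in> S" for W
  proof -
    obtain g where g: "det g \<noteq> 0" "\<And>W'. W' \<in> S \<longleftrightarrow> translate W' g \<in> S"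
      "translate (translate W g) b \<inter> coord_space (- I) = {0}"
      "\<delta> (graph_coord I (translate (translate W g) b)) \<noteq> 0"
      using move[OF W \<delta>(1,2)] by blast
    have "W \<in> ?V (g ** b)" using g(3) W S by (auto simp: translate_translate)
    moreover then have "?\<theta> (g ** b) W \<in> A" using im[OF g(1,2)] W by blast
    ultimately show ?thesis using g \<delta>(3) by (auto simp: translate_translate)
  qed
  have det_b: "det (g ** b) \<noteq> 0" if "det g \<noteq> 0" for g using that b by (simp add: det_mul)
  show ?thesis
  proof (intro exI conjI ballI)
    show "embedded_submanifold (grassmann_manifold k) d S"
      unfolding embedded_submanifold_def
    proof (intro conjI ballI)
      show "S \<subseteq> fst (grassmann_manifold k)" using S by (simp add: grassmann_manifold_def)
      fix W assume "W \<in> S"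
      from good[OF this] obtain g where g: "det g \<noteq> 0" "\<And>W'. W' \<in> S \<longleftrightarrow> translate W' g \<in> S"
        "W \<in> ?V (g ** b)" "local_slice (I \<times> - I) d A (?\<theta> (g ** b) W)" by blast
      show "\<exists>J U \<phi> K. (J, U, \<phi>) \<in> maximal_atlas (grassmann_manifold k) \<and> W \<in> U \<and> K \<subseteq> J \<and>
          card K = d \<and> \<phi> ` (U \<inter> S) = \<phi> ` U \<inter> coord_space K"
        by (rule slice_chart_at[OF is_manifold_grassmann atlas[OF det_b[OF g(1)]] g(3) im[OF g(1,2)] g(4)])
    qed
    fix a assume a: "a \<in> A"
    define W where "W = translate (graph_subspace I a) (matrix_inv b)"
    have tW: "translate W b = graph_subspace I a"
      by (simp add: W_def translate_translate matrix_inv_props[OF b])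
    have W: "W \<in> grassmannian k"
      unfolding W_def I[symmetric] by (rule translate_grassmannian[OF det_matrix_inv[OF b] graph_subspace_grassmannian])
    have \<theta>W: "?\<theta> b W = a" unfolding tW using a A(1) by (intro graph_coord_graph) auto
    have WV: "W \<in> ?V b" using W tW graph_subspace_Int by simp
    have "W \<in> S" using chart[OF W] WV \<theta>W a by auto
    from good[OF this] obtain g where g: "det g \<noteq> 0" "\<And>W'. W' \<in> S \<longleftrightarrow> translate W' g \<in> S"
      "W \<in> ?V (g ** b)" "local_slice (I \<times> - I) d A (?\<theta> (g ** b) W)" by blast
    have im_b: "?\<theta> b ` (?V b \<inter> S) = ?\<theta> b ` ?V b \<inter> A" using im[of "mat 1"] by simp
    have "local_slice (I \<times> - I) d A (?\<theta> b W)"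
      by (rule local_slice_change_chart[OF is_manifold_grassmann atlas[OF b] atlas[OF det_b[OF g(1)]] WV g(3)
            im_b im[OF g(1,2)] g(4)])
    then show "local_slice (I \<times> - I) d A a" unfolding \<theta>W .
  qed
qed

text \<open>The common form of the two halves of the theorem. After conjugation by \<open>b\<close> the map \<open>\<beta>\<close> measures
  the deviation of \<open>x\<close> from the diagonal idempotent \<open>origin\<close>, up to a sign \<open>s\<close>. The set \<open>E\<close> of
  idempotents is then an algebraic set of matrices supported in the block \<open>I \<times> - I\<close>, and \<open>sp\<close> (the range
  or the null space) sends \<open>x \<in> E\<close> to the subspace with chart coordinates \<open>\<beta> x\<close>. So \<open>E\<close> and the part of
  \<open>S\<close> in this chart are one and the same algebraic set, which is why the dimensions agree.\<close>

lemma family_submanifolds: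
  fixes M E :: "(complex^'n^'n) set" and b origin :: "complex^'n^'n" and S :: "(complex^'n) set set"
    and sp :: "complex^'n^'n \<Rightarrow> (complex^'n) set"
  assumes M: "algebraic_set M" and b: "det b \<noteq> 0" and s: "s * s = (1::complex)" and I: "card I = k"
  defines "\<beta> x \<equiv> flatten (\<chi> i j. s * (b ** x ** matrix_inv b - origin) $ i $ j)"
  assumes E: "E = {x \<in> M. \<beta> x \<in> coord_space (I \<times> - I)}" and "E \<noteq> {}"
    and sp: "\<And>x. x \<in> E \<Longrightarrow> translate (sp x) (matrix_inv b) = graph_subspace I (\<beta> x)" "sp ` E \<subseteq> S"
    and slice: "\<And>W. W \<in> S \<Longrightarrow> translate W (matrix_inv b) \<inter> coord_space (- I) = {0} \<Longrightarrow> \<exists>f\<in>E. W = sp f"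
    and move: "\<And>W p u. W \<in> S \<Longrightarrow> entry_polynomial p \<Longrightarrow> u \<in> E \<Longrightarrow> p u \<noteq> 0 \<Longrightarrow>
        \<exists>g. det g \<noteq> 0 \<and> (\<forall>W'. W' \<in> S \<longleftrightarrow> translate W' g \<in> S) \<and> (\<exists>f\<in>E. p f \<noteq> 0 \<and> translate W g = sp f)"
  shows "\<exists>d. embedded_submanifold matrix_manifold d E \<and> embedded_submanifold (grassmann_manifold k) d S"
proof -
  let ?b' = "matrix_inv b"
  note b' = det_matrix_inv[OF b]
  define \<gamma> where "\<gamma> a = ?b' ** ((\<chi> i j. s * a $ (i, j)) + origin) ** b" for a
  have \<gamma>\<beta>: "\<gamma> (\<beta> x) = x" for x
  proof -
    have "(\<chi> i j. s * \<beta> x $ (i, j)) + origin = b ** x ** ?b'"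
      using s by (simp add: \<beta>_def flatten_def vec_eq_iff mult.assoc[symmetric])
    then have "\<gamma> (\<beta> x) = (?b' ** b) ** x ** (?b' ** b)"
      unfolding \<gamma>_def by (simp add: matrix_mul_assoc)
    then show ?thesis by (simp add: matrix_inv_props[OF b])
  qed
  have \<beta>\<gamma>: "\<beta> (\<gamma> a) = a" for a
  proof -
    have "b ** \<gamma> a ** ?b' = (b ** ?b') ** ((\<chi> i j. s * a $ (i, j)) + origin) ** (b ** ?b')"
      unfolding \<gamma>_def by (simp add: matrix_mul_assoc)
    then show ?thesis
      using s by (simp add: \<beta>_def matrix_inv_props[OF b] flatten_def vec_eq_iff mult.assoc[symmetric])
  qed
  have poly_\<beta>: "entry_polynomial (\<lambda>x. \<beta> x $ p)" for p
    unfolding \<beta>_def flatten_def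
    by (simp, intro entry_polynomial.intros(2,4) entry_polynomial_diff entry_polynomial_matrix_mult)
       (auto intro: entry_polynomial.intros)
  have poly_\<gamma>: "poly_fun (\<lambda>a. \<gamma> a $ i $ j)" for i j
    unfolding \<gamma>_def
    by (intro poly_fun_matrix_mult) (auto intro!: poly_fun.intros)
  define A where "A = {a \<in> coord_space (I \<times> - I). \<gamma> a \<in> M}"
  obtain P0 where P0: "\<And>p. p \<in> P0 \<Longrightarrow> entry_polynomial p" "M = {x. \<forall>p\<in>P0. p x = 0}"
    using M unfolding algebraic_set_def by blast
  (* the equations of M in the coordinates \<beta>, and those of the coordinate subspace *)
  define P where "P = (\<lambda>p a. p (\<gamma> a)) ` P0 \<union> (\<lambda>q a. a $ q) ` (- (I \<times> - I))"
  have P: "poly_fun p" if "p \<in> P" for p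
    using that P0(1) poly_\<gamma> unfolding P_def by (auto intro: poly_fun_entry_polynomial_comp poly_fun.coord)
  have AP: "A = {a. \<forall>p\<in>P. p a = 0}"
    unfolding A_def P_def P0(2) coord_space_def by auto
  have EA: "x \<in> E \<longleftrightarrow> \<beta> x \<in> A" for x
    unfolding E A_def by (auto simp: \<gamma>\<beta>)
  have AE: "\<gamma> a \<in> E" if "a \<in> A" for a using that EA \<beta>\<gamma> by simp
  have "A \<noteq> {}" using \<open>E \<noteq> {}\<close> EA by auto
  have A_sub: "A \<subseteq> coord_space (I \<times> - I)" by (auto simp: A_def)
  have sp_coord: "graph_coord I (translate (sp x) ?b') = \<beta> x"
    "translate (sp x) ?b' \<inter> coord_space (- I) = {0}" if "x \<in> E" for x
    unfolding sp(1)[OF that] using that E by (auto simp: graph_coord_graph graph_subspace_Int)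
  have S: "S \<subseteq> grassmannian k"
  proof
    fix W assume W: "W \<in> S"
    obtain u where "u \<in> E" using \<open>E \<noteq> {}\<close> by blast
    (* with a constant polynomial, move only says that W is a translate of a graph *)
    from move[OF W entry_polynomial.const[of 1] this] obtain g f
      where g: "det g \<noteq> 0" "f \<in> E" "translate W g = sp f" by auto
    have "translate W (g ** ?b') = graph_subspace I (\<beta> f)"
      using sp(1)[OF g(2)] g(3) by (metis translate_translate)
    moreover have "det (g ** ?b') \<noteq> 0" using g(1) b' by (simp add: det_mul)
    ultimately have "translate (translate W (g ** ?b')) (matrix_inv (g ** ?b')) \<in> grassmannian k"
      using translate_grassmannian[OF det_matrix_inv graph_subspace_grassmannian[of I "\<beta> f"]] I by simp
    then show "W \<in> grassmannian k"
      using g(1) b' by (simp add: translate_translate matrix_inv_props det_mul)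
  qed
  have chart: "W \<in> S \<longleftrightarrow> graph_coord I (translate W ?b') \<in> A"
    if W: "W \<in> grassmannian k" "translate W ?b' \<inter> coord_space (- I) = {0}" for W
    proof
      assume "W \<in> S"
      from slice[OF this W(2)] obtain f where "f \<in> E" "W = sp f" by blast
      then show "graph_coord I (translate W ?b') \<in> A" using sp_coord EA by simp
    next
      assume a: "graph_coord I (translate W ?b') \<in> A" (is "?a \<in> A")
      have "translate (sp (\<gamma> ?a)) ?b' = graph_subspace I ?a"
        using sp(1)[OF AE[OF a]] by (simp add: \<beta>\<gamma>)
      also have "\<dots> = translate W ?b'"
        using graph_coord(2)[of "translate W ?b'" I] translate_grassmannian[OF b' W(1)] W(2) I by simp
      finally have "translate (translate (sp (\<gamma> ?a)) ?b') b = translate (translate W ?b') b" by simp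
      then have "sp (\<gamma> ?a) = W" by (simp add: translate_translate matrix_inv_props[OF b])
      then show "W \<in> S" using sp(2) AE[OF a] by blast
    qed
  have homog: "\<exists>g. det g \<noteq> 0 \<and> (\<forall>W'. W' \<in> S \<longleftrightarrow> translate W' g \<in> S) \<and>
          translate (translate W g) ?b' \<inter> coord_space (- I) = {0} \<and>
          \<delta> (graph_coord I (translate (translate W g) ?b')) \<noteq> 0"
    if W: "W \<in> S" and \<delta>: "poly_fun \<delta>" "\<exists>a\<in>A. \<delta> a \<noteq> 0" for W \<delta>
  proof -
    obtain a where a: "a \<in> A" "\<delta> a \<noteq> 0" using \<delta>(2) by blast
    have "entry_polynomial (\<lambda>x. \<delta> (\<beta> x))"
      by (rule entry_polynomial_poly_fun_comp[OF \<delta>(1) poly_\<beta>])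
    from move[OF W this AE[OF a(1)]] a(2) obtain g f where
      g: "det g \<noteq> 0" "\<forall>W'. W' \<in> S \<longleftrightarrow> translate W' g \<in> S" "f \<in> E" "\<delta> (\<beta> f) \<noteq> 0" "translate W g = sp f"
      by (auto simp: \<beta>\<gamma>)
    then show ?thesis
      using sp_coord[OF g(3)] by (intro exI[of _ g]) simp
  qed
  have "\<exists>d. embedded_submanifold (grassmann_manifold k) d S \<and> (\<forall>a\<in>A. local_slice (I \<times> - I) d A a)"
    by (rule homogeneous_family[OF S I b' A_sub P AP \<open>A \<noteq> {}\<close> chart homog])
  then obtain d where d: "embedded_submanifold (grassmann_manifold k) d S"
    "\<And>a. a \<in> A \<Longrightarrow> local_slice (I \<times> - I) d A a" by blast
  have "embedded_submanifold matrix_manifold d {x. \<beta> x \<in> A}"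
    by (rule matrix_submanifoldI[OF poly_\<beta> poly_\<gamma> \<gamma>\<beta> \<beta>\<gamma> A_sub d(2)])
  moreover have "{x. \<beta> x \<in> A} = E" using EA by auto
  ultimately show ?thesis using d(1) by auto
qed

section \<open>Green classes of idempotents\<close>

lemma green_L_iff:
  assumes M: "matrix_submonoid M"
  shows "(a, b) \<in> green_L M \<longleftrightarrow> a \<in> M \<and> b \<in> M \<and> (\<exists>x\<in>M. b = x ** a) \<and> (\<exists>x\<in>M. a = x ** b)"
proof -
  have "{x ** a | x. x \<in> M} \<subseteq> {x ** b | x. x \<in> M} \<longleftrightarrow> (\<exists>x\<in>M. a = x ** b)" for a b
  proof
    have "a \<in> {x ** a | x. x \<in> M}" using M by (auto simp: matrix_submonoid_def intro!: exI[of _ "mat 1"])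
    then show "\<exists>x\<in>M. a = x ** b" if "{x ** a | x. x \<in> M} \<subseteq> {x ** b | x. x \<in> M}" using that by blast
  qed (use M in \<open>auto simp: matrix_submonoid_def matrix_mul_assoc\<close>)
  from this[of a b] this[of b a] show ?thesis unfolding green_L_def by auto
qed

lemma green_R_iff:
  assumes M: "matrix_submonoid M"
  shows "(a, b) \<in> green_R M \<longleftrightarrow> a \<in> M \<and> b \<in> M \<and> (\<exists>x\<in>M. b = a ** x) \<and> (\<exists>x\<in>M. a = b ** x)"
proof -
  have "{a ** x | x. x \<in> M} \<subseteq> {b ** x | x. x \<in> M} \<longleftrightarrow> (\<exists>x\<in>M. a = b ** x)" for a b
  proof
    have "a \<in> {a ** x | x. x \<in> M}" using M by (auto simp: matrix_submonoid_def intro!: exI[of _ "mat 1"])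
    then show "\<exists>x\<in>M. a = b ** x" if "{a ** x | x. x \<in> M} \<subseteq> {b ** x | x. x \<in> M}" using that by blast
  qed (use M in \<open>auto simp: matrix_submonoid_def matrix_mul_assoc[symmetric]\<close>)
  from this[of a b] this[of b a] show ?thesis unfolding green_R_def by auto
qed

lemma equiv_fibres: "equiv M {(a, b). a \<in> M \<and> b \<in> M \<and> f a = f b}"
  by (auto simp: equiv_def refl_on_def sym_def trans_def)

lemma equiv_green: "equiv M (green_L M)" "equiv M (green_R M)"
  by (auto simp: equiv_def refl_on_def sym_def trans_def green_L_def green_R_def)

text \<open>Stated for both orders of the Green relations. Relating \<open>a\<close> and \<open>b\<close> whenever \<open>f\<close> takes the same
  values on their \<open>K\<close>-classes gives an equivalence relation that contains \<open>K\<close> trivially and \<open>K'\<close> by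
  the step condition; hence it contains the D-relation.\<close>

lemma image_D_class:
  assumes K: "{K, K'} = {green_L M, green_R M}" and e: "e \<in> M"
    and step: "\<And>a b y. (a, b) \<in> K' \<Longrightarrow> (a, y) \<in> K \<Longrightarrow> \<exists>y'. (b, y') \<in> K \<and> f y' = f y"
  shows "f ` D_class M e = f ` K `` {e}"
proof -
  have eqv: "equiv M K" "equiv M K'" using K equiv_green by (auto simp: doubleton_eq_iff)
  define r where "r = {(a, b). a \<in> M \<and> b \<in> M \<and> f ` K `` {a} = f ` K `` {b}}"
  have "K \<subseteq> r"
    using equiv_class_eq[OF eqv(1)] equiv_type[OF eqv(1)] by (fastforce simp: r_def)
  moreover have "K' \<subseteq> r"
  proof -
    have le: "f ` K `` {a} \<subseteq> f ` K `` {b}" if ab: "(a, b) \<in> K'" for a b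
    proof
      fix W assume "W \<in> f ` K `` {a}"
      then obtain y where y: "(a, y) \<in> K" "W = f y" by blast
      with step[OF ab y(1)] show "W \<in> f ` K `` {b}" by (metis Image_singleton_iff imageI)
    qed
    have "(a, b) \<in> r" if ab: "(a, b) \<in> K'" for a b
    proof -
      have ba: "(b, a) \<in> K'" using ab eqv(2) by (auto simp: equiv_def dest: symD)
      have "a \<in> M" "b \<in> M" using ab equiv_type[OF eqv(2)] by auto
      then show ?thesis using le[OF ab] le[OF ba] unfolding r_def by blast
    qed
    then show ?thesis by auto
  qed
  moreover have "equiv M r" unfolding r_def by (rule equiv_fibres)
  moreover have "green_L M \<union> green_R M = K \<union> K'" using K by (auto simp: doubleton_eq_iff)
  ultimately have D: "green_D M \<subseteq> r" "K \<subseteq> green_D M" unfolding green_D_def by blast+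
  show ?thesis
  proof
    show "f ` D_class M e \<subseteq> f ` K `` {e}"
    proof
      fix W assume "W \<in> f ` D_class M e"
      then obtain x where x: "(e, x) \<in> r" "W = f x" using D(1) by (auto simp: D_class_def)
      moreover have "x \<in> K `` {x}" using x(1) eqv(1) by (auto simp: r_def equiv_def refl_on_def)
      ultimately show "W \<in> f ` K `` {e}" by (auto simp: r_def)
    qed
    show "f ` K `` {e} \<subseteq> f ` D_class M e" using D(2) by (auto simp: D_class_def)
  qed
qed

text \<open>If \<open>b = a ** u\<close> and \<open>a = b ** v\<close>, right multiplication by \<open>u\<close> maps the L-class of \<open>a\<close> into that of
  \<open>b\<close>; on that class it is undone by \<open>v\<close>, so that it keeps null spaces.\<close>

lemma G_r_via_L_class:
  assumes M: "matrix_submonoid M" and e: "e \<in> M"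
  shows "G_r M e = null_space ` {y. (e, y) \<in> green_L M}"
proof -
  have "null_space ` D_class M e = null_space ` green_L M `` {e}"
  proof (rule image_D_class[OF refl e])
    fix a b y assume ab: "(a, b) \<in> green_R M" and y: "(a, y) \<in> green_L M"
    obtain u v where uv: "u \<in> M" "b = a ** u" "a = b ** v" "b \<in> M"
      using ab by (auto simp: green_R_iff[OF M])
    obtain s t where st: "s \<in> M" "t \<in> M" "y = s ** a" "a = t ** y" "y \<in> M"
      using y by (auto simp: green_L_iff[OF M])
    have "y ** u = s ** b" unfolding st(3) uv(2) by (simp add: matrix_mul_assoc)
    moreover have "b = t ** (y ** u)" unfolding matrix_mul_assoc st(4)[symmetric] by (rule uv(2))
    moreover have "y ** u \<in> M" using M st(5) uv(1) by (auto simp: matrix_submonoid_def)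
    ultimately have "(b, y ** u) \<in> green_L M"
      unfolding green_L_iff[OF M] using uv(4) st(1,2) by blast
    moreover have "null_space (y ** u) = null_space y"
    proof -
      have "y ** u ** v = s ** ((a ** u) ** v)" unfolding st(3) by (simp add: matrix_mul_assoc)
      also have "\<dots> = y" by (simp only: uv(2)[symmetric] uv(3)[symmetric] st(3)[symmetric])
      finally have "w v* (y ** u) = (w v* y) v* u" "w v* y = (w v* (y ** u)) v* v" for w
        by (simp_all add: vector_matrix_mul_assoc matrix_mul_assoc)
      then have "w v* (y ** u) = 0 \<longleftrightarrow> w v* y = 0" for w by (metis vector_matrix_mult_0)
      then show ?thesis by (simp add: null_space_def)
    qed
    ultimately show "\<exists>y'. (b, y') \<in> green_L M \<and> null_space y' = null_space y" by blast
  qed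
  then show ?thesis by (simp add: G_r_def Image_singleton Setcompr_eq_image)
qed

text \<open>The mirror image of \<open>G_r_via_L_class\<close>, with left multiplication and ranges.\<close>

lemma G_l_via_R_class:
  assumes M: "matrix_submonoid M" and e: "e \<in> M"
  shows "G_l M e = range_space ` {y. (e, y) \<in> green_R M}"
proof -
  have "range_space ` D_class M e = range_space ` green_R M `` {e}"
  proof (rule image_D_class[OF insert_commute e])
    fix a b y assume ab: "(a, b) \<in> green_L M" and y: "(a, y) \<in> green_R M"
    obtain u v where uv: "u \<in> M" "b = u ** a" "a = v ** b" "b \<in> M"
      using ab by (auto simp: green_L_iff[OF M])
    obtain s t where st: "s \<in> M" "t \<in> M" "y = a ** s" "a = y ** t" "y \<in> M"
      using y by (auto simp: green_R_iff[OF M])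
    have "u ** y = b ** s" unfolding st(3) uv(2) by (simp add: matrix_mul_assoc)
    moreover have "b = (u ** y) ** t" unfolding matrix_mul_assoc[symmetric] st(4)[symmetric] by (rule uv(2))
    moreover have "u ** y \<in> M" using M st(5) uv(1) by (auto simp: matrix_submonoid_def)
    ultimately have "(b, u ** y) \<in> green_R M"
      unfolding green_R_iff[OF M] using uv(4) st(1,2) by blast
    moreover have "range_space (u ** y) = range_space y"
    proof -
      have "v ** (u ** y) = (v ** (u ** a)) ** s" unfolding st(3) by (simp add: matrix_mul_assoc)
      also have "\<dots> = y" by (simp only: uv(2)[symmetric] uv(3)[symmetric] st(3)[symmetric])
      finally have "w v* (u ** y) = (w v* u) v* y" "w v* y = (w v* v) v* (u ** y)" for w
        by (simp_all add: vector_matrix_mul_assoc)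
      then show ?thesis unfolding range_space_def by blast
    qed
    ultimately show "\<exists>y'. (b, y') \<in> green_R M \<and> range_space y' = range_space y" by blast
  qed
  then show ?thesis by (simp add: G_l_def Image_singleton Setcompr_eq_image)
qed

lemma L_class_idempotent:
  assumes M: "matrix_submonoid M" and e: "e \<in> M" "e ** e = e"
  shows "(e, y) \<in> green_L M \<longleftrightarrow> y \<in> M \<and> y ** e = y \<and> (\<exists>z\<in>M. z ** y = e)"
  unfolding green_L_iff[OF M] using e by (metis matrix_mul_assoc)

lemma R_class_idempotent:
  assumes M: "matrix_submonoid M" and e: "e \<in> M" "e ** e = e"
  shows "(e, y) \<in> green_R M \<longleftrightarrow> y \<in> M \<and> e ** y = y \<and> (\<exists>z\<in>M. y ** z = e)"
  unfolding green_R_iff[OF M] using e by (metis matrix_mul_assoc)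

lemma idempotents_L_class:
  assumes M: "matrix_submonoid M" and e: "e \<in> M" "e ** e = e"
  shows "idempotents (L_class M e) = {f \<in> M. f ** e = f \<and> e ** f = e}"
proof (intro equalityI subsetI)
  fix f assume "f \<in> idempotents (L_class M e)"
  then have "f ** f = f" "(e, f) \<in> green_L M" by (auto simp: idempotents_def L_class_def)
  then show "f \<in> {f \<in> M. f ** e = f \<and> e ** f = e}"
    unfolding L_class_idempotent[OF assms] by (auto simp: matrix_mul_assoc[symmetric])
next
  fix f assume f: "f \<in> {f \<in> M. f ** e = f \<and> e ** f = e}"
  then have "f ** f = f" by (metis (mono_tags, lifting) matrix_mul_assoc mem_Collect_eq)
  then show "f \<in> idempotents (L_class M e)"
    using f e by (auto simp: idempotents_def L_class_def L_class_idempotent[OF assms])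
qed

lemma idempotents_R_class:
  assumes M: "matrix_submonoid M" and e: "e \<in> M" "e ** e = e"
  shows "idempotents (R_class M e) = {f \<in> M. e ** f = f \<and> f ** e = e}"
proof (intro equalityI subsetI)
  fix f assume "f \<in> idempotents (R_class M e)"
  then have "f ** f = f" "(e, f) \<in> green_R M" by (auto simp: idempotents_def R_class_def)
  then show "f \<in> {f \<in> M. e ** f = f \<and> f ** e = e}"
    unfolding R_class_idempotent[OF assms] by (auto simp: matrix_mul_assoc)
next
  fix f assume f: "f \<in> {f \<in> M. e ** f = f \<and> f ** e = e}"
  then have "f ** f = f" by (metis (mono_tags, lifting) matrix_mul_assoc mem_Collect_eq)
  then show "f \<in> idempotents (R_class M e)"
    using f e by (auto simp: idempotents_def R_class_def R_class_idempotent[OF assms])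
qed

section \<open>Units of the monoid\<close>

text \<open>Zariski density of the units, in the form of the existence of units in general position.\<close>

definition units_dense :: "(complex^'n^'n) set \<Rightarrow> bool" where
  "units_dense M \<longleftrightarrow>
     (\<forall>p. entry_polynomial p \<longrightarrow> (\<exists>x\<in>M. p x \<noteq> 0) \<longrightarrow> (\<exists>x\<in>M. det x \<noteq> 0 \<and> p x \<noteq> 0))"

text \<open>Otherwise \<open>M\<close> would be the union of the zero sets of the determinant and of \<open>p\<close>.\<close>

lemma irreducible_units_dense:
  assumes M: "algebraic_set M" "irreducible_set M" "mat 1 \<in> M"
  shows "units_dense M"
  unfolding units_dense_def
proof (intro allI impI, rule ccontr)
  fix p assume p: "entry_polynomial p" "\<exists>x\<in>M. p x \<noteq> 0" and none: "\<not> (\<exists>x\<in>M. det x \<noteq> 0 \<and> p x \<noteq> 0)"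
  have alg: "algebraic_set {x \<in> M. q x = 0}" if "entry_polynomial q" for q
  proof -
    obtain P where P: "\<forall>p\<in>P. entry_polynomial p" "M = {x. \<forall>p\<in>P. p x = 0}"
      using M(1) unfolding algebraic_set_def by blast
    then show ?thesis unfolding algebraic_set_def by (intro exI[of _ "insert q P"]) (use that in auto)
  qed
  have "entry_polynomial (det :: complex^'n^'n \<Rightarrow> complex)"
    by (rule entry_polynomial_det) (rule entry_polynomial.entry)
  from alg[OF this] alg[OF p(1)] have "algebraic_set {x \<in> M. det x = 0}" "algebraic_set {x \<in> M. p x = 0}" .
  moreover have "{x \<in> M. det x = 0} \<subset> M" using M(3) det_I by (metis (mono_tags, lifting) mem_Collect_eq psubsetI subsetI zero_neq_one)
  moreover have "{x \<in> M. p x = 0} \<subset> M" using p(2) by blast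
  moreover have "M = {x \<in> M. det x = 0} \<union> {x \<in> M. p x = 0}" using none by blast
  ultimately show False using M(2) unfolding irreducible_set_def by blast
qed

lemma regular_unit_inverse:
  assumes "regular_monoid M" "g \<in> M" "det g \<noteq> 0"
  shows "matrix_inv g \<in> M"
proof -
  obtain x where x: "x \<in> M" "g ** x ** g = g" using assms by (auto simp: regular_monoid_def)
  have "matrix_inv g ** (g ** x ** g) ** matrix_inv g = matrix_inv g ** g ** matrix_inv g" using x by simp
  moreover have "matrix_inv g ** (g ** x ** g) ** matrix_inv g = (matrix_inv g ** g) ** x ** (g ** matrix_inv g)"
    by (simp only: matrix_mul_assoc)
  ultimately show ?thesis using x by (simp add: matrix_inv_props[OF assms(3)])
qed

text \<open>An element \<open>y\<close> with \<open>y ** e = y\<close> whose null space is complementary to the range of \<open>e\<close> has the null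
  space of an idempotent \<open>f\<close> that is L-related to \<open>e\<close>. On the range of \<open>e\<close> the matrix \<open>e ** y\<close> is
  invertible, and \<open>X\<close> extends it by the identity. The inverse of \<open>X\<close> need not belong to \<open>M\<close>, but its
  corner \<open>matrix_inv X ** e\<close> equals \<open>e ** w ** e\<close> for every \<open>w \<in> M\<close> with
  \<open>(e ** y) ** w ** (e ** y) = e ** y\<close>, and regularity provides such a \<open>w\<close>.\<close>

lemma idempotent_slice:
  fixes M :: "(complex^'n^'n) set"
  assumes M: "matrix_submonoid M" "regular_monoid M" and e: "e \<in> M" "e ** e = e"
    and y: "y \<in> M" "y ** e = y"
  defines "X \<equiv> e ** y + mat 1 - e"
  assumes X: "det X \<noteq> 0"
  defines "f \<equiv> y ** matrix_inv X ** e"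
  shows "f \<in> M" "f ** e = f" "e ** f = e" "f ** X = y"
proof -
  have mult: "\<And>x y. x \<in> M \<Longrightarrow> y \<in> M \<Longrightarrow> x ** y \<in> M" using M by (auto simp: matrix_submonoid_def)
  define Z where "Z = matrix_inv X"
  note XZ = matrix_inv_props[OF X, folded Z_def]
  have eX: "e ** X = e ** y"
    by (rule matrix_eq_rowI)
       (simp add: X_def vector_matrix_mul_assoc[symmetric] vector_matrix_mult_diff_rdistrib
          vector_matrix_mult_add_rdistrib, simp add: vector_matrix_mul_assoc e matrix_mul_assoc)
  have Xe: "X ** e = e ** y"
  proof (rule matrix_eq_rowI)
    fix v
    have "v v* (X ** e) = (v v* X) v* e" by (simp add: vector_matrix_mul_assoc)
    also have "v v* X = v v* (e ** y) + v - v v* e"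
      by (simp add: X_def vector_matrix_mult_diff_rdistrib vector_matrix_mult_add_rdistrib)
    also have "(v v* (e ** y) + v - v v* e) v* e = v v* (e ** (y ** e)) + v v* e - v v* (e ** e)"
      by (simp only: vector_matrix_left_distrib vector_matrix_mult_diff_distrib vector_matrix_mul_assoc matrix_mul_assoc)
    finally show "v v* (X ** e) = v v* (e ** y)" by (simp add: y e)
  qed
  have Ze: "Z ** e = e ** Z"
  proof -
    have "Z ** (X ** e) ** Z = Z ** (e ** X) ** Z" using eX Xe by simp
    then have "(Z ** X) ** e ** Z = Z ** e ** (X ** Z)" by (simp add: matrix_mul_assoc)
    then show ?thesis by (simp add: XZ)
  qed
  have f_eq: "f = y ** Z ** e" by (simp add: f_def Z_def)
  show fX: "f ** X = y"
  proof -
    have "f ** X = y ** Z ** (X ** e)" unfolding f_eq using eX Xe by (simp add: matrix_mul_assoc[symmetric])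
    also have "\<dots> = y ** (Z ** X) ** e" by (simp only: matrix_mul_assoc)
    finally show ?thesis using y by (simp add: XZ)
  qed
  show "f ** e = f" unfolding f_eq by (simp add: matrix_mul_assoc[symmetric] e)
  show "e ** f = e"
  proof -
    have "e ** f = (e ** y) ** Z ** e" unfolding f_eq by (simp only: matrix_mul_assoc)
    also have "\<dots> = e ** (X ** Z) ** e" unfolding eX[symmetric] by (simp only: matrix_mul_assoc)
    finally show ?thesis by (simp add: XZ e)
  qed
  show "f \<in> M"
  proof -
    obtain w where w: "w \<in> M" "(e ** y) ** w ** (e ** y) = e ** y"
      using M(2) mult[OF e(1) y(1)] by (auto simp: regular_monoid_def)
    have "e ** w ** e ** X = e ** (Z ** X) ** w ** (e ** X)"
      by (simp add: XZ matrix_mul_assoc)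
    also have "\<dots> = Z ** ((e ** X) ** w ** (e ** X))"
      using Ze by (simp add: matrix_mul_assoc)
    also have "\<dots> = Z ** (X ** e)" unfolding eX w(2) Xe ..
    also have "\<dots> = e" by (simp add: matrix_mul_assoc XZ)
    finally have "e ** w ** e ** (X ** Z) = e ** Z" by (simp add: matrix_mul_assoc)
    then have "e ** w ** e = Z ** e" by (simp add: XZ Ze)
    then have "f = y ** (e ** w ** e)" unfolding f_eq by (simp add: matrix_mul_assoc)
    then show ?thesis using mult w(1) e(1) y(1) by simp
  qed
qed

text \<open>A unit moves any element \<open>y\<close> of the L-class of \<open>e\<close> to one with the null space of an idempotent in
  general position. The condition on \<open>g\<close> is that a certain polynomial does not vanish at \<open>g\<close>; it holds
  at \<open>u ** z\<close>, which lies in \<open>M\<close> and sends \<open>y\<close> to \<open>u\<close>, and therefore it holds at some unit.\<close>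

lemma generic_unit_left:
  fixes M :: "(complex^'n^'n) set"
  assumes M: "matrix_submonoid M" "regular_monoid M" "units_dense M" and e: "e \<in> M" "e ** e = e"
    and y: "y \<in> M" "y ** e = y" "z \<in> M" "z ** y = e"
    and u: "u \<in> M" "u ** e = u" "e ** u = e" and p: "entry_polynomial p" "p u \<noteq> 0"
  shows "\<exists>g\<in>M. det g \<noteq> 0 \<and> (\<exists>f\<in>M. f ** e = f \<and> e ** f = e \<and> p f \<noteq> 0 \<and>
           (\<exists>h. g ** y = f ** h) \<and> (\<exists>h. f = g ** y ** h))"
proof -
  have mult: "\<And>x y. x \<in> M \<Longrightarrow> y \<in> M \<Longrightarrow> x ** y \<in> M" using M by (auto simp: matrix_submonoid_def)
  define X where "X g = e ** (g ** y) + mat 1 - e" for g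
  define N where "N g = g ** y ** (\<chi> i j. adjugate_entry (X g) i j) ** e" for g
  have gy: "entry_polynomial (\<lambda>g. (g ** y) $ i $ j)" for i j
    by (intro entry_polynomial_matrix_mult entry_polynomial.entry entry_polynomial.const)
  have pX: "entry_polynomial (\<lambda>g. X g $ i $ j)" for i j
    unfolding X_def
    by (simp, intro entry_polynomial_diff entry_polynomial.add entry_polynomial_matrix_mult gy entry_polynomial.const)
  have pN: "entry_polynomial (\<lambda>g. N g $ i $ j)" for i j
    unfolding N_def
    by (intro entry_polynomial_matrix_mult entry_polynomial.const entry_polynomial.entry)
       (simp add: entry_polynomial_adjugate_entry[OF pX])
  have pd: "entry_polynomial (\<lambda>g. det (X g))" by (rule entry_polynomial_det[OF pX])
  obtain Q m where Q: "entry_polynomial Q"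
    "\<And>g. det (X g) \<noteq> 0 \<Longrightarrow> Q g = det (X g) ^ m * p (\<chi> i j. N g $ i $ j / det (X g))"
    using clear_denominators[OF p(1) pN pd] by blast
  have N: "(\<chi> i j. N g $ i $ j / det (X g)) = g ** y ** matrix_inv (X g) ** e" if "det (X g) \<noteq> 0" for g
    using that
    by (simp add: N_def vec_eq_iff matrix_matrix_mult_def matrix_inv_entry sum_divide_distrib sum_distrib_right)
  (* the point of M, in general not a unit, where the generic condition visibly holds *)
  define g0 where "g0 = u ** z"
  have g0y: "g0 ** y = u" unfolding g0_def using y(4) u(2) by (simp add: matrix_mul_assoc[symmetric])
  have X0: "X g0 = mat 1" unfolding X_def g0y u(3) by simp
  have "matrix_inv (mat 1 :: complex^'n^'n) = mat 1"
    using matrix_inv_props(1)[of "mat 1 :: complex^'n^'n"] by simp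
  then have "Q g0 = p u" using Q(2)[of g0] N[of g0] by (simp add: X0 g0y u(2))
  then have "Q g0 * det (X g0) \<noteq> 0" using p(2) X0 by simp
  moreover have "g0 \<in> M" unfolding g0_def using mult u(1) y(3) by blast
  ultimately obtain g where g: "g \<in> M" "det g \<noteq> 0" "Q g * det (X g) \<noteq> 0"
    using M(3) entry_polynomial.mult[OF Q(1) pd] unfolding units_dense_def by blast
  then have dX: "det (X g) \<noteq> 0" and Qg: "Q g \<noteq> 0" by auto
  have "g ** y \<in> M" "g ** y ** e = g ** y"
    using g mult y by (auto simp: matrix_mul_assoc[symmetric])
  note f = idempotent_slice[OF M(1,2) e this dX[unfolded X_def], folded X_def]
  have "p (g ** y ** matrix_inv (X g) ** e) \<noteq> 0" using Qg Q(2)[OF dX] N[OF dX] by auto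
  with f g show ?thesis
    by (intro bexI[of _ g] conjI bexI[of _ "g ** y ** matrix_inv (X g) ** e"])
       (auto simp: matrix_mul_assoc[symmetric] intro: sym)
qed

section \<open>Passing to the transposed monoid\<close>

lemma idempotent_slice_left:
  fixes M :: "(complex^'n^'n) set"
  assumes "matrix_submonoid M" "regular_monoid M" and "e \<in> M" "e ** e = e"
    and "y \<in> M" "y ** e = y" and "det (e ** y + mat 1 - e) \<noteq> 0"
  shows "\<exists>f\<in>M. f ** e = f \<and> e ** f = e \<and> (\<exists>h. y = f ** h) \<and> (\<exists>h. f = y ** h)"
  using idempotent_slice[OF assms] by (metis matrix_mul_assoc)

lemma transpose_monoid:
  fixes M :: "(complex^'n^'n) set"
  shows "matrix_submonoid M \<Longrightarrow> matrix_submonoid (transpose ` M)"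
    "regular_monoid M \<Longrightarrow> regular_monoid (transpose ` M)"
    "units_dense M \<Longrightarrow> units_dense (transpose ` M)"
proof -
  show "matrix_submonoid (transpose ` M)" if "matrix_submonoid M"
  proof -
    have "mat 1 = transpose (mat 1 :: complex^'n^'n)" by (simp add: transpose_mat)
    then have "mat 1 \<in> transpose ` M" using that unfolding matrix_submonoid_def by blast
    then show ?thesis using that
      by (auto simp: matrix_submonoid_def matrix_transpose_mul[symmetric])
  qed
  show "regular_monoid (transpose ` M)" if reg: "regular_monoid M"
    unfolding regular_monoid_def
  proof
    fix a assume "a \<in> transpose ` M"
    then obtain c where c: "c \<in> M" "a = transpose c" by blast
    obtain x where x: "x \<in> M" "c ** x ** c = c" using reg c(1) unfolding regular_monoid_def by blast
    have "a ** transpose x ** a = transpose (c ** x ** c)"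
      by (simp add: c matrix_transpose_mul matrix_mul_assoc)
    then show "\<exists>x\<in>transpose ` M. a ** x ** a = a" using x c(2) by (intro bexI[of _ "transpose x"]) auto
  qed
  show "units_dense (transpose ` M)" if "units_dense M"
    unfolding units_dense_def
  proof (intro allI impI)
    fix p :: "complex^'n^'n \<Rightarrow> complex" assume p: "entry_polynomial p" "\<exists>x\<in>transpose ` M. p x \<noteq> 0"
    have "entry_polynomial (\<lambda>x. p (transpose x))"
      unfolding entry_polynomial_iff
      by (rule poly_fun_entry_polynomial_comp[OF p(1)]) (simp add: transpose_def unflatten_def poly_fun.coord)
    then show "\<exists>x\<in>transpose ` M. det x \<noteq> 0 \<and> p x \<noteq> 0"
      using that p(2) unfolding units_dense_def by (auto simp: det_transpose)
  qed
qed

lemma transpose_mult_eq: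
  fixes a :: "complex^'n^'n"
  shows "a ** b = c \<Longrightarrow> transpose b ** transpose a = transpose c"
  by (simp add: matrix_transpose_mul[symmetric])

lemma transpose_eq_iff: "transpose a = transpose b \<longleftrightarrow> a = b"
  by (metis transpose_transpose)

lemma idempotent_slice_right:
  fixes M :: "(complex^'n^'n) set"
  assumes M: "matrix_submonoid M" "regular_monoid M" and e: "e \<in> M" "e ** e = e"
    and y: "y \<in> M" "e ** y = y" and X: "det (y ** e + mat 1 - e) \<noteq> 0"
  shows "\<exists>f\<in>M. e ** f = f \<and> f ** e = e \<and> (\<exists>h. y = h ** f) \<and> (\<exists>h. f = h ** y)"
proof -
  have "transpose e ** transpose y + mat 1 - transpose e = transpose (y ** e + mat 1 - e)"
    by (simp add: matrix_transpose_mul[symmetric]) (simp add: transpose_def mat_def vec_eq_iff)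
  then have det: "det (transpose e ** transpose y + mat 1 - transpose e) \<noteq> 0"
    using X by (simp add: det_transpose)
  have "\<exists>f\<in>transpose ` M. f ** transpose e = f \<and> transpose e ** f = transpose e \<and>
      (\<exists>h. transpose y = f ** h) \<and> (\<exists>h. f = transpose y ** h)"
    by (rule idempotent_slice_left[OF transpose_monoid(1)[OF M(1)] transpose_monoid(2)[OF M(2)]
          imageI[OF e(1)] transpose_mult_eq[OF e(2)] imageI[OF y(1)] transpose_mult_eq[OF y(2)] det])
  then obtain f h k where f: "f \<in> M" "transpose f ** transpose e = transpose f"
    "transpose e ** transpose f = transpose e" "transpose y = transpose f ** h" "transpose f = transpose y ** k"
    by blast
  have "e ** f = f" "f ** e = e" using f(2,3) by (simp_all add: matrix_transpose_mul[symmetric] transpose_eq_iff)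
  moreover have "y = transpose h ** f" using arg_cong[OF f(4), of transpose] by (simp add: matrix_transpose_mul)
  moreover have "f = transpose k ** y" using arg_cong[OF f(5), of transpose] by (simp add: matrix_transpose_mul)
  ultimately show ?thesis using f(1) by blast
qed

lemma generic_unit_right:
  fixes M :: "(complex^'n^'n) set"
  assumes M: "matrix_submonoid M" "regular_monoid M" "units_dense M" and e: "e \<in> M" "e ** e = e"
    and y: "y \<in> M" "e ** y = y" "z \<in> M" "y ** z = e"
    and u: "u \<in> M" "e ** u = u" "u ** e = e" and p: "entry_polynomial p" "p u \<noteq> 0"
  shows "\<exists>g\<in>M. det g \<noteq> 0 \<and> (\<exists>f\<in>M. e ** f = f \<and> f ** e = e \<and> p f \<noteq> 0 \<and>
           (\<exists>h. y ** g = h ** f) \<and> (\<exists>h. f = h ** (y ** g)))"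
proof -
  have pt: "entry_polynomial (\<lambda>x. p (transpose x))"
    unfolding entry_polynomial_iff
    by (rule poly_fun_entry_polynomial_comp[OF p(1)]) (simp add: transpose_def unflatten_def poly_fun.coord)
  have "\<exists>g\<in>transpose ` M. det g \<noteq> 0 \<and> (\<exists>f\<in>transpose ` M. f ** transpose e = f \<and> transpose e ** f = transpose e \<and>
           p (transpose f) \<noteq> 0 \<and> (\<exists>h. g ** transpose y = f ** h) \<and> (\<exists>h. f = g ** transpose y ** h))"
    by (rule generic_unit_left[OF transpose_monoid(1)[OF M(1)] transpose_monoid(2)[OF M(2)]
          transpose_monoid(3)[OF M(3)] imageI[OF e(1)] transpose_mult_eq[OF e(2)]
          imageI[OF y(1)] transpose_mult_eq[OF y(2)] imageI[OF y(3)] transpose_mult_eq[OF y(4)]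
          imageI[OF u(1)] transpose_mult_eq[OF u(2)] transpose_mult_eq[OF u(3)] pt])
       (use p(2) in simp)
  then obtain gt ft h k where gt: "gt \<in> transpose ` M" "det gt \<noteq> 0" "ft \<in> transpose ` M"
    and *: "ft ** transpose e = ft" "transpose e ** ft = transpose e" "p (transpose ft) \<noteq> 0"
      "gt ** transpose y = ft ** h" "ft = gt ** transpose y ** k" by blast
  obtain g f where gf: "g \<in> M" "gt = transpose g" "f \<in> M" "ft = transpose f" using gt by blast
  have g: "g \<in> M" "det g \<noteq> 0" using gf(1,2) gt(2) by (simp_all add: det_transpose)
  note f = gf(3) *[unfolded gf(2,4) transpose_transpose]
  have "e ** f = f" "f ** e = e" using f(2,3) by (simp_all add: matrix_transpose_mul[symmetric] transpose_eq_iff)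
  moreover have "y ** g = transpose h ** f"
    using arg_cong[OF f(5), of transpose] by (simp add: matrix_transpose_mul)
  moreover have "f = transpose k ** (y ** g)"
    using arg_cong[OF f(6), of transpose] by (simp add: matrix_transpose_mul)
  ultimately show ?thesis using f(1,4) g by blast
qed

section \<open>The two families attached to an idempotent\<close>

lemma null_space_eqI: "y = f ** h \<Longrightarrow> f = y ** k \<Longrightarrow> null_space y = null_space f"
  unfolding null_space_def by (metis vector_matrix_mul_assoc vector_matrix_mult_0)

lemma range_space_eqI:
  assumes "y = h ** f" "f = k ** y"
  shows "range_space y = range_space f"
proof -
  have "v v* y = (v v* h) v* f" "v v* f = (v v* k) v* y" for v
    using assms by (simp_all add: vector_matrix_mul_assoc)
  then show ?thesis unfolding range_space_def by blast
qed

text \<open>Left multiplication by a unit translates null spaces by its inverse, since matrices act on the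
  right of row vectors.\<close>

lemma translate_null_space:
  fixes g y :: "complex^'n^'n"
  assumes "det g \<noteq> 0"
  shows "translate (null_space y) (matrix_inv g) = null_space (g ** y)"
proof (intro equalityI subsetI)
  fix w assume "w \<in> translate (null_space y) (matrix_inv g)"
  then obtain v where v: "v v* y = 0" "w = v v* matrix_inv g" by (auto simp: translate_def null_space_def)
  have "w v* (g ** y) = v v* (matrix_inv g ** g ** y)"
    unfolding v(2) by (simp add: vector_matrix_mul_assoc matrix_mul_assoc)
  then show "w \<in> null_space (g ** y)" using v(1) by (simp add: null_space_def matrix_inv_props[OF assms])
next
  fix w assume "w \<in> null_space (g ** y)"
  then have "w v* g \<in> null_space y" by (simp add: null_space_def vector_matrix_mul_assoc)
  moreover have "w = (w v* g) v* matrix_inv g" by (simp add: vector_matrix_mul_assoc matrix_inv_props[OF assms])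
  ultimately show "w \<in> translate (null_space y) (matrix_inv g)" unfolding translate_def by blast
qed

lemma translate_range_space: "translate (range_space y) g = range_space (y ** g)"
proof -
  have R: "range_space z = range (\<lambda>v. v v* z)" for z :: "complex^'n^'n" by (auto simp: range_space_def)
  show ?thesis
    unfolding translate_def R[of y] R[of "y ** g"] image_image vector_matrix_mul_assoc by (rule refl)
qed

lemma range_space_mult_left:
  fixes y :: "complex^'n^'n"
  assumes "det b \<noteq> 0"
  shows "range_space (b ** y) = range_space y"
  by (rule range_space_eqI[where k = "matrix_inv b" and h = b])
     (simp_all add: matrix_mul_assoc matrix_inv_props[OF assms])

lemma conjugation:
  fixes b :: "complex^'n^'n"
  assumes "det b \<noteq> 0"
  defines "c x \<equiv> b ** x ** matrix_inv b"
  shows "c (x ** y) = c x ** c y" "c x = c y \<longleftrightarrow> x = y"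
proof -
  note b = matrix_inv_props[OF assms(1)]
  have "c x ** c y = b ** x ** (matrix_inv b ** b) ** y ** matrix_inv b"
    unfolding c_def by (simp only: matrix_mul_assoc)
  then show "c (x ** y) = c x ** c y" unfolding c_def by (simp add: b matrix_mul_assoc)
  have "matrix_inv b ** c x ** b = x" for x
  proof -
    have "matrix_inv b ** c x ** b = (matrix_inv b ** b) ** x ** (matrix_inv b ** b)"
      unfolding c_def by (simp only: matrix_mul_assoc)
    then show ?thesis by (simp add: b)
  qed
  then show "c x = c y \<longleftrightarrow> x = y" by metis
qed

text \<open>In a basis where \<open>e\<close> is the projection to the coordinates \<open>J\<close>, the idempotents that are L-related to
  \<open>e\<close> are the elements of \<open>M\<close> that differ from it only in the block \<open>(- J) \<times> J\<close>, and the null space of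
  such an \<open>x\<close> is the graph of the negative of that block.\<close>

lemma L_family:
  fixes M :: "(complex^'n^'n) set"
  assumes M: "matrix_submonoid M" "algebraic_set M" "regular_monoid M" "units_dense M"
    and e: "e \<in> M" "e ** e = e"
  shows "\<exists>d. embedded_submanifold matrix_manifold d (idempotents (L_class M e)) \<and>
    embedded_submanifold (grassmann_manifold (CARD('n) - rank e)) d (G_r M e)"
proof -
  have mult: "\<And>x y. x \<in> M \<Longrightarrow> y \<in> M \<Longrightarrow> x ** y \<in> M" using M by (auto simp: matrix_submonoid_def)
  obtain b J where b: "det b \<noteq> 0" "card J = rank e" "b ** e ** matrix_inv b = diag_mat J"
    and eb': "e ** matrix_inv b = matrix_inv b ** diag_mat J"
    using idempotent_diagonalizable[OF e(2)] by blast
  let ?b' = "matrix_inv b"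
  define c where "c x = b ** x ** ?b'" for x
  note conj = conjugation[OF b(1), folded c_def] and ce = b(3)[folded c_def]
  let ?\<beta> = "\<lambda>x. flatten (\<chi> i j. (-1) * (b ** x ** ?b' - diag_mat J) $ i $ j)"
  have E: "idempotents (L_class M e) = {x \<in> M. ?\<beta> x \<in> coord_space ((- J) \<times> - (- J))}"
  proof -
    have "x ** e = x \<and> e ** x = e \<longleftrightarrow> ?\<beta> x \<in> coord_space ((- J) \<times> - (- J))" for x
    proof -
      have "x ** e = x \<and> e ** x = e \<longleftrightarrow> c x ** diag_mat J = c x \<and> diag_mat J ** c x = diag_mat J"
        unfolding ce[symmetric] conj(1)[symmetric] conj(2) ..
      also have "\<dots> \<longleftrightarrow> (\<forall>i j. i \<in> J \<or> j \<notin> J \<longrightarrow> c x $ i $ j = diag_mat J $ i $ j)"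
        unfolding vec_eq_iff mult_diag_mat diag_mat_mult
        by (auto simp: diag_mat_def split: if_splits)
      also have "\<dots> \<longleftrightarrow> ?\<beta> x \<in> coord_space ((- J) \<times> - (- J))"
        unfolding c_def[symmetric] by (auto simp: coord_space_def flatten_def)
      finally show ?thesis .
    qed
    then show ?thesis unfolding idempotents_L_class[OF M(1) e] by auto
  qed
  have x0: "graph_matrix (- J) (?\<beta> x) = mat 1 - c x" if "x \<in> idempotents (L_class M e)" for x
  proof -
    have eq: "c x $ i $ j = diag_mat J $ i $ j" if "i \<in> J \<or> j \<notin> J" for i j
      using \<open>x \<in> _\<close> that unfolding E c_def[symmetric] by (auto simp: coord_space_def flatten_def)
    have "graph_matrix (- J) (?\<beta> x) $ i $ j = (mat 1 - c x) $ i $ j" for i j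
      unfolding c_def[symmetric]
      by (cases "i \<in> J \<or> j \<notin> J") (auto simp: eq flatten_def graph_matrix_def mat_def diag_mat_def)
    then show ?thesis by (simp add: vec_eq_iff)
  qed
  have L: "(e, y) \<in> green_L M \<longleftrightarrow> y \<in> M \<and> y ** e = y \<and> (\<exists>z\<in>M. z ** y = e)" for y
    by (rule L_class_idempotent[OF M(1) e])
  have S: "G_r M e = null_space ` {y. (e, y) \<in> green_L M}" by (rule G_r_via_L_class[OF M(1) e(1)])
  have idem: "f \<in> idempotents (L_class M e) \<longleftrightarrow> f \<in> M \<and> f ** e = f \<and> e ** f = e" for f
    unfolding idempotents_L_class[OF M(1) e] by blast
  have unit: "translate W (matrix_inv g) \<in> G_r M e" if g: "g \<in> M" "det g \<noteq> 0" and W: "W \<in> G_r M e" for g W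
  proof -
    obtain y where y: "(e, y) \<in> green_L M" "W = null_space y" using W unfolding S by blast
    obtain z where z: "y \<in> M" "y ** e = y" "z \<in> M" "z ** y = e" using y(1) unfolding L by blast
    have "(z ** matrix_inv g) ** (g ** y) = z ** (matrix_inv g ** g) ** y" by (simp only: matrix_mul_assoc)
    then have "(z ** matrix_inv g) ** (g ** y) = e" by (simp add: matrix_inv_props[OF g(2)] z)
    moreover have "z ** matrix_inv g \<in> M" using mult z(3) regular_unit_inverse[OF M(3) g] by blast
    moreover have "g ** y ** e = g ** y" by (simp add: matrix_mul_assoc[symmetric] z(2))
    ultimately have "(e, g ** y) \<in> green_L M" unfolding L using mult[OF g(1) z(1)] by blast
    then show ?thesis unfolding S y(2) translate_null_space[OF g(2)] by blast
  qed
  show ?thesis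
  proof (rule family_submanifolds[where s = "-1" and origin = "diag_mat J" and sp = null_space, OF M(2) b(1) _ _ E])
    show "card (- J) = CARD('n) - rank e" using b(2) by (simp add: Compl_eq_Diff_UNIV card_Diff_subset)
    show "idempotents (L_class M e) \<noteq> {}" using idem[of e] e by blast
    show "translate (null_space x) ?b' = graph_subspace (- J) (?\<beta> x)" if "x \<in> idempotents (L_class M e)" for x
    proof -
      have "w v* (b ** x) = 0 \<longleftrightarrow> w v* c x = 0" for w
        unfolding c_def vector_matrix_mul_assoc[of w "b ** x" ?b', symmetric]
        using det_matrix_inv[OF b(1)] det_nz_iff_row_kernel by (metis vector_matrix_mult_0)
      moreover have "w \<in> graph_subspace (- J) (?\<beta> x) \<longleftrightarrow> w v* c x = 0" for w
        unfolding graph_subspace_iff x0[OF that] vector_matrix_mult_diff_rdistrib by simp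
      ultimately have "w \<in> null_space (b ** x) \<longleftrightarrow> w \<in> graph_subspace (- J) (?\<beta> x)" for w
        unfolding null_space_def mem_Collect_eq by metis
      then show ?thesis
        unfolding translate_null_space[OF b(1)] by (rule set_eqI)
    qed
    show "null_space ` idempotents (L_class M e) \<subseteq> G_r M e"
      unfolding S L using idem e(1) by blast
    show "\<exists>f\<in>idempotents (L_class M e). W = null_space f"
      if W: "W \<in> G_r M e" "translate W ?b' \<inter> coord_space (- (- J)) = {0}" for W
    proof -
      obtain y where y: "W = null_space y" "y \<in> M" "y ** e = y" using W(1) unfolding S L by blast
      have "det (e ** y + mat 1 - e) \<noteq> 0"
        unfolding det_nz_iff_row_kernel
      proof (intro allI impI)
        fix v assume "v v* (e ** y + mat 1 - e) = 0"
        then have v: "v v* (e ** y) + v - v v* e = 0"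
          by (simp add: vector_matrix_mult_diff_rdistrib vector_matrix_mult_add_rdistrib)
        have "(v v* (e ** y) + v - v v* e) v* e = v v* (e ** (y ** e)) + v v* e - v v* (e ** e)"
          by (simp only: vector_matrix_left_distrib vector_matrix_mult_diff_distrib vector_matrix_mul_assoc matrix_mul_assoc)
        then have "(v v* e) v* y = 0" unfolding v by (simp add: y(3) e(2) vector_matrix_mul_assoc)
        then have "(v v* e) v* ?b' \<in> translate W ?b'" by (auto simp: translate_def y(1) null_space_def)
        moreover have "(v v* e) v* ?b' = (v v* ?b') v* diag_mat J" by (simp add: vector_matrix_mul_assoc eb')
        then have "(v v* e) v* ?b' \<in> coord_space (- (- J))" by (simp add: vec_diag_mat)
        ultimately have "(v v* e) v* ?b' = 0" using W(2) by blast
        then have "v v* e = 0" using det_matrix_inv[OF b(1)] det_nz_iff_row_kernel by blast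
        then show "v = 0" using v by (simp add: vector_matrix_mul_assoc[symmetric])
      qed
      from idempotent_slice_left[OF M(1,3) e y(2,3) this] obtain f h k
        where f: "f \<in> M" "f ** e = f" "e ** f = e" "y = f ** h" "f = y ** k" by blast
      then show ?thesis using idem null_space_eqI[OF f(4,5)] y(1) by blast
    qed
    show "\<exists>g. det g \<noteq> 0 \<and> (\<forall>W'. W' \<in> G_r M e \<longleftrightarrow> translate W' g \<in> G_r M e) \<and>
        (\<exists>f\<in>idempotents (L_class M e). p f \<noteq> 0 \<and> translate W g = null_space f)"
      if W: "W \<in> G_r M e" and p: "entry_polynomial p" "u \<in> idempotents (L_class M e)" "p u \<noteq> 0" for W p u
    proof -
      obtain y z where y: "W = null_space y" "y \<in> M" "y ** e = y" "z \<in> M" "z ** y = e"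
        using W unfolding S L by blast
      obtain g f h k where g: "g \<in> M" "det g \<noteq> 0"
        and f: "f \<in> M" "f ** e = f" "e ** f = e" "p f \<noteq> 0" "g ** y = f ** h" "f = g ** y ** k"
        using generic_unit_left[OF M(1,3,4) e y(2-5) _ _ _ p(1,3)] p(2) unfolding idem by blast
      have g': "matrix_inv g \<in> M" "det (matrix_inv g) \<noteq> 0"
        using regular_unit_inverse[OF M(3) g] det_matrix_inv[OF g(2)] by auto
      have iff: "W' \<in> G_r M e \<longleftrightarrow> translate W' (matrix_inv g) \<in> G_r M e" for W'
      proof
        assume "translate W' (matrix_inv g) \<in> G_r M e"
        from unit[OF g' this] show "W' \<in> G_r M e"
          by (simp add: translate_translate matrix_inv_props[OF g'(2)])
      qed (rule unit[OF g])
      have "translate W (matrix_inv g) = null_space f"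
        unfolding y(1) translate_null_space[OF g(2)] by (rule null_space_eqI[OF f(5,6)])
      then show ?thesis using g'(2) iff f(1-4) idem by blast
    qed
  qed simp
qed

text \<open>Here the idempotents differ from \<open>e\<close> in the block \<open>J \<times> (- J)\<close>, and the conjugate of such an \<open>x\<close> is
  the matrix \<open>graph_matrix\<close> whose row space is the graph of the block, without a change of sign.\<close>

lemma R_family:
  fixes M :: "(complex^'n^'n) set"
  assumes M: "matrix_submonoid M" "algebraic_set M" "regular_monoid M" "units_dense M"
    and e: "e \<in> M" "e ** e = e"
  shows "\<exists>d. embedded_submanifold matrix_manifold d (idempotents (R_class M e)) \<and>
    embedded_submanifold (grassmann_manifold (rank e)) d (G_l M e)"
proof -
  have mult: "\<And>x y. x \<in> M \<Longrightarrow> y \<in> M \<Longrightarrow> x ** y \<in> M" using M by (auto simp: matrix_submonoid_def)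
  obtain b J where b: "det b \<noteq> 0" "card J = rank e" "b ** e ** matrix_inv b = diag_mat J"
    and eb': "e ** matrix_inv b = matrix_inv b ** diag_mat J"
    using idempotent_diagonalizable[OF e(2)] by blast
  let ?b' = "matrix_inv b"
  define c where "c x = b ** x ** ?b'" for x
  note conj = conjugation[OF b(1), folded c_def] and ce = b(3)[folded c_def]
  let ?\<beta> = "\<lambda>x. flatten (\<chi> i j. 1 * (b ** x ** ?b' - diag_mat J) $ i $ j)"
  have E: "idempotents (R_class M e) = {x \<in> M. ?\<beta> x \<in> coord_space (J \<times> - J)}"
  proof -
    have "e ** x = x \<and> x ** e = e \<longleftrightarrow> ?\<beta> x \<in> coord_space (J \<times> - J)" for x
    proof -
      have "e ** x = x \<and> x ** e = e \<longleftrightarrow> diag_mat J ** c x = c x \<and> c x ** diag_mat J = diag_mat J"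
        unfolding ce[symmetric] conj(1)[symmetric] conj(2) ..
      also have "\<dots> \<longleftrightarrow> (\<forall>i j. i \<notin> J \<or> j \<in> J \<longrightarrow> c x $ i $ j = diag_mat J $ i $ j)"
        unfolding vec_eq_iff mult_diag_mat diag_mat_mult
        by (auto simp: diag_mat_def split: if_splits)
      also have "\<dots> \<longleftrightarrow> ?\<beta> x \<in> coord_space (J \<times> - J)"
        unfolding c_def[symmetric] by (auto simp: coord_space_def flatten_def)
      finally show ?thesis .
    qed
    then show ?thesis unfolding idempotents_R_class[OF M(1) e] by auto
  qed
  have x0: "graph_matrix J (?\<beta> x) = c x" if "x \<in> idempotents (R_class M e)" for x
    using that unfolding E c_def[symmetric]
    by (auto simp: coord_space_def flatten_def graph_matrix_def vec_eq_iff diag_mat_def)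
  have R: "(e, y) \<in> green_R M \<longleftrightarrow> y \<in> M \<and> e ** y = y \<and> (\<exists>z\<in>M. y ** z = e)" for y
    by (rule R_class_idempotent[OF M(1) e])
  have S: "G_l M e = range_space ` {y. (e, y) \<in> green_R M}" by (rule G_l_via_R_class[OF M(1) e(1)])
  have idem: "f \<in> idempotents (R_class M e) \<longleftrightarrow> f \<in> M \<and> e ** f = f \<and> f ** e = e" for f
    unfolding idempotents_R_class[OF M(1) e] by blast
  have unit: "translate W g \<in> G_l M e" if g: "g \<in> M" "det g \<noteq> 0" and W: "W \<in> G_l M e" for g W
  proof -
    obtain y where y: "(e, y) \<in> green_R M" "W = range_space y" using W unfolding S by blast
    obtain z where z: "y \<in> M" "e ** y = y" "z \<in> M" "y ** z = e" using y(1) unfolding R by blast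
    have "(y ** g) ** (matrix_inv g ** z) = y ** (g ** matrix_inv g) ** z" by (simp only: matrix_mul_assoc)
    then have "(y ** g) ** (matrix_inv g ** z) = e" by (simp add: matrix_inv_props[OF g(2)] z)
    moreover have "matrix_inv g ** z \<in> M" using mult z(3) regular_unit_inverse[OF M(3) g] by blast
    moreover have "e ** (y ** g) = y ** g" by (simp add: matrix_mul_assoc z(2))
    ultimately have "(e, y ** g) \<in> green_R M" unfolding R using mult[OF z(1) g(1)] by blast
    then show ?thesis unfolding S y(2) translate_range_space by blast
  qed
  show ?thesis
  proof (rule family_submanifolds[where s = 1 and origin = "diag_mat J" and sp = range_space, OF M(2) b(1) _ b(2) E])
    show "idempotents (R_class M e) \<noteq> {}" using idem[of e] e by blast
    show "translate (range_space x) ?b' = graph_subspace J (?\<beta> x)" if "x \<in> idempotents (R_class M e)" for x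
    proof -
      have "translate (range_space x) ?b' = range_space (c x)"
        unfolding translate_range_space c_def
        using range_space_mult_left[OF b(1), of "x ** ?b'"] by (simp add: matrix_mul_assoc)
      also have "\<dots> = graph_subspace J (?\<beta> x)"
        unfolding x0[OF that, symmetric] by (rule range_graph_matrix)
      finally show ?thesis .
    qed
    show "range_space ` idempotents (R_class M e) \<subseteq> G_l M e"
      unfolding S R using idem e(1) by blast
    show "\<exists>f\<in>idempotents (R_class M e). W = range_space f"
      if W: "W \<in> G_l M e" "translate W ?b' \<inter> coord_space (- J) = {0}" for W
    proof -
      obtain y z where y: "W = range_space y" "y \<in> M" "e ** y = y" "y ** z = e" using W(1) unfolding S R by blast
      have "det (y ** e + mat 1 - e) \<noteq> 0"
        unfolding det_nz_iff_row_kernel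
      proof (intro allI impI)
        fix v assume "v v* (y ** e + mat 1 - e) = 0"
        then have v: "v v* (y ** e) + v - v v* e = 0"
          by (simp add: vector_matrix_mult_diff_rdistrib vector_matrix_mult_add_rdistrib)
        have "(v v* (y ** e) + v - v v* e) v* e = v v* (y ** (e ** e)) + v v* e - v v* (e ** e)"
          by (simp only: vector_matrix_left_distrib vector_matrix_mult_diff_distrib vector_matrix_mul_assoc matrix_mul_assoc)
        then have ye: "v v* (y ** e) = 0" unfolding v by (simp add: e(2))
        have "((v v* y) v* ?b') v* diag_mat J = (v v* (y ** e)) v* ?b'"
          by (simp only: vector_matrix_mul_assoc matrix_mul_assoc[symmetric] eb')
        then have "coord_proj J ((v v* y) v* ?b') = 0" unfolding ye by (simp add: vec_diag_mat)
        then have "(v v* y) v* ?b' \<in> coord_space (- J)"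
          unfolding coord_space_def coord_proj_def vec_eq_iff by (auto split: if_splits)
        moreover have "(v v* y) v* ?b' \<in> translate W ?b'" by (auto simp: translate_def y(1) range_space_def)
        ultimately have "(v v* y) v* ?b' = 0" using W(2) by blast
        then have "v v* y = 0" using det_matrix_inv[OF b(1)] det_nz_iff_row_kernel by blast
        then have "v v* e = 0" unfolding y(4)[symmetric] by (simp add: vector_matrix_mul_assoc[symmetric])
        then show "v = 0" using v ye by simp
      qed
      from idempotent_slice_right[OF M(1,3) e y(2,3) this] obtain f h k
        where f: "f \<in> M" "e ** f = f" "f ** e = e" "y = h ** f" "f = k ** y" by blast
      then show ?thesis using idem range_space_eqI[OF f(4,5)] y(1) by blast
    qed
    show "\<exists>g. det g \<noteq> 0 \<and> (\<forall>W'. W' \<in> G_l M e \<longleftrightarrow> translate W' g \<in> G_l M e) \<and>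
        (\<exists>f\<in>idempotents (R_class M e). p f \<noteq> 0 \<and> translate W g = range_space f)"
      if W: "W \<in> G_l M e" and p: "entry_polynomial p" "u \<in> idempotents (R_class M e)" "p u \<noteq> 0" for W p u
    proof -
      obtain y z where y: "W = range_space y" "y \<in> M" "e ** y = y" "z \<in> M" "y ** z = e"
        using W unfolding S R by blast
      obtain g f h k where g: "g \<in> M" "det g \<noteq> 0"
        and f: "f \<in> M" "e ** f = f" "f ** e = e" "p f \<noteq> 0" "y ** g = h ** f" "f = k ** (y ** g)"
        using generic_unit_right[OF M(1,3,4) e y(2-5) _ _ _ p(1,3)] p(2) unfolding idem by blast
      have g': "matrix_inv g \<in> M" "det (matrix_inv g) \<noteq> 0"
        using regular_unit_inverse[OF M(3) g] det_matrix_inv[OF g(2)] by auto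
      have iff: "W' \<in> G_l M e \<longleftrightarrow> translate W' g \<in> G_l M e" for W'
      proof
        assume "translate W' g \<in> G_l M e"
        from unit[OF g' this] show "W' \<in> G_l M e"
          by (simp add: translate_translate matrix_inv_props[OF g(2)])
      qed (rule unit[OF g])
      have "translate W g = range_space f"
        unfolding y(1) translate_range_space by (rule range_space_eqI[OF f(5,6)])
      then show ?thesis using g(2) iff f(1-4) idem by blast
    qed
  qed simp
qed

theorem theorem5p7:
  fixes M :: "(complex^'n^'n) set" and e :: "complex^'n^'n"
  assumes "algebraic_submonoid M"
    and "irreducible_set M"
    and "regular_monoid M"
    and "e \<in> M"
    and "e ** e = e"
  shows "(is_submanifold matrix_manifold (idempotents (L_class M e)) \<and>
          is_submanifold (grassmann_manifold (CARD('n) - rank e)) (G_r M e) \<and>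
          manifold_dim matrix_manifold (idempotents (L_class M e)) =
          manifold_dim (grassmann_manifold (CARD('n) - rank e)) (G_r M e)) \<and>
         (is_submanifold matrix_manifold (idempotents (R_class M e)) \<and>
          is_submanifold (grassmann_manifold (rank e)) (G_l M e) \<and>
          manifold_dim matrix_manifold (idempotents (R_class M e)) =
          manifold_dim (grassmann_manifold (rank e)) (G_l M e))"
proof -
  have M: "matrix_submonoid M" "algebraic_set M" using assms(1) by (auto simp: algebraic_submonoid_def)
  then have "mat 1 \<in> M" by (simp add: matrix_submonoid_def)
  then have dense: "units_dense M" using irreducible_units_dense M(2) assms(2) by blast
  have eL: "e \<in> idempotents (L_class M e)" and eR: "e \<in> idempotents (R_class M e)"
    unfolding idempotents_L_class[OF M(1) assms(4,5)] idempotents_R_class[OF M(1) assms(4,5)]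
    using assms(4,5) by auto
  have "(e, e) \<in> green_L M" "(e, e) \<in> green_R M" using assms(4) by (auto simp: green_L_def green_R_def)
  then have ne: "G_r M e \<noteq> {}" "G_l M e \<noteq> {}"
    unfolding G_r_via_L_class[OF M(1) assms(4)] G_l_via_R_class[OF M(1) assms(4)] by auto
  obtain d where d: "embedded_submanifold matrix_manifold d (idempotents (L_class M e))"
    "embedded_submanifold (grassmann_manifold (CARD('n) - rank e)) d (G_r M e)"
    using L_family[OF M assms(3) dense assms(4,5)] by blast
  obtain d' where d': "embedded_submanifold matrix_manifold d' (idempotents (R_class M e))"
    "embedded_submanifold (grassmann_manifold (rank e)) d' (G_l M e)"
    using R_family[OF M assms(3) dense assms(4,5)] by blast
  have "manifold_dim matrix_manifold (idempotents (L_class M e)) = d"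
    "manifold_dim matrix_manifold (idempotents (R_class M e)) = d'"
    using manifold_dim_eqI[OF is_manifold_matrix] d(1) d'(1) eL eR by blast+
  moreover have "manifold_dim (grassmann_manifold (CARD('n) - rank e)) (G_r M e) = d"
    "manifold_dim (grassmann_manifold (rank e)) (G_l M e) = d'"
    using manifold_dim_eqI[OF is_manifold_grassmann] d(2) d'(2) ne by blast+
  ultimately show ?thesis using d d' unfolding is_submanifold_def by auto
qed

end
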